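(* Let $k$ be a field of characteristic zero, $\mathfrak g$ a Lie algebra over $k$, $S=S\mathfrak g$ its symmetric algebra, $a\in S$ and $p\ge1$. Let $F:S\to S$ be one of the maps $b\mapsto B_p(a,b)$ or $b\mapsto B_p(b,a)$, where $B_p$ is the operator defined in the context. Then $F$ is a differential operator of order $\le p$.
   Context: **The operators $B_p$.** Let $k$ be a field of characteristic zero and $\mathfrak g$ a (possibly infinite dimensional) Lie algebra over $k$, with symmetric algebra $S=S\mathfrak g=\bigoplus_{d\ge0}S^d$ and universal enveloping algebra $U=U\mathfrak g$. The symmetrization map is the $k$-linear isomorphism $e:S\to U$ given by $e(g_1\cdots g_d)=\frac1{d!}\sum_{\sigma\in S_d} g_{\sigma(1)}\cdots g_{\sigma(d)}$ for $g_1,\dots,g_d\in\mathfrak g$ (in the summation index $S_d$ denotes the symmetric group; $e(1)=1$). Define $B:S\otimes_kS\to S$ by $B(x,y)=e^{-1}(e(x)e(y))$. Then $B=\sum_{p\ge0}B_p$, where $B_p$ is the homogeneous component of degree $-p$ of $B$, i.e. $B_p$ maps $S^a\otimes S^b$ to $S^{a+b-p}$ (with $S^d=0$ for $d<0$). **Differential operators.** A $k$-linear endomorphism $F$ of a commutative associative $k$-algebra $\mathcal A$ is a differential operator of order $\le p$ if $$\sum_{T\subset\{1,\dots,p+1\}}(-1)^{\#T}\,a_{T^c}\,F(a_T\,b)=0\qquad\text{for all }a_1,\dots,a_{p+1},b\in\mathcal A,$$ where $a_T=\prod_{i\in T}a_i$ (with $a_\emptyset=1$) and $T^c$ is the complement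 of $T$ in $\{1,\dots,p+1\}$. *)

theory Defs
  imports
    "HOL-Algebra.Algebraic_Closure_Type"
    "HOL-Library.Poly_Mapping"
    "HOL-Combinatorics.Permutations"
begin

section \<open>Lie algebras\<close>

locale lie_algebra = vector_space scale
  for scale :: "'k::field \<Rightarrow> 'g::ab_group_add \<Rightarrow> 'g" +
  fixes bracket :: "'g \<Rightarrow> 'g \<Rightarrow> 'g"
  assumes bracket_linear_right: "Vector_Spaces.linear scale scale (\<lambda>y. bracket x y)"
    and bracket_linear_left: "Vector_Spaces.linear scale scale (\<lambda>x. bracket x y)"
    and bracket_self: "bracket x x = 0"
    and jacobi: "bracket x (bracket y z) + bracket y (bracket z x) + bracket z (bracket x y) = 0"

section \<open>Associative algebras presented by generators and relations\<close>

text \<open>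
  Words form the free monoid on \<open>'g\<close>, written additively so that \<open>'g word \<Rightarrow>\<^sub>0 'k\<close>, with the
  convolution product of the library, is the free associative unital \<open>'k\<close>-algebra on the set \<open>'g\<close>.
\<close>

datatype 'g word = Word (letters: "'g list")

instantiation word :: (type) monoid_add
begin

definition zero_word :: "'a word" where
  "0 = Word []"

definition plus_word :: "'a word \<Rightarrow> 'a word \<Rightarrow> 'a word" where
  "v + w = Word (letters v @ letters w)"

instance
  by standard (simp_all add: zero_word_def plus_word_def)

end

type_synonym ('k, 'g) free_alg = "'g word \<Rightarrow>\<^sub>0 'k"

abbreviation free_ring :: "('k::field, 'g) free_alg ring" where
  "free_ring \<equiv> ring_of_type_algebra"

definition free_const :: "'k::field \<Rightarrow> ('k, 'g) free_alg" where
  "free_const c = Poly_Mapping.single 0 c"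

definition letter :: "'g \<Rightarrow> ('k::field, 'g) free_alg" where
  "letter x = Poly_Mapping.single (Word [x]) 1"

definition quot_alg :: "('k::field, 'g) free_alg set \<Rightarrow> ('k, ('k, 'g) free_alg set) module" where
  "quot_alg I = ring.extend (free_ring Quot I)
     (module.fields (\<lambda>c u. (I +>\<^bsub>free_ring\<^esub> free_const c) \<otimes>\<^bsub>free_ring Quot I\<^esub> u))"

text \<open>
  Modulo these relations the free algebra on the set \<open>'g\<close> becomes the tensor algebra of the vector
  space \<open>'g\<close>.
\<close>

definition tensor_rels ::
  "('k::field \<Rightarrow> 'g::ab_group_add \<Rightarrow> 'g) \<Rightarrow> ('k, 'g) free_alg set" where
  "tensor_rels scale =
     {letter (x + y) - (letter x + letter y) |x y. True} \<union>
     {letter (scale c x) - free_const c * letter x |c x. True}"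

definition sym_ideal ::
  "('k::field \<Rightarrow> 'g::ab_group_add \<Rightarrow> 'g) \<Rightarrow> ('k, 'g) free_alg set" where
  "sym_ideal scale = Idl\<^bsub>free_ring\<^esub>
     (tensor_rels scale \<union> {letter x * letter y - letter y * letter x |x y. True})"

definition env_ideal ::
  "('k::field \<Rightarrow> 'g::ab_group_add \<Rightarrow> 'g) \<Rightarrow> ('g \<Rightarrow> 'g \<Rightarrow> 'g) \<Rightarrow> ('k, 'g) free_alg set" where
  "env_ideal scale bracket = Idl\<^bsub>free_ring\<^esub>
     (tensor_rels scale \<union>
      {letter x * letter y - letter y * letter x - letter (bracket x y) |x y. True})"

definition sym_alg ::
  "('k::field \<Rightarrow> 'g::ab_group_add \<Rightarrow> 'g) \<Rightarrow> ('k, ('k, 'g) free_alg set) module" where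
  "sym_alg scale = quot_alg (sym_ideal scale)"

definition env_alg ::
  "('k::field \<Rightarrow> 'g::ab_group_add \<Rightarrow> 'g) \<Rightarrow> ('g \<Rightarrow> 'g \<Rightarrow> 'g) \<Rightarrow>
    ('k, ('k, 'g) free_alg set) module" where
  "env_alg scale bracket = quot_alg (env_ideal scale bracket)"

definition sym_gen ::
  "('k::field \<Rightarrow> 'g::ab_group_add \<Rightarrow> 'g) \<Rightarrow> 'g \<Rightarrow> ('k, 'g) free_alg set" where
  "sym_gen scale x = sym_ideal scale +>\<^bsub>free_ring\<^esub> letter x"

definition env_gen ::
  "('k::field \<Rightarrow> 'g::ab_group_add \<Rightarrow> 'g) \<Rightarrow> ('g \<Rightarrow> 'g \<Rightarrow> 'g) \<Rightarrow> 'g \<Rightarrow> ('k, 'g) free_alg set" where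
  "env_gen scale bracket x = env_ideal scale bracket +>\<^bsub>free_ring\<^esub> letter x"

section \<open>Symmetrization\<close>

definition list_prod :: "('a, 'm) monoid_scheme \<Rightarrow> 'a list \<Rightarrow> 'a" where
  "list_prod G xs = foldr (\<otimes>\<^bsub>G\<^esub>) xs \<one>\<^bsub>G\<^esub>"

definition klinear ::
  "('k, 'a, 'm) module_scheme \<Rightarrow> ('k, 'b, 'n) module_scheme \<Rightarrow> ('a \<Rightarrow> 'b) \<Rightarrow> bool" where
  "klinear M N f \<longleftrightarrow>
     f \<in> carrier M \<rightarrow> carrier N \<and>
     (\<forall>x\<in>carrier M. \<forall>y\<in>carrier M. f (x \<oplus>\<^bsub>M\<^esub> y) = f x \<oplus>\<^bsub>N\<^esub> f y) \<and>
     (\<forall>c. \<forall>x\<in>carrier M. f (c \<odot>\<^bsub>M\<^esub> x) = c \<odot>\<^bsub>N\<^esub> f x)"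

text \<open>
  \<open>extensional\<close> only fixes the values outside of the carrier, to make the map unique as a function
  on the whole type.
\<close>

definition symmetrization ::
  "('k::field_char_0 \<Rightarrow> 'g::ab_group_add \<Rightarrow> 'g) \<Rightarrow> ('g \<Rightarrow> 'g \<Rightarrow> 'g) \<Rightarrow>
    ('k, 'g) free_alg set \<Rightarrow> ('k, 'g) free_alg set" where
  "symmetrization scale bracket =
     (let S = sym_alg scale; U = env_alg scale bracket in
      THE e. e \<in> extensional (carrier S) \<and> klinear S U e \<and>
        (\<forall>gs. e (list_prod S (map (sym_gen scale) gs)) =
           (1 / fact (length gs)) \<odot>\<^bsub>U\<^esub>
             (\<Oplus>\<^bsub>U\<^esub>\<sigma>\<in>{\<sigma>. \<sigma> permutes {..<length gs}}.
                list_prod U (map (env_gen scale bracket) (permute_list \<sigma> gs)))))"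

definition B_op ::
  "('k::field_char_0 \<Rightarrow> 'g::ab_group_add \<Rightarrow> 'g) \<Rightarrow> ('g \<Rightarrow> 'g \<Rightarrow> 'g) \<Rightarrow>
    ('k, 'g) free_alg set \<Rightarrow> ('k, 'g) free_alg set \<Rightarrow> ('k, 'g) free_alg set" where
  "B_op scale bracket x y =
     (let e = symmetrization scale bracket in
      the_inv_into (carrier (sym_alg scale)) e (e x \<otimes>\<^bsub>env_alg scale bracket\<^esub> e y))"

section \<open>Homogeneous components\<close>

definition sym_degree ::
  "('k::field \<Rightarrow> 'g::ab_group_add \<Rightarrow> 'g) \<Rightarrow> nat \<Rightarrow> ('k, 'g) free_alg set set" where
  "sym_degree scale d =
     {sym_ideal scale +>\<^bsub>free_ring\<^esub> f |f. \<forall>w\<in>Poly_Mapping.keys f. length (letters w) = d}"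

definition sym_component ::
  "('k::field \<Rightarrow> 'g::ab_group_add \<Rightarrow> 'g) \<Rightarrow> ('k, 'g) free_alg set \<Rightarrow> nat \<Rightarrow>
    ('k, 'g) free_alg set" where
  "sym_component scale x =
     (let S = sym_alg scale in
      THE c. (\<forall>d. c d \<in> sym_degree scale d) \<and> finite {d. c d \<noteq> \<zero>\<^bsub>S\<^esub>} \<and>
        x = (\<Oplus>\<^bsub>S\<^esub>d\<in>{d. c d \<noteq> \<zero>\<^bsub>S\<^esub>}. c d))"

text \<open>
  On \<open>S\<^sup>m \<otimes> S\<^sup>n\<close> the component \<open>B\<^sub>p\<close> is the part of \<open>B\<close> of degree \<open>m + n - p\<close>. It vanishes if
  \<open>m + n < p\<close>; those pairs are excluded because of the truncated subtraction on natural numbers.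
\<close>

definition B_comp ::
  "('k::field_char_0 \<Rightarrow> 'g::ab_group_add \<Rightarrow> 'g) \<Rightarrow> ('g \<Rightarrow> 'g \<Rightarrow> 'g) \<Rightarrow> nat \<Rightarrow>
    ('k, 'g) free_alg set \<Rightarrow> ('k, 'g) free_alg set \<Rightarrow> ('k, 'g) free_alg set" where
  "B_comp scale bracket p x y =
     (let S = sym_alg scale; \<pi> = sym_component scale in
      finsum S (\<lambda>(m, n). \<pi> (B_op scale bracket (\<pi> x m) (\<pi> y n)) (m + n - p))
        {(m, n). \<pi> x m \<noteq> \<zero>\<^bsub>S\<^esub> \<and> \<pi> y n \<noteq> \<zero>\<^bsub>S\<^esub> \<and> p \<le> m + n})"

section \<open>Differential operators\<close>

definition diff_op :: "('k::field, 'a, 'm) module_scheme \<Rightarrow> nat \<Rightarrow> ('a \<Rightarrow> 'a) \<Rightarrow> bool" where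
  "diff_op A p F \<longleftrightarrow>
     klinear A A F \<and>
     (\<forall>a \<in> {1..p+1} \<rightarrow> carrier A. \<forall>b \<in> carrier A.
        (\<Oplus>\<^bsub>A\<^esub>T\<in>Pow {1..p+1}.
           ((- 1) ^ card T) \<odot>\<^bsub>A\<^esub>
             ((\<Otimes>\<^bsub>A\<^esub>i\<in>{1..p+1} - T. a i) \<otimes>\<^bsub>A\<^esub> F ((\<Otimes>\<^bsub>A\<^esub>i\<in>T. a i) \<otimes>\<^bsub>A\<^esub> b)))
        = \<zero>\<^bsub>A\<^esub>)"

end

theory Submission
  imports Defs "HOL-Computational_Algebra.Formal_Power_Series"
begin

text \<open>
  For a power \<open>y\<^sup>d\<close> of a vector the symmetrization is \<open>e(y\<^sup>d) = e(y)\<^sup>d\<close>, so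
  \<open>B(y\<^sup>d, b) = L\<^sub>y\<^sup>d b\<close>, where \<open>L\<^sub>x = B(x, -)\<close> is left multiplication by a vector, carried over
  from \<open>U\<close> to \<open>S\<close>. Put \<open>y\<^bsup>[n]\<^esup> = y\<^sup>n / n!\<close> and let \<open>c\<^sub>p\<close> be the coefficients of
  \<open>\<phi>(t) = t / (e\<^sup>t - 1)\<close>. Moving the letter \<open>x\<close> through the letters \<open>y\<close> shows that
  \<open>L\<^sub>x = \<Sum>\<^sub>p c\<^sub>p E\<^sub>p(x)\<close>, where \<open>E\<^sub>p(x)\<close> sends \<open>y\<^bsup>[n]\<^esup>\<close> to \<open>ad(y)\<^sup>p(x) y\<^bsup>[n-p]\<^esup>\<close>. The
  operator \<open>E\<^sub>p(x)\<close> differentiates \<open>p\<close> times and then multiplies by a vector; hence it lowers the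
  degree by \<open>p - 1\<close> and has order at most \<open>p\<close> (lemma \<open>dorder_eop\<close>). The part of \<open>L\<^sub>y\<^sup>d\<close> that maps
  degree \<open>n\<close> to degree \<open>n + d - p\<close> is the sum of the products \<open>\<Prod>\<^sub>i c\<^sub>q\<^sub>i E\<^sub>q\<^sub>i(y)\<close> over
  \<open>q\<^sub>1 + \<dots> + q\<^sub>d = p\<close>, and orders add up under composition, so it has order at most \<open>p\<close>
  (\<open>dorder_lop_comp\<close>). By polarization the powers \<open>y\<^sup>d\<close> span \<open>S\<^sup>d\<close> in characteristic zero, and
  \<open>B\<^sub>p(a, b)\<close> is linear in \<open>a\<close>. For \<open>B\<^sub>p(b, a)\<close> the same argument applies to the opposite Lie
  algebra, because reversing words fixes symmetrized words.

  The definition of \<open>B\<close> presupposes that \<open>e\<close> is bijective, which is the theorem of Poincare,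
  Birkhoff and Witt. The same operators prove it: \<open>L\<close> is defined on \<open>S\<close> by the formula above, and
  the addition theorem of the exponential function, in the form of the identity \<open>bern_identity\<close>
  between the \<open>c\<^sub>p\<close>, yields \<open>[L\<^sub>z, L\<^sub>x] = L\<^bsub>[z,x]\<^esub>\<close> (\<open>lop_commutator\<close>). So \<open>U\<close> acts on \<open>S\<close>, and
  \<open>u \<mapsto> u 1\<close> inverts \<open>e\<close>: it is a left inverse because \<open>L\<^sub>y y\<^sup>n = y\<^bsup>n+1\<^esup>\<close> (\<open>act_symz\<close>), and \<open>e\<close> is
  onto because \<open>x e(s) = e(L\<^sub>x s)\<close> (\<open>symz_lop\<close>, \<open>symz_surj\<close>).

  Classes in \<open>S\<close> and \<open>U\<close> are handled through representatives in the free
  algebra. The algebra \<open>S\<close> is identified with a polynomial ring in the vectors of a basis, by the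
  map \<open>poly_of\<close> with kernel \<open>sym_ideal\<close>, so that operators on \<open>S\<close> become functions on a type of
  class \<open>comm_ring_1\<close>.
\<close>

abbreviation "lookup \<equiv> Poly_Mapping.lookup"
abbreviation "keys \<equiv> Poly_Mapping.keys"

section \<open>Linear maps between free modules\<close>

text \<open>
  Multiplication by \<open>cst c\<close> is scalar multiplication by \<open>c\<close>, in the free algebra as well as in
  polynomial rings and even for the finitely supported functions on the vector space itself.
\<close>

definition cst :: "'k::field \<Rightarrow> ('b::monoid_add \<Rightarrow>\<^sub>0 'k)" where
  "cst c = Poly_Mapping.single 0 c"

lemma cst_0 [simp]: "cst 0 = 0" and cst_1 [simp]: "cst 1 = 1"
  by (simp_all add: cst_def)

lemma cst_add: "cst (a + b) = cst a + cst b"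
  by (simp add: cst_def single_add)

lemma cst_diff: "cst (a - b) = cst a - cst b"
  by (simp add: cst_def single_diff)

lemma cst_uminus: "cst (- a) = - cst a"
  by (simp add: cst_def single_uminus)

lemma cst_mult: "cst (a * b) = cst a * cst b"
  by (simp add: cst_def mult_single)

lemma cst_sum: "cst (sum f A) = (\<Sum>i\<in>A. cst (f i))"
  by (induction A rule: infinite_finite_induct) (simp_all add: cst_add)

lemma cst_of_nat: "cst (of_nat n) = of_nat n"
  by (simp add: cst_def)

lemma cst_cancel: "c \<noteq> 0 \<Longrightarrow> cst (1 / c) * (cst c * f) = f"
  by (simp add: mult.assoc[symmetric] cst_mult[symmetric])

lemma lookup_cst_mult [simp]: "lookup (cst c * f) k = c * lookup f k"
  unfolding cst_def mult_map_scale_conv_mult[symmetric] by (simp add: Poly_Mapping.map.rep_eq when_def)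

lemma poly_mapping_sum_single:
  fixes f :: "'a \<Rightarrow>\<^sub>0 'b::comm_monoid_add"
  shows "f = (\<Sum>k\<in>keys f. Poly_Mapping.single k (lookup f k))"
  by (rule poly_mapping_eqI)
     (auto simp: lookup_sum lookup_single when_def sum.delta in_keys_iff)

lemma poly_mapping_single_induct [case_names zero single add]:
  fixes f :: "'a \<Rightarrow>\<^sub>0 'b::comm_monoid_add"
  assumes "P 0" "\<And>k c. P (Poly_Mapping.single k c)" "\<And>f g. P f \<Longrightarrow> P g \<Longrightarrow> P (f + g)"
  shows "P f"
proof -
  have "P (\<Sum>k\<in>A. Poly_Mapping.single k (lookup f k))" for A
    by (induction A rule: infinite_finite_induct) (use assms in auto)
  from this[of "keys f"] show ?thesis
    using poly_mapping_sum_single[of f, symmetric] by metis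
qed

lemma cst_central: "f * cst c = cst c * f"
proof (induction f rule: poly_mapping_single_induct)
  case (single k c')
  then show ?case by (simp add: cst_def mult_single mult.commute)
qed (simp_all add: algebra_simps)

lemma cst_left_commute: "f * (cst c * g) = cst c * (f * g)"
  by (metis cst_central mult.assoc)

lemma single_eq_cst_mult: "Poly_Mapping.single k c = cst c * Poly_Mapping.single k 1"
  by (simp add: cst_def mult_single)

definition klin :: "(('a::monoid_add \<Rightarrow>\<^sub>0 'k::field) \<Rightarrow> ('b::monoid_add \<Rightarrow>\<^sub>0 'k)) \<Rightarrow> bool" where
  "klin F \<longleftrightarrow> (\<forall>f g. F (f + g) = F f + F g) \<and> (\<forall>c f. F (cst c * f) = cst c * F f)"

lemma klinI:
  "(\<And>f g. F (f + g) = F f + F g) \<Longrightarrow> (\<And>c f. F (cst c * f) = cst c * F f) \<Longrightarrow> klin F"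
  by (simp add: klin_def)

lemma klin_add: "klin F \<Longrightarrow> F (f + g) = F f + F g"
  and klin_cst: "klin F \<Longrightarrow> F (cst c * f) = cst c * F f"
  by (auto simp: klin_def)

lemma klin_0: "klin F \<Longrightarrow> F 0 = 0"
  using klin_cst[of F 0 0] by simp

lemma klin_diff: "klin F \<Longrightarrow> F (f - g) = F f - F g"
  by (metis add_diff_cancel_right' diff_add_cancel klin_add)

lemma klin_sum: "klin F \<Longrightarrow> F (sum f A) = (\<Sum>i\<in>A. F (f i))"
  by (induction A rule: infinite_finite_induct) (simp_all add: klin_0 klin_add)

lemma klin_id: "klin (\<lambda>f. f)" and klin_zero: "klin (\<lambda>f. 0)"
  by (auto simp: klin_def)

lemma klin_compose: "klin F \<Longrightarrow> klin G \<Longrightarrow> klin (\<lambda>f. F (G f))"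
  by (simp add: klin_def)

lemma klin_plus: "klin F \<Longrightarrow> klin G \<Longrightarrow> klin (\<lambda>f. F f + G f)"
  and klin_minus: "klin F \<Longrightarrow> klin G \<Longrightarrow> klin (\<lambda>f. F f - G f)"
  by (simp_all add: klin_def algebra_simps)

lemma klin_setsum: "(\<And>i. i \<in> A \<Longrightarrow> klin (F i)) \<Longrightarrow> klin (\<lambda>f. \<Sum>i\<in>A. F i f)"
  by (induction A rule: infinite_finite_induct) (auto intro!: klin_plus klin_zero)

lemma klin_lmult: "klin F \<Longrightarrow> klin (\<lambda>f. u * F f)"
  by (simp add: klin_def algebra_simps cst_left_commute)

lemma klin_rmult: "klin F \<Longrightarrow> klin (\<lambda>f. F f * u)"
  by (simp add: klin_def algebra_simps)

lemma klin_eqI: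
  assumes "klin F" "klin G" "\<And>k. F (Poly_Mapping.single k 1) = G (Poly_Mapping.single k 1)"
  shows "F f = G f"
proof (induction f rule: poly_mapping_single_induct)
  case (single k c)
  then show ?case
    using assms by (subst (1 2) single_eq_cst_mult) (simp add: klin_cst)
qed (use assms in \<open>simp_all add: klin_0 klin_add\<close>)

text \<open>
  The linear extension of a map given on the basis of a free module.
\<close>

definition lin :: "('a \<Rightarrow> ('b::monoid_add \<Rightarrow>\<^sub>0 'k::field)) \<Rightarrow> ('a \<Rightarrow>\<^sub>0 'k) \<Rightarrow> ('b \<Rightarrow>\<^sub>0 'k)" where
  "lin h f = (\<Sum>k\<in>keys f. cst (lookup f k) * h k)"

lemma lin_superset: "finite A \<Longrightarrow> keys f \<subseteq> A \<Longrightarrow> lin h f = (\<Sum>k\<in>A. cst (lookup f k) * h k)"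
  unfolding lin_def by (rule sum.mono_neutral_left) (auto simp: in_keys_iff)

lemma lin_add: "lin h (f + g) = lin h f + lin h g"
proof -
  let ?A = "keys f \<union> keys g"
  have "lin h (f + g) = (\<Sum>k\<in>?A. cst (lookup (f + g) k) * h k)"
    by (rule lin_superset) (auto simp: keys_add)
  also have "\<dots> = (\<Sum>k\<in>?A. cst (lookup f k) * h k) + (\<Sum>k\<in>?A. cst (lookup g k) * h k)"
    by (simp add: lookup_add cst_add algebra_simps sum.distrib)
  also have "\<dots> = lin h f + lin h g"
    by (simp add: lin_superset[of ?A])
  finally show ?thesis .
qed

lemma lin_cst: "lin h (cst c * f) = cst c * lin h f"
proof -
  have "lin h (cst c * f) = (\<Sum>k\<in>keys f. cst (lookup (cst c * f) k) * h k)"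
    by (rule lin_superset) (auto simp: in_keys_iff)
  then show ?thesis
    by (simp add: lin_def sum_distrib_left cst_mult algebra_simps)
qed

lemma klin_lin: "klin (lin h)"
  by (simp add: klin_def lin_add lin_cst)

lemma lin_single [simp]: "lin h (Poly_Mapping.single k c) = cst c * h k"
  by (cases "c = 0") (simp_all add: lin_def)

definition subsp :: "('b::monoid_add \<Rightarrow>\<^sub>0 'k::field) set \<Rightarrow> bool" where
  "subsp V \<longleftrightarrow> 0 \<in> V \<and> (\<forall>f\<in>V. \<forall>g\<in>V. f + g \<in> V) \<and> (\<forall>c. \<forall>f\<in>V. cst c * f \<in> V)"

lemma subspD:
  assumes "subsp V"
  shows "0 \<in> V" "f \<in> V \<Longrightarrow> g \<in> V \<Longrightarrow> f + g \<in> V" "f \<in> V \<Longrightarrow> cst c * f \<in> V"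
    "f \<in> V \<Longrightarrow> g \<in> V \<Longrightarrow> f - g \<in> V" "(\<And>i. i \<in> A \<Longrightarrow> h i \<in> V) \<Longrightarrow> sum h A \<in> V"
    "f \<in> V \<Longrightarrow> - f \<in> V"
proof -
  show *: "0 \<in> V" "f \<in> V \<Longrightarrow> g \<in> V \<Longrightarrow> f + g \<in> V" "f \<in> V \<Longrightarrow> cst c * f \<in> V" for f g c
    using assms by (auto simp: subsp_def)
  show m: "f \<in> V \<Longrightarrow> - f \<in> V" for f
    using *(3)[of f "-1"] by (simp add: cst_uminus)
  show "f \<in> V \<Longrightarrow> g \<in> V \<Longrightarrow> f - g \<in> V"
    using *(2)[OF _ m, of f g] by simp
  show "(\<And>i. i \<in> A \<Longrightarrow> h i \<in> V) \<Longrightarrow> sum h A \<in> V"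
    by (induction A rule: infinite_finite_induct) (auto intro: *)
qed

lemma klin_span_induct:
  assumes "subsp V" "\<And>k. Poly_Mapping.single k 1 \<in> V"
  shows "f \<in> V"
proof (induction f rule: poly_mapping_single_induct)
  case (single k c)
  then show ?case
    using assms subspD(3)[OF assms(1)] by (subst single_eq_cst_mult) auto
qed (use assms subspD in blast)+

text \<open>
  A curve with polynomial coordinates that stays inside a subspace has its coefficients there:
  \<open>2\<^sup>n f(t) - f(2 t)\<close> is a curve of smaller degree in the subspace.
\<close>

lemma subsp_coeffs:
  fixes v :: "nat \<Rightarrow> ('b::monoid_add \<Rightarrow>\<^sub>0 'k::field_char_0)"
  assumes V: "subsp V" and "\<And>t. (\<Sum>i\<le>n. cst (t ^ i) * v i) \<in> V" and "i \<le> n"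
  shows "v i \<in> V"
  using assms(2,3)
proof (induction n arbitrary: v i)
  case 0
  then show ?case using 0(1)[of 1] by simp
next
  case (Suc n)
  have low: "v j \<in> V" if "j \<le> n" for j
  proof -
    define w where "w = (\<lambda>j. cst (2 ^ Suc n - 2 ^ j) * v j)"
    have "(\<Sum>i\<le>n. cst (t ^ i) * w i) \<in> V" for t
    proof -
      have e: "2 ^ Suc n * t ^ i - (2 * t) ^ i = t ^ i * (2 ^ Suc n - 2 ^ i)" for i
        by (simp add: power_mult_distrib algebra_simps)
      have "cst (2 ^ Suc n) * (\<Sum>i\<le>Suc n. cst (t ^ i) * v i) - (\<Sum>i\<le>Suc n. cst ((2 * t) ^ i) * v i)
         = (\<Sum>i\<le>Suc n. cst (t ^ i) * w i)"
        unfolding w_def sum_distrib_left sum_subtractf[symmetric] mult.assoc[symmetric]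
          cst_mult[symmetric] left_diff_distrib[symmetric] cst_diff[symmetric] e ..
      also have "\<dots> = (\<Sum>i\<le>n. cst (t ^ i) * w i)"
        by (simp add: w_def)
      finally show ?thesis
        using subspD(4)[OF V subspD(3)[OF V Suc.prems(1), of "2 ^ Suc n" t] Suc.prems(1)[of "2 * t"]]
        by simp
    qed
    then have "w j \<in> V" using Suc.IH that by blast
    then have "cst (1 / (2 ^ Suc n - 2 ^ j)) * w j \<in> V"
      using V subspD(3) by blast
    moreover have "(2 ^ Suc n - 2 ^ j :: 'k) \<noteq> 0"
    proof -
      have "(2 ^ Suc n :: nat) \<noteq> 2 ^ j" using that by (simp del: power_Suc)
      then have "(of_nat (2 ^ Suc n) :: 'k) \<noteq> of_nat (2 ^ j)" by (simp only: of_nat_eq_iff not_False_eq_True)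
      then show ?thesis by simp
    qed
    ultimately show ?thesis
      by (simp add: w_def mult.assoc[symmetric] cst_mult[symmetric])
  qed
  have "(\<Sum>i\<le>Suc n. cst (1 ^ i) * v i) \<in> V" using Suc.prems(1)[of 1] .
  then have "(\<Sum>i\<le>n. v i) + v (Suc n) \<in> V" by simp
  moreover have "(\<Sum>i\<le>n. v i) \<in> V" using V low by (intro subspD(5)) auto
  ultimately have "v (Suc n) \<in> V"
    using V by (metis add_diff_cancel_left' subspD(4)[OF V])
  then show ?case using low Suc.prems(2) le_Suc_eq by blast
qed

section \<open>Differential operators by iterated commutators\<close>

text \<open>\<open>dorder n F\<close> is order strictly less than \<open>n\<close>, so that the zero operator starts the recursion.\<close>

fun dorder :: "nat \<Rightarrow> ('a::comm_ring_1 \<Rightarrow> 'a) \<Rightarrow> bool" where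
  "dorder 0 F \<longleftrightarrow> (\<forall>f. F f = 0)"
| "dorder (Suc n) F \<longleftrightarrow> (\<forall>h. dorder n (\<lambda>f. F (h * f) - h * F f))"

lemma dorder_zero: "dorder n (\<lambda>f. 0)"
  by (induction n) auto

lemma dorder_add: "dorder n F \<Longrightarrow> dorder n G \<Longrightarrow> dorder n (\<lambda>f. F f + G f)"
proof (induction n arbitrary: F G)
  case (Suc n)
  have "dorder n (\<lambda>f. (F (h * f) - h * F f) + (G (h * f) - h * G f))" for h
    using Suc by auto
  then show ?case by (simp add: algebra_simps)
qed simp

lemma dorder_mult: "dorder n F \<Longrightarrow> dorder n (\<lambda>f. u * F f)"
proof (induction n arbitrary: F)
  case (Suc n)
  have "dorder n (\<lambda>f. u * (F (h * f) - h * F f))" for h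
    using Suc by auto
  then show ?case by (simp add: algebra_simps)
qed simp

lemma dorder_mult_arg: "dorder n F \<Longrightarrow> dorder n (\<lambda>f. F (u * f))"
proof (induction n arbitrary: F)
  case (Suc n)
  have "dorder n (\<lambda>f. (F (h * (u * f)) - h * F (u * f)))" for h
    using Suc by auto
  then show ?case by (simp add: algebra_simps)
qed simp

lemma dorder_sum: "(\<And>i. i \<in> A \<Longrightarrow> dorder n (F i)) \<Longrightarrow> dorder n (\<lambda>f. \<Sum>i\<in>A. F i f)"
  by (induction A rule: infinite_finite_induct) (auto simp: dorder_zero intro!: dorder_add)

text \<open>
  By the Leibniz rule \<open>[F G, h] = [F, h] G + F [G, h]\<close>. The orders are strict bounds, hence the
  \<open>- 1\<close>: orders at most \<open>p\<close> and \<open>q\<close> compose to order at most \<open>p + q\<close>.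
\<close>

lemma dorder_compose:
  assumes "dorder m F" "dorder n G" "\<And>f g. F (f + g) = F f + F g"
  shows "dorder (m + n - 1) (\<lambda>f. F (G f))"
  using assms
proof (induction "m + n" arbitrary: m n F G)
  case 0
  then show ?case by simp
next
  case (Suc k)
  have F0: "F 0 = 0" using Suc.prems(3)[of 0 0] by simp
  have Fm: "F (f - g) = F f - F g" for f g
    by (metis Suc.prems(3) add_diff_cancel_right' diff_add_cancel)
  consider "m = 0" | "n = 0" | m' n' where "m = Suc m'" "n = Suc n'"
    by (meson not0_implies_Suc)
  then show ?case
  proof cases
    case 1
    then show ?thesis using Suc.prems by (simp add: dorder_zero)
  next
    case 2
    then show ?thesis using Suc.prems F0 by (simp add: dorder_zero)
  next
    case 3
    have "dorder (m' + n') (\<lambda>f. F (G (h * f)) - h * F (G f))" for h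
    proof -
      have "dorder (m' + n - 1) (\<lambda>f. F (h * G f) - h * F (G f))"
        by (rule Suc.hyps(1)[of m' n "\<lambda>f. F (h * f) - h * F f" G])
           (use Suc.hyps(2) Suc.prems 3 in \<open>auto simp: algebra_simps\<close>)
      moreover have "dorder (m + n' - 1) (\<lambda>f. F (G (h * f) - h * G f))"
        by (rule Suc.hyps(1)[of m n' F "\<lambda>f. G (h * f) - h * G f"])
           (use Suc.hyps(2) Suc.prems 3 in \<open>auto simp: algebra_simps\<close>)
      ultimately have "dorder (m' + n') (\<lambda>f. (F (h * G f) - h * F (G f)) + F (G (h * f) - h * G f))"
        using 3 by (intro dorder_add) auto
      then show ?thesis by (simp add: Fm)
    qed
    then show ?thesis using 3 by simp
  qed
qed

text \<open>
  Commutators need only be tested on generators, since \<open>[F, g h] = [F, g] h + g [F, h]\<close>.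
\<close>

lemma dorder_commutator_mult:
  assumes "dorder n (\<lambda>f. F (g * f) - g * F f)" "dorder n (\<lambda>f. F (h * f) - h * F f)"
  shows "dorder n (\<lambda>f. F (g * h * f) - g * h * F f)"
proof -
  have "dorder n (\<lambda>f. (F (g * (h * f)) - g * F (h * f)) + g * (F (h * f) - h * F f))"
    by (intro dorder_add dorder_mult dorder_mult_arg[of n "\<lambda>f. F (g * f) - g * F f" h] assms)
  then show ?thesis by (simp add: algebra_simps)
qed

text \<open>The alternating sum over subsets is the iterated commutator with the \<open>a i\<close>, up to sign.\<close>

lemma dorder_alternating_sum:
  fixes F :: "'a::comm_ring_1 \<Rightarrow> 'a"
  assumes "finite A" "dorder (card A) F"
  shows "(\<Sum>T\<in>Pow A. (-1) ^ card T * (prod a (A - T) * F (prod a T * b))) = 0"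
  using assms
proof (induction A arbitrary: F rule: finite_induct)
  case empty
  then show ?case by simp
next
  case (insert x A)
  define F' where "F' = (\<lambda>f. F (a x * f) - a x * F f)"
  have fin: "finite T" if "T \<in> Pow A" for T
    using that insert.hyps finite_subset by blast
  have "(\<Sum>T\<in>Pow (insert x A). (-1) ^ card T * (prod a (insert x A - T) * F (prod a T * b)))
    = (\<Sum>T\<in>Pow A. (-1) ^ card T * (prod a (insert x A - T) * F (prod a T * b)))
    + (\<Sum>T\<in>insert x ` Pow A. (-1) ^ card T * (prod a (insert x A - T) * F (prod a T * b)))"
    unfolding Pow_insert by (rule sum.union_disjoint) (use insert.hyps in auto)
  also have "(\<Sum>T\<in>insert x ` Pow A. (-1) ^ card T * (prod a (insert x A - T) * F (prod a T * b)))
    = (\<Sum>T\<in>Pow A. (-1) ^ card (insert x T) * (prod a (insert x A - insert x T) * F (prod a (insert x T) * b)))"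
    by (subst sum.reindex) (use insert.hyps in \<open>auto intro!: inj_onI\<close>)
  also have "\<dots> = (\<Sum>T\<in>Pow A. - ((-1) ^ card T * (prod a (A - T) * F (a x * (prod a T * b)))))"
  proof (rule sum.cong[OF refl])
    fix T assume T: "T \<in> Pow A"
    then have "x \<notin> T" "insert x A - insert x T = A - T" using insert.hyps by auto
    then show "(-1) ^ card (insert x T) * (prod a (insert x A - insert x T) * F (prod a (insert x T) * b))
      = - ((-1) ^ card T * (prod a (A - T) * F (a x * (prod a T * b))))"
      using fin[OF T] by (simp add: algebra_simps)
  qed
  also have "(\<Sum>T\<in>Pow A. (-1) ^ card T * (prod a (insert x A - T) * F (prod a T * b)))
    = (\<Sum>T\<in>Pow A. (-1) ^ card T * (prod a (A - T) * (a x * F (prod a T * b))))"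
  proof (rule sum.cong[OF refl])
    fix T assume T: "T \<in> Pow A"
    then have "insert x A - T = insert x (A - T)" "x \<notin> A - T" using insert.hyps by auto
    then show "(-1) ^ card T * (prod a (insert x A - T) * F (prod a T * b))
      = (-1) ^ card T * (prod a (A - T) * (a x * F (prod a T * b)))"
      using insert.hyps by (simp add: algebra_simps)
  qed
  also have "(\<Sum>T\<in>Pow A. (-1) ^ card T * (prod a (A - T) * (a x * F (prod a T * b))))
    + (\<Sum>T\<in>Pow A. - ((-1) ^ card T * (prod a (A - T) * F (a x * (prod a T * b)))))
    = - (\<Sum>T\<in>Pow A. (-1) ^ card T * (prod a (A - T) * F' (prod a T * b)))"
    by (simp add: F'_def sum.distrib[symmetric] sum_negf[symmetric] algebra_simps)
  also have "\<dots> = 0"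
    using insert.IH[of F'] insert.prems insert.hyps by (simp add: F'_def)
  finally show ?case .
qed

section \<open>The coefficients of \<open>t / (e\<^sup>t - 1)\<close>\<close>

text \<open>
  The series \<open>(e\<^sup>t - 1) / t\<close>.
\<close>

definition expm1_quot :: "'k::field_char_0 fps" where
  "expm1_quot = Abs_fps (\<lambda>n. 1 / fact (Suc n))"

text \<open>
  The Bernoulli numbers divided by factorials.
\<close>

definition bern :: "nat \<Rightarrow> 'k::field_char_0" where
  "bern n = fps_nth (inverse expm1_quot) n"

lemma inverse_expm1_quot: "inverse expm1_quot * expm1_quot = (1 :: 'k::field_char_0 fps)"
  by (rule inverse_mult_eq_1) (simp add: expm1_quot_def)

lemma bern_convolution:
  "(\<Sum>i\<le>n. bern i * (1 / fact (Suc (n - i)))) = (if n = 0 then 1 else 0 :: 'k::field_char_0)"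
proof -
  have "(\<Sum>i\<le>n. bern i * (1 / fact (Suc (n - i)))) = fps_nth (inverse expm1_quot * expm1_quot) n"
    by (simp add: fps_mult_nth bern_def expm1_quot_def atLeast0AtMost)
  then show ?thesis
    by (simp add: inverse_expm1_quot)
qed

text \<open>
  A double series in \<open>s\<close> (the inner variable) and \<open>t\<close> (the outer one); the three maps below
  substitute \<open>s\<close>, \<open>t\<close> and \<open>s + t\<close> into a series in one variable.
\<close>

definition fps_at_s :: "'k::field_char_0 fps \<Rightarrow> 'k fps fps" where
  "fps_at_s F = fps_const F"

definition fps_at_t :: "'k::field_char_0 fps \<Rightarrow> 'k fps fps" where
  "fps_at_t F = Abs_fps (\<lambda>b. fps_const (fps_nth F b))"

definition fps_at_sum :: "'k::field_char_0 fps \<Rightarrow> 'k fps fps" where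
  "fps_at_sum F = Abs_fps (\<lambda>b. Abs_fps (\<lambda>a. of_nat ((a + b) choose a) * fps_nth F (a + b)))"

lemma fps_at_s_mult: "fps_at_s (F * G) = fps_at_s F * fps_at_s G"
  by (simp add: fps_at_s_def)

lemma fps_at_t_mult: "fps_at_t (F * G) = fps_at_t F * fps_at_t G"
  by (rule fps_ext, rule fps_ext) (simp add: fps_at_t_def fps_mult_nth fps_sum_nth)

text \<open>
  On coefficients this is the identity of Vandermonde.
\<close>

lemma fps_at_sum_mult: "fps_at_sum (F * G) = fps_at_sum F * fps_at_sum G"
proof (rule fps_ext, rule fps_ext)
  fix b a
  define f where "f = fps_nth F"
  define g where "g = fps_nth G"
  define h where "h = (\<lambda>i m. of_nat (m choose i) * of_nat ((a + b - m) choose (a - i)) * (f m * g (a + b - m)))"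
  have inner: "(\<Sum>m\<le>a + b. h i m)
      = (\<Sum>j\<le>b. of_nat ((i + j) choose i) * f (i + j) *
          (of_nat ((a - i + (b - j)) choose (a - i)) * g (a - i + (b - j))))" if "i \<le> a" for i
  proof -
    have "(\<Sum>m\<le>a + b. h i m) = (\<Sum>m\<in>(\<lambda>j. i + j) ` {..b}. h i m)"
    proof (rule sum.mono_neutral_right)
      show "\<forall>m\<in>{..a + b} - (\<lambda>j. i + j) ` {..b}. h i m = 0"
      proof
        fix m assume m: "m \<in> {..a + b} - (\<lambda>j. i + j) ` {..b}"
        have "m < i \<or> i + b < m"
        proof (rule ccontr)
          assume "\<not> (m < i \<or> i + b < m)"
          then have "m = i + (m - i)" "m - i \<le> b" by auto
          then show False using m by blast
        qed
        then show "h i m = 0"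
        proof
          assume "i + b < m"
          then have "a + b - m < a - i" using m by auto
          then show ?thesis by (simp add: h_def binomial_eq_0)
        qed (simp add: h_def binomial_eq_0)
      qed
    qed (use that in auto)
    also have "\<dots> = (\<Sum>j\<le>b. h i (i + j))"
      by (subst sum.reindex) (auto simp: inj_on_def)
    also have "\<dots> = (\<Sum>j\<le>b. of_nat ((i + j) choose i) * f (i + j) *
          (of_nat ((a - i + (b - j)) choose (a - i)) * g (a - i + (b - j))))"
    proof (rule sum.cong[OF refl])
      fix j assume "j \<in> {..b}"
      then have "a + b - (i + j) = a - i + (b - j)" using that by auto
      then show "h i (i + j) = of_nat ((i + j) choose i) * f (i + j) *
          (of_nat ((a - i + (b - j)) choose (a - i)) * g (a - i + (b - j)))"
        by (simp add: h_def)
    qed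
    finally show ?thesis .
  qed
  have "fps_nth (fps_nth (fps_at_sum (F * G)) b) a
      = of_nat ((a + b) choose a) * (\<Sum>m\<le>a + b. f m * g (a + b - m))"
    by (simp add: fps_at_sum_def fps_mult_nth f_def g_def atLeast0AtMost)
  also have "\<dots> = (\<Sum>m\<le>a + b. \<Sum>i\<le>a. h i m)"
    unfolding sum_distrib_left
  proof (rule sum.cong[OF refl])
    fix m assume "m \<in> {..a + b}"
    then have "(a + b) choose a = (\<Sum>i\<le>a. (m choose i) * ((a + b - m) choose (a - i)))"
      using vandermonde[of m "a + b - m" a] by simp
    then show "of_nat ((a + b) choose a) * (f m * g (a + b - m)) = (\<Sum>i\<le>a. h i m)"
      by (simp add: h_def sum_distrib_right)
  qed
  also have "\<dots> = (\<Sum>i\<le>a. \<Sum>m\<le>a + b. h i m)"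
    by (rule sum.swap)
  also have "\<dots> = (\<Sum>i\<le>a. \<Sum>j\<le>b. of_nat ((i + j) choose i) * f (i + j) *
          (of_nat ((a - i + (b - j)) choose (a - i)) * g (a - i + (b - j))))"
    by (rule sum.cong[OF refl]) (rule inner, simp)
  also have "\<dots> = (\<Sum>j\<le>b. \<Sum>i\<le>a. of_nat ((i + j) choose i) * f (i + j) *
          (of_nat ((a - i + (b - j)) choose (a - i)) * g (a - i + (b - j))))"
    by (rule sum.swap)
  also have "\<dots> = fps_nth (fps_nth (fps_at_sum F * fps_at_sum G) b) a"
    by (simp add: fps_at_sum_def fps_mult_nth f_def g_def atLeast0AtMost fps_sum_nth)
  finally show "fps_nth (fps_nth (fps_at_sum (F * G)) b) a
      = fps_nth (fps_nth (fps_at_sum F * fps_at_sum G) b) a" .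
qed

lemma fps_at_one: "fps_at_s 1 = 1" "fps_at_t 1 = 1" "fps_at_sum 1 = 1"
  by (auto simp: fps_at_s_def fps_at_t_def fps_at_sum_def fps_eq_iff)

lemma X_expm1_quot: "fps_X * expm1_quot = fps_exp 1 - (1 :: 'k::field_char_0 fps)"
  by (rule fps_ext) (auto simp: expm1_quot_def fact_reduce)

text \<open>
  With \<open>\<phi>(t) = t / (e\<^sup>t - 1)\<close> this says
  \<open>\<phi>(s) (\<phi>(s + t) - \<phi>(t)) / s + \<phi>(t) (\<phi>(s + t) - \<phi>(s)) / t + \<phi>(s + t) = 0\<close>,
  the addition theorem of the exponential function.
\<close>

lemma bern_identity:
  "(\<Sum>i\<le>a. bern i * (of_nat ((a - i + b + 1) choose (a - i + 1)) * bern (a - i + b + 1)))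
   + (\<Sum>j\<le>b. bern j * (of_nat ((a + (b - j) + 1) choose (b - j + 1)) * bern (a + (b - j) + 1)))
   + of_nat ((a + b) choose a) * bern (a + b) = (0 :: 'k::field_char_0)"
proof -
  define s t :: "'k fps fps" where "s = fps_const fps_X" and "t = fps_X"
  define G where "G = (expm1_quot :: 'k fps)"
  define phi where "phi = inverse G"
  define gs gt gst where "gs = fps_at_s G" and "gt = fps_at_t G" and "gst = fps_at_sum G"
  define ps pt pst where "ps = fps_at_s phi" and "pt = fps_at_t phi" and "pst = fps_at_sum phi"
  define es et where "es = fps_at_s (fps_exp (1::'k))" and "et = fps_at_t (fps_exp (1::'k))"
  define W W' :: "'k fps fps" where
    "W = Abs_fps (\<lambda>b. Abs_fps (\<lambda>a. of_nat ((a + b + 1) choose (a + 1)) * bern (a + b + 1)))"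
    and "W' = Abs_fps (\<lambda>b. Abs_fps (\<lambda>a. of_nat ((a + b + 1) choose (b + 1)) * bern (a + b + 1)))"
  have inv: "phi * G = 1"
    unfolding phi_def G_def by (rule inverse_expm1_quot)
  have ps: "ps * gs = 1" and pt: "pt * gt = 1" and pst: "pst * gst = 1"
    unfolding ps_def gs_def pt_def gt_def pst_def gst_def
      fps_at_s_mult[symmetric] fps_at_t_mult[symmetric] fps_at_sum_mult[symmetric] inv fps_at_one
    by simp_all
  have XG: "fps_X * G = fps_exp 1 - 1"
    unfolding G_def by (rule X_expm1_quot)
  have sgs: "s * gs = es - 1"
    unfolding s_def gs_def es_def fps_at_s_def using XG by (simp add: fps_eq_iff)
  have tgt: "t * gt = et - 1"
    unfolding t_def gt_def et_def fps_at_t_def G_def expm1_quot_def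
    by (auto simp: fps_eq_iff fact_reduce)
  have "s + t = fps_at_sum fps_X"
    by (rule fps_ext, rule fps_ext) (auto simp: s_def t_def fps_at_sum_def fps_X_def)
  moreover have "fps_at_sum (fps_exp 1) = es * et"
  proof (rule fps_ext, rule fps_ext)
    fix b a
    have "of_nat ((a + b) choose a) / fact (a + b) = (1 / (fact a * fact b) :: 'k)"
      by (simp add: binomial_fact)
    then show "fps_nth (fps_nth (fps_at_sum (fps_exp (1::'k))) b) a = fps_nth (fps_nth (es * et) b) a"
      by (simp add: fps_at_sum_def es_def et_def fps_at_s_def fps_at_t_def)
  qed
  moreover have "fps_at_sum (F - H) = fps_at_sum F - fps_at_sum H" for F H :: "'k fps"
    by (auto simp: fps_eq_iff fps_at_sum_def algebra_simps)
  ultimately have stg: "(s + t) * gst = es * et - 1"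
    unfolding gst_def by (simp add: fps_at_sum_mult[symmetric] XG fps_at_one)
  have sW: "s * W = pst - pt"
  proof (rule fps_ext, rule fps_ext)
    fix b a
    show "fps_nth (fps_nth (s * W) b) a = fps_nth (fps_nth (pst - pt) b) a"
      by (cases a) (simp_all add: s_def W_def pst_def pt_def fps_at_sum_def fps_at_t_def phi_def G_def bern_def add_ac)
  qed
  have tW: "t * W' = pst - ps"
  proof (rule fps_ext, rule fps_ext)
    fix b a
    show "fps_nth (fps_nth (t * W') b) a = fps_nth (fps_nth (pst - ps) b) a"
    proof (cases b)
      case 0
      then show ?thesis by (simp add: t_def pst_def ps_def fps_at_sum_def fps_at_s_def)
    next
      case (Suc b')
      have "(Suc (a + b') choose Suc b') = (Suc (a + b') choose a)"
        by (subst binomial_symmetric) simp_all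
      then show ?thesis
        using Suc by (simp add: t_def W'_def pst_def ps_def fps_at_sum_def fps_at_s_def phi_def G_def bern_def
            del: binomial_Suc_Suc)
    qed
  qed
  (* The series W and W' are the two difference quotients. Multiplying Z by s, t and the inverses of
     the three values of phi leaves a polynomial identity in the two exponential series. *)
  define Z where "Z = ps * W + pt * W' + pst"
  have "s * t * Z = t * ps * (s * W) + s * pt * (t * W') + s * t * pst"
    by (simp add: Z_def algebra_simps)
  also have "\<dots> = t * ps * (pst - pt) + s * pt * (pst - ps) + s * t * pst"
    by (simp only: sW tW)
  finally have "s * t * Z * (gs * gt * gst) = (t * ps * (pst - pt) + s * pt * (pst - ps) + s * t * pst) * (gs * gt * gst)"
    by simp
  also have "\<dots> = (ps * gs) * (pst * gst) * (t * gt) + (pt * gt) * (pst * gst) * (s * gs)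
      - (ps * gs) * (pt * gt) * ((s + t) * gst) + (pst * gst) * (s * gs) * (t * gt)"
    by (simp add: algebra_simps)
  also have "\<dots> = 0"
    unfolding ps pt pst sgs tgt stg by (simp add: algebra_simps)
  finally have "Z = 0"
    using ps pt pst by (auto simp: s_def t_def)
  then have Zab: "fps_nth (fps_nth Z b) a = 0" by simp
  have "fps_nth (fps_nth (ps * W) b) a
      = (\<Sum>i\<le>a. bern i * (of_nat ((a - i + b + 1) choose (a - i + 1)) * bern (a - i + b + 1)))"
  proof -
    have "fps_nth (ps * W) b = phi * fps_nth W b"
      by (simp add: ps_def fps_at_s_def)
    then show ?thesis
      by (simp add: fps_mult_nth phi_def G_def bern_def W_def atLeast0AtMost)
  qed
  moreover have "fps_nth (fps_nth (pt * W') b) a = (\<Sum>j\<le>b. fps_nth (fps_nth pt j * fps_nth W' (b - j)) a)"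
    by (simp only: fps_mult_nth[of pt] fps_sum_nth atLeast0AtMost)
  moreover have "\<dots> = (\<Sum>j\<le>b. bern j * (of_nat ((a + (b - j) + 1) choose (b - j + 1)) * bern (a + (b - j) + 1)))"
    by (simp add: pt_def fps_at_t_def W'_def phi_def G_def bern_def)
  moreover have "fps_nth (fps_nth pst b) a = of_nat ((a + b) choose a) * bern (a + b)"
    by (simp add: pst_def fps_at_sum_def phi_def G_def bern_def)
  ultimately show ?thesis
    using Zab by (simp only: Z_def fps_add_nth)
qed

section \<open>Moving a letter through a power\<close>

text \<open>
  Left multiplication by \<open>Y\<close> is the sum of the commuting maps \<open>[Y, -]\<close> and right multiplication
  by \<open>Y\<close>, so this is the binomial theorem for them.
\<close>

lemma power_times_commutators:
  fixes Y W :: "'a::ring_1"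
  defines "D \<equiv> \<lambda>V. Y * V - V * Y"
  shows "Y ^ i * W = (\<Sum>j\<le>i. of_nat (i choose j) * ((D ^^ j) W * Y ^ (i - j)))"
proof (induction i arbitrary: W)
  case 0
  then show ?case by simp
next
  case (Suc i)
  define u where "u = (\<lambda>j. (D ^^ j) W * Y ^ (Suc i - j))"
  have "Y ^ Suc i * W = Y ^ i * (D W) + Y ^ i * W * Y"
    by (simp add: D_def right_diff_distrib mult.assoc power_commutes)
       (metis mult.assoc power_commutes)
  also have "Y ^ i * W * Y = (\<Sum>j\<le>i. of_nat (i choose j) * u j)"
    unfolding Suc.IH sum_distrib_right u_def
    by (rule sum.cong) (auto simp: mult.assoc Suc_diff_le power_commutes)
  also have "\<dots> = (\<Sum>j\<le>Suc i. of_nat (i choose j) * u j)"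
    by (simp add: binomial_eq_0)
  also have "\<dots> = u 0 + (\<Sum>j\<le>i. of_nat (i choose Suc j) * u (Suc j))"
    by (simp add: sum.atMost_Suc_shift del: sum.atMost_Suc)
  also have "Y ^ i * (D W) = (\<Sum>j\<le>i. of_nat (i choose j) * u (Suc j))"
    unfolding Suc.IH u_def by (simp add: funpow_swap1)
  also have "(\<Sum>j\<le>i. of_nat (i choose j) * u (Suc j)) + (u 0 + (\<Sum>j\<le>i. of_nat (i choose Suc j) * u (Suc j)))
      = u 0 + (\<Sum>j\<le>i. of_nat (Suc i choose Suc j) * u (Suc j))"
    by (simp add: sum.distrib algebra_simps)
  also have "\<dots> = (\<Sum>j\<le>Suc i. of_nat (Suc i choose j) * u j)"
    by (simp add: sum.atMost_Suc_shift del: sum.atMost_Suc)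
  finally show ?case by (simp only: u_def)
qed

text \<open>
  Summing the previous expansion over \<open>i\<close> gives the hockey-stick sum of binomial coefficients.
\<close>

lemma sum_powers_commutators:
  fixes Y W :: "'a::ring_1"
  defines "D \<equiv> \<lambda>V. Y * V - V * Y"
  shows "(\<Sum>i\<le>m. Y ^ i * W * Y ^ (m - i)) = (\<Sum>j\<le>m. of_nat (Suc m choose Suc j) * ((D ^^ j) W * Y ^ (m - j)))"
proof -
  have "(\<Sum>i\<le>m. Y ^ i * W * Y ^ (m - i))
      = (\<Sum>i\<le>m. \<Sum>j\<le>m. of_nat (i choose j) * ((D ^^ j) W * Y ^ (m - j)))"
  proof (rule sum.cong[OF refl])
    fix i assume i: "i \<in> {..m}"
    have "Y ^ i * W * Y ^ (m - i) = (\<Sum>j\<le>i. of_nat (i choose j) * ((D ^^ j) W * Y ^ (m - j)))"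
      unfolding power_times_commutators[where Y = Y and i = i and W = W] D_def[symmetric] sum_distrib_right
    proof (rule sum.cong[OF refl])
      fix j assume j: "j \<in> {..i}"
      then have "Y ^ (m - j) = Y ^ (i - j) * Y ^ (m - i)"
        using i by (simp add: power_add[symmetric])
      then show "of_nat (i choose j) * ((D ^^ j) W * Y ^ (i - j)) * Y ^ (m - i)
          = of_nat (i choose j) * ((D ^^ j) W * Y ^ (m - j))"
        by (simp add: mult.assoc)
    qed
    also have "\<dots> = (\<Sum>j\<le>m. of_nat (i choose j) * ((D ^^ j) W * Y ^ (m - j)))"
      by (rule sum.mono_neutral_left) (use i in \<open>auto simp: binomial_eq_0\<close>)
    finally show "Y ^ i * W * Y ^ (m - i) = \<dots>" .
  qed
  also have "\<dots> = (\<Sum>j\<le>m. \<Sum>i\<le>m. of_nat (i choose j) * ((D ^^ j) W * Y ^ (m - j)))"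
    by (rule sum.swap)
  also have "\<dots> = (\<Sum>j\<le>m. of_nat (Suc m choose Suc j) * ((D ^^ j) W * Y ^ (m - j)))"
    by (simp only: sum_distrib_right[symmetric] of_nat_sum[symmetric] sum_choose_upper)
  finally show ?thesis .
qed

text \<open>
  The weights invert the relation of the previous lemma, which expresses the symmetrized
  products through the commutators.
\<close>

lemma letter_times_power:
  fixes Y Z :: "'b::monoid_add \<Rightarrow>\<^sub>0 'k::field_char_0"
  defines "D \<equiv> \<lambda>V. Y * V - V * Y"
  shows "Z * Y ^ n = (\<Sum>p\<le>n. cst (bern p * (fact n / fact (Suc (n - p)))) *
     (\<Sum>i\<le>n - p. Y ^ i * (D ^^ p) Z * Y ^ (n - p - i)))"
proof -
  define u where "u = (\<lambda>k. (D ^^ k) Z * Y ^ (n - k))"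
  define c where "c = (\<lambda>p j. bern p * (1 / fact (Suc j)) * (fact n / fact (n - p - j)) :: 'k)"
  have "(\<Sum>p\<le>n. cst (bern p * (fact n / fact (Suc (n - p)))) *
     (\<Sum>i\<le>n - p. Y ^ i * (D ^^ p) Z * Y ^ (n - p - i)))
     = (\<Sum>p\<le>n. \<Sum>j\<le>n - p. cst (c p j) * u (p + j))"
  proof (rule sum.cong[OF refl])
    fix p assume p: "p \<in> {..n}"
    define m where "m = n - p"
    have *: "cst (bern p * (fact n / fact (Suc m))) * (of_nat (Suc m choose Suc j) * ((D ^^ j) ((D ^^ p) Z) * Y ^ (m - j)))
        = cst (c p j) * u (p + j)" if "j \<in> {..m}" for j
    proof -
      have e: "n - (p + j) = m - j" by (simp add: m_def)
      have "bern p * (fact n / fact (Suc m)) * of_nat (Suc m choose Suc j) = c p j"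
        using that by (subst binomial_fact) (simp_all add: c_def e del: fact_Suc)
      moreover have "(D ^^ j) ((D ^^ p) Z) * Y ^ (m - j) = u (p + j)"
        by (simp add: u_def m_def funpow_add add.commute[of p])
      ultimately show ?thesis
        by (simp only: cst_of_nat[symmetric] mult.assoc[symmetric] cst_mult[symmetric])
    qed
    show "cst (bern p * (fact n / fact (Suc (n - p)))) *
       (\<Sum>i\<le>n - p. Y ^ i * (D ^^ p) Z * Y ^ (n - p - i)) = (\<Sum>j\<le>n - p. cst (c p j) * u (p + j))"
      unfolding m_def[symmetric] sum_powers_commutators[where Y = Y and m = m] D_def[symmetric] sum_distrib_left
      by (rule sum.cong[OF refl]) (rule *)
  qed
  also have "\<dots> = (\<Sum>(p, j)\<in>Sigma {..n} (\<lambda>p. {..n - p}). cst (c p j) * u (p + j))"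
    by (simp add: sum.Sigma)
  also have "Sigma {..n} (\<lambda>p. {..n - p}) = {(p, j). p + j \<le> n}"
    by auto
  also have "(\<Sum>(p, j)\<in>{(p, j). p + j \<le> n}. cst (c p j) * u (p + j))
      = (\<Sum>k\<le>n. \<Sum>p\<le>k. cst (c p (k - p)) * u (p + (k - p)))"
    by (rule sum.triangle_reindex_eq)
  also have "\<dots> = (\<Sum>k\<le>n. cst (if k = 0 then 1 else 0) * u k)"
  proof (rule sum.cong[OF refl])
    fix k assume "k \<in> {..n}"
    have "(\<Sum>p\<le>k. cst (c p (k - p)) * u (p + (k - p))) = (\<Sum>p\<le>k. cst (c p (k - p))) * u k"
      by (simp add: sum_distrib_right)
    also have "(\<Sum>p\<le>k. cst (c p (k - p))) = (cst (\<Sum>p\<le>k. c p (k - p)) :: 'b \<Rightarrow>\<^sub>0 'k)"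
      by (simp add: cst_sum)
    also have "(\<Sum>p\<le>k. c p (k - p)) = (\<Sum>p\<le>k. bern p * (1 / fact (Suc (k - p)))) * (fact n / fact (n - k))"
      unfolding sum_distrib_right c_def by (rule sum.cong) auto
    also have "\<dots> = (if k = 0 then 1 else 0)"
      by (simp only: bern_convolution) simp
    finally show "(\<Sum>p\<le>k. cst (c p (k - p)) * u (p + (k - p))) = cst (if k = 0 then 1 else 0) * u k" .
  qed
  also have "\<dots> = (\<Sum>k\<le>n. if k = 0 then u k else 0)"
    by (rule sum.cong) auto
  also have "\<dots> = Z * Y ^ n"
    by (simp add: sum.delta u_def)
  finally show ?thesis by simp
qed

section \<open>Ideals of the free algebra\<close>

abbreviation wd :: "'g list \<Rightarrow> ('k::field, 'g) free_alg" where
  "wd xs \<equiv> Poly_Mapping.single (Word xs) 1"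

lemma wd_Nil [simp]: "wd [] = 1"
  by (simp add: zero_word_def[symmetric])

lemma wd_append: "wd (xs @ ys) = wd xs * wd ys"
  by (simp add: mult_single plus_word_def)

lemma wd_Cons: "wd (x # xs) = letter x * wd xs"
  using wd_append[of "[x]" xs] by (simp add: letter_def)

lemma letter_eq_wd: "letter x = wd [x]"
  by (simp add: letter_def)

lemma free_const_eq_cst: "free_const c = cst c"
  by (simp add: free_const_def cst_def)

lemma wd_replicate: "wd (replicate n y) = letter y ^ n"
  by (induction n) (simp_all add: wd_Cons)

lemma free_alg_induct:
  assumes "subsp V" "\<And>xs. wd xs \<in> V"
  shows "f \<in> V"
  by (rule klin_span_induct[OF assms(1)]) (metis assms(2) word.collapse)

lemma klin_free_eqI:
  assumes "klin F" "klin G" "\<And>xs. F (wd xs) = G (wd xs)"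
  shows "F f = G f"
  by (rule klin_eqI[OF assms(1,2)]) (metis assms(3) word.collapse)

lemma free_ring_simps [simp]:
  "carrier free_ring = UNIV" "monoid.mult free_ring = (*)" "monoid.one free_ring = 1"
  "ring.zero free_ring = 0" "ring.add free_ring = (+)"
  by (simp_all add: ring_of_type_algebra_def)

lemma ring_free_ring: "ring (free_ring :: ('k::field, 'g) free_alg ring)"
proof (rule ringI)
  show "abelian_group (free_ring :: ('k, 'g) free_alg ring)"
  proof (rule abelian_groupI)
    fix x :: "('k, 'g) free_alg"
    show "\<exists>y\<in>carrier free_ring. y \<oplus>\<^bsub>free_ring\<^esub> x = \<zero>\<^bsub>free_ring\<^esub>"
      by (auto intro: exI[of _ "- x"])
  qed (auto simp: add_ac)
  show "Group.monoid (free_ring :: ('k, 'g) free_alg ring)"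
    by (rule monoidI) (auto simp: mult.assoc)
qed (auto simp: distrib_left distrib_right)

lemma ideal_free_ring_iff:
  "ideal I (free_ring :: ('k::field, 'g) free_alg ring) \<longleftrightarrow>
     0 \<in> I \<and> (\<forall>f\<in>I. \<forall>g\<in>I. f + g \<in> I) \<and> (\<forall>f\<in>I. \<forall>u. u * f \<in> I) \<and> (\<forall>f\<in>I. \<forall>u. f * u \<in> I)"
  (is "?L \<longleftrightarrow> ?R")
proof
  assume ?L
  then interpret ideal I "free_ring :: ('k, 'g) free_alg ring" .
  show ?R
    using additive_subgroup.zero_closed[OF additive_subgroup_axioms]
      additive_subgroup.a_closed[OF additive_subgroup_axioms] I_l_closed I_r_closed
    by auto
next
  assume R: ?R
  interpret R: ring "free_ring :: ('k, 'g) free_alg ring" by (rule ring_free_ring)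
  have neg: "- f \<in> I" if "f \<in> I" for f
    using R that by (metis mult_minus1)
  show ?L
  proof (rule idealI[OF ring_free_ring])
    show "subgroup I (add_monoid (free_ring :: ('k, 'g) free_alg ring))"
    proof (rule group.subgroupI[OF R.add.is_group])
      fix f assume f: "f \<in> I"
      have "\<ominus>\<^bsub>free_ring\<^esub> f = - f"
        by (rule R.minus_equality) auto
      then show "inv\<^bsub>add_monoid free_ring\<^esub> f \<in> I" using neg[OF f] by (simp add: a_inv_def)
    qed (use R in auto)
  qed (use R in auto)
qed

locale free_ideal =
  fixes I :: "('k::field, 'g) free_alg set"
  assumes ideal: "ideal I free_ring"
begin

lemma zero_mem: "0 \<in> I"
  and add_mem: "f \<in> I \<Longrightarrow> g \<in> I \<Longrightarrow> f + g \<in> I"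
  and lmult_mem: "f \<in> I \<Longrightarrow> u * f \<in> I"
  and rmult_mem: "f \<in> I \<Longrightarrow> f * u \<in> I"
  using ideal by (auto simp: ideal_free_ring_iff)

lemma subsp: "subsp I"
  by (simp add: subsp_def zero_mem add_mem lmult_mem)

lemmas diff_mem = subspD(4)[OF subsp] and sum_mem = subspD(5)[OF subsp]
  and uminus_mem = subspD(6)[OF subsp]

lemma swap_mem: "f - g \<in> I \<Longrightarrow> g - f \<in> I"
  using uminus_mem[of "f - g"] by simp

lemma subsp_cong:
  fixes F G :: "('c::monoid_add \<Rightarrow>\<^sub>0 'k) \<Rightarrow> ('k, 'g) free_alg"
  assumes "klin F" "klin G"
  shows "subsp {f. F f - G f \<in> I}"
proof -
  have "klin (\<lambda>f. F f - G f)" using assms by (rule klin_minus)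
  note l = klin_0[OF this] klin_add[OF this] klin_cst[OF this]
  show ?thesis
    unfolding subsp_def mem_Collect_eq l by (auto intro: zero_mem add_mem lmult_mem)
qed

end

lemma genideal_free_ideal: "free_ideal (Idl\<^bsub>free_ring\<^esub> G)"
  by (rule free_ideal.intro) (rule ring.genideal_ideal[OF ring_free_ring], simp)

lemma genideal_gen: "r \<in> G \<Longrightarrow> r \<in> Idl\<^bsub>free_ring\<^esub> G"
  using ring.genideal_self[OF ring_free_ring, of G] by auto

text \<open>
  The elements \<open>f\<close> with \<open>u f v \<in> N\<close> for all \<open>u\<close> and \<open>v\<close> form a two-sided ideal, so a linear
  condition on an ideal need only be checked on its generators placed between two words.
\<close>

lemma genideal_induct:
  assumes f: "f \<in> Idl\<^bsub>free_ring\<^esub> G"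
    and N: "subsp N" and gen: "\<And>r xs ys. r \<in> G \<Longrightarrow> wd xs * r * wd ys \<in> N"
  shows "f \<in> N"
proof -
  define J where "J = {f. \<forall>u v. u * f * v \<in> N}"
  have "ideal J free_ring"
    unfolding ideal_free_ring_iff J_def
    by (auto simp: subspD(1,2)[OF N] distrib_left distrib_right) (metis mult.assoc)+
  moreover have "G \<subseteq> J"
  proof
    fix r assume r: "r \<in> G"
    have 1: "u * r * wd ys \<in> N" for u ys
    proof -
      have "subsp {u. u * r * wd ys \<in> N}"
        using subspD(1-3)[OF N] by (auto simp: subsp_def distrib_right mult.assoc)
      from free_alg_induct[OF this, of u] show ?thesis using gen[OF r] by auto
    qed
    have "u * r * v \<in> N" for u v
    proof -
      have "subsp {v. u * r * v \<in> N}"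
        using subspD(1-3)[OF N] by (auto simp: subsp_def distrib_left cst_left_commute)
      from free_alg_induct[OF this, of v] show ?thesis using 1 by auto
    qed
    then show "r \<in> J" by (simp add: J_def)
  qed
  ultimately have "f \<in> J"
    using f ring.genideal_minimal[OF ring_free_ring] by blast
  then have "1 * f * 1 \<in> N" unfolding J_def by blast
  then show ?thesis by simp
qed

section \<open>The symmetric algebra as a polynomial ring\<close>

text \<open>
  Degrees are integers, so that a negative degree forces a polynomial to vanish and degree shifts
  need no truncation.
\<close>

definition homog :: "int \<Rightarrow> ('a multiset \<Rightarrow>\<^sub>0 'k::field) \<Rightarrow> bool" where
  "homog n f \<longleftrightarrow> (\<forall>M\<in>keys f. int (size M) = n)"

lemma lookup_lin_filter:
  fixes f :: "'a::monoid_add \<Rightarrow>\<^sub>0 'k::field"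
  shows "lookup (lin (\<lambda>k. if P k then Poly_Mapping.single k 1 else 0) f) k = (if P k then lookup f k else 0)"
proof -
  have "lookup (cst c * (if P j then Poly_Mapping.single j 1 else 0)) k = (if j = k then if P k then c else 0 else 0)"
    for c :: 'k and j by (simp add: lookup_single when_def)
  then show ?thesis
    by (auto simp: lin_def lookup_sum sum.delta in_keys_iff)
qed

definition pcomp :: "int \<Rightarrow> ('a multiset \<Rightarrow>\<^sub>0 'k::field) \<Rightarrow> ('a multiset \<Rightarrow>\<^sub>0 'k)" where
  "pcomp n = lin (\<lambda>M. if int (size M) = n then Poly_Mapping.single M 1 else 0)"

lemma klin_pcomp: "klin (pcomp n)"
  unfolding pcomp_def by (rule klin_lin)

lemma lookup_pcomp: "lookup (pcomp n f) M = (if int (size M) = n then lookup f M else 0)"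
  unfolding pcomp_def by (rule lookup_lin_filter)

lemma homog_pcomp: "homog n (pcomp n f)"
  by (auto simp: homog_def in_keys_iff lookup_pcomp split: if_splits)

lemma pcomp_homog: "homog n f \<Longrightarrow> pcomp m f = (if m = n then f else 0)"
  by (rule poly_mapping_eqI) (auto simp: homog_def lookup_pcomp in_keys_iff)

lemma homog_neg: "homog n f \<Longrightarrow> n < 0 \<Longrightarrow> f = 0"
  by (rule poly_mapping_eqI) (auto simp: homog_def in_keys_iff)

lemma homog_0: "homog n 0" and homog_1: "homog 0 1"
  by (simp_all add: homog_def)

lemma homog_single: "homog (int (size M)) (Poly_Mapping.single M c)"
  by (auto simp: homog_def split: if_splits)

lemma homog_add: "homog n f \<Longrightarrow> homog n g \<Longrightarrow> homog n (f + g)"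
  using keys_add[of f g] by (auto simp: homog_def)

lemma homog_cst: "homog n f \<Longrightarrow> homog n (cst c * f)"
  by (auto simp: homog_def in_keys_iff)

lemma homog_sum: "(\<And>i. i \<in> A \<Longrightarrow> homog n (f i)) \<Longrightarrow> homog n (sum f A)"
  by (induction A rule: infinite_finite_induct) (auto simp: homog_0 homog_add)

lemma homog_mult: "homog m f \<Longrightarrow> homog n g \<Longrightarrow> homog (m + n) (f * g)"
  using keys_mult[of f g] by (fastforce simp: homog_def)

lemma homog_prod_list: "(\<And>f. f \<in> set fs \<Longrightarrow> homog 1 f) \<Longrightarrow> homog (int (length fs)) (prod_list fs)"
proof (induction fs)
  case (Cons f fs)
  then show ?case using homog_mult[of 1 f "int (length fs)" "prod_list fs"] by auto
qed (simp add: homog_1)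

lemma homog_lin: "(\<And>M. M \<in> keys f \<Longrightarrow> homog n (h M)) \<Longrightarrow> homog n (lin h f)"
  unfolding lin_def by (intro homog_sum homog_cst)

text \<open>
  The part of word length \<open>n\<close> and the part \<open>pcomp\<close> of degree \<open>n\<close> correspond under \<open>poly_of\<close>.
\<close>

definition tcomp :: "nat \<Rightarrow> ('k::field, 'g) free_alg \<Rightarrow> ('k, 'g) free_alg" where
  "tcomp n = lin (\<lambda>w. if length (letters w) = n then Poly_Mapping.single w 1 else 0)"

lemma klin_tcomp: "klin (tcomp n)"
  unfolding tcomp_def by (rule klin_lin)

lemma lookup_tcomp: "lookup (tcomp n f) w = (if length (letters w) = n then lookup f w else 0)"
  unfolding tcomp_def by (rule lookup_lin_filter)

lemma tcomp_wd: "tcomp n (wd xs) = (if length xs = n then wd xs else 0)"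
  by (simp add: tcomp_def)

lemma tcomp_decompose:
  assumes "\<And>w. w \<in> keys f \<Longrightarrow> length (letters w) \<le> N"
  shows "f = (\<Sum>n\<le>N. tcomp n f)"
proof (rule poly_mapping_eqI)
  fix w
  have "lookup (\<Sum>n\<le>N. tcomp n f) w = (\<Sum>n\<le>N. if n = length (letters w) then lookup f w else 0)"
    by (simp only: lookup_sum lookup_tcomp) (rule sum.cong, auto)
  also have "\<dots> = lookup f w"
    using assms[of w] by (auto simp: sum.delta' in_keys_iff)
  finally show "lookup f w = lookup (\<Sum>n\<le>N. tcomp n f) w" by simp
qed

locale sym_space = vector_space scale
  for scale :: "'k::field_char_0 \<Rightarrow> 'g::ab_group_add \<Rightarrow> 'g"
begin

definition cbasis :: "'g set" where "cbasis = extend_basis {}"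

lemma cbasis: "independent cbasis" "span cbasis = UNIV"
  by (simp_all add: cbasis_def independent_extend_basis independent_empty)

definition coords :: "'g \<Rightarrow> ('g \<Rightarrow>\<^sub>0 'k)" where
  "coords x = Abs_poly_mapping (representation cbasis x)"

lemma lookup_coords: "lookup (coords x) b = representation cbasis x b"
  unfolding coords_def by (simp add: finite_representation)

lemma coords_add: "coords (x + y) = coords x + coords y"
  by (rule poly_mapping_eqI) (simp add: lookup_coords lookup_add representation_add cbasis)

lemma coords_scale: "coords (scale c x) = cst c * coords x"
  by (rule poly_mapping_eqI) (simp add: lookup_coords representation_scale cbasis)

lemma sum_coords: "(\<Sum>b\<in>keys (coords x). scale (lookup (coords x) b) b) = x"
proof -
  have "keys (coords x) = {b. representation cbasis x b \<noteq> 0}"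
    by (auto simp: in_keys_iff lookup_coords)
  then show ?thesis
    using sum_nonzero_representation_eq[OF cbasis(1), of x] by (simp add: lookup_coords cbasis)
qed

text \<open>
  Linear maps on the vector space, whose scalar multiplication is not of the form \<open>cst\<close>.
\<close>

definition glin :: "('g \<Rightarrow> ('b::monoid_add \<Rightarrow>\<^sub>0 'k)) \<Rightarrow> bool" where
  "glin F \<longleftrightarrow> (\<forall>x y. F (x + y) = F x + F y) \<and> (\<forall>c x. F (scale c x) = cst c * F x)"

lemma glin_add: "glin F \<Longrightarrow> F (x + y) = F x + F y"
  and glin_scale: "glin F \<Longrightarrow> F (scale c x) = cst c * F x"
  by (auto simp: glin_def)

lemma glin_0: "glin F \<Longrightarrow> F 0 = 0"
  using glin_scale[of F 0 0] by simp

lemma glin_coords: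
  assumes "glin F"
  shows "lin F (coords x) = F x"
proof -
  have "F (\<Sum>b\<in>A. scale (c b) b) = (\<Sum>b\<in>A. cst (c b) * F b)" for A and c :: "'g \<Rightarrow> 'k"
    by (induction A rule: infinite_finite_induct)
       (use assms in \<open>auto simp: glin_0 glin_add glin_scale\<close>)
  from this[of "lookup (coords x)" "keys (coords x)"] show ?thesis
    by (simp add: lin_def sum_coords)
qed

text \<open>
  A vector as a linear form in the variables, which are the vectors of the chosen basis.
\<close>

definition iota :: "'g \<Rightarrow> ('g multiset \<Rightarrow>\<^sub>0 'k)" where
  "iota x = lin (\<lambda>b. Poly_Mapping.single {#b#} 1) (coords x)"

lemma glin_iota: "glin iota"
  by (simp add: glin_def iota_def coords_add coords_scale lin_add lin_cst)

lemma homog_iota: "homog 1 (iota x)"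
  unfolding iota_def by (rule homog_lin) (use homog_single[of "{#_#}"] in auto)

definition poly_of :: "('k, 'g) free_alg \<Rightarrow> ('g multiset \<Rightarrow>\<^sub>0 'k)" where
  "poly_of = lin (\<lambda>w. prod_list (map iota (letters w)))"

lemma klin_poly_of: "klin poly_of"
  unfolding poly_of_def by (rule klin_lin)

lemma poly_of_wd: "poly_of (wd xs) = prod_list (map iota xs)"
  by (simp add: poly_of_def)

lemma poly_of_1: "poly_of 1 = 1"
  using poly_of_wd[of "[]"] by simp

lemma poly_of_letter: "poly_of (letter x) = iota x"
  by (simp add: letter_eq_wd poly_of_wd)

lemma poly_of_mult: "poly_of (f * g) = poly_of f * poly_of g"
proof (rule klin_free_eqI[where F = "\<lambda>f. poly_of (f * g)" and G = "\<lambda>f. poly_of f * poly_of g"])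
  fix xs
  show "poly_of (wd xs * g) = poly_of (wd xs) * poly_of g"
  proof (rule klin_free_eqI[where F = "\<lambda>g. poly_of (wd xs * g)" and G = "\<lambda>g. poly_of (wd xs) * poly_of g"])
    show "poly_of (wd xs * wd ys) = poly_of (wd xs) * poly_of (wd ys)" for ys
      by (simp add: wd_append[symmetric] poly_of_wd)
  qed (rule klin_compose[OF klin_poly_of klin_lmult[OF klin_id]] klin_lmult[OF klin_poly_of])+
qed (rule klin_compose[OF klin_poly_of klin_rmult[OF klin_id]] klin_rmult[OF klin_poly_of])+

lemma poly_of_cst: "poly_of (cst c) = cst c"
  using klin_cst[OF klin_poly_of, of c 1] by (simp add: poly_of_1)

lemma poly_of_power: "poly_of (f ^ n) = poly_of f ^ n"
  by (induction n) (simp_all add: poly_of_1 poly_of_mult)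

lemma poly_of_tcomp: "poly_of (tcomp n f) = pcomp (int n) (poly_of f)"
proof (rule klin_free_eqI[where F = "\<lambda>f. poly_of (tcomp n f)" and G = "\<lambda>f. pcomp (int n) (poly_of f)"])
  fix xs
  have "homog (int (length xs)) (prod_list (map iota xs))"
    using homog_prod_list[of "map iota xs"] homog_iota by auto
  then show "poly_of (tcomp n (wd xs)) = pcomp (int n) (poly_of (wd xs))"
    by (simp add: tcomp_wd poly_of_wd pcomp_homog klin_0[OF klin_poly_of])
qed (rule klin_compose[OF klin_poly_of klin_tcomp] klin_compose[OF klin_pcomp klin_poly_of])+

sublocale SI: free_ideal "sym_ideal scale"
  unfolding sym_ideal_def by (rule genideal_free_ideal)

lemma letter_add_sym: "letter (x + y) - (letter x + letter y) \<in> sym_ideal scale"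
  and letter_scale_sym: "letter (scale c x) - cst c * letter x \<in> sym_ideal scale"
  and letter_comm_sym: "letter x * letter y - letter y * letter x \<in> sym_ideal scale"
  unfolding sym_ideal_def
  by (rule genideal_gen, auto simp: tensor_rels_def free_const_eq_cst)+

lemma sym_ideal_cases:
  assumes "f \<in> sym_ideal scale" "subsp N"
    and "\<And>u v x y. wd u * (letter (x + y) - (letter x + letter y)) * wd v \<in> N"
    and "\<And>u v c x. wd u * (letter (scale c x) - cst c * letter x) * wd v \<in> N"
    and "\<And>u v x y. wd u * (letter x * letter y - letter y * letter x) * wd v \<in> N"
  shows "f \<in> N"
  using assms(1) unfolding sym_ideal_def
  by (rule genideal_induct) (use assms in \<open>auto simp: tensor_rels_def free_const_eq_cst\<close>)

lemma poly_of_sym_ideal: "f \<in> sym_ideal scale \<Longrightarrow> poly_of f = 0"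
  using sym_ideal_cases[of f "{f. poly_of f = 0}"] klin_poly_of
  by (auto simp: subsp_def klin_0 klin_add klin_cst klin_diff poly_of_mult poly_of_letter poly_of_cst
      glin_add glin_scale glin_iota mult.commute)

text \<open>
  Modulo the ideal letters commute, hence words do, hence everything does.
\<close>

lemma mult_comm_sym: "f * g - g * f \<in> sym_ideal scale"
proof -
  have 1: "letter x * wd ys - wd ys * letter x \<in> sym_ideal scale" for x ys
  proof (induction ys)
    case (Cons y ys)
    have "letter x * wd (y # ys) - wd (y # ys) * letter x
       = (letter x * letter y - letter y * letter x) * wd ys + letter y * (letter x * wd ys - wd ys * letter x)"
      by (simp add: wd_Cons algebra_simps)
    also have "\<dots> \<in> sym_ideal scale"
      by (rule SI.add_mem[OF SI.rmult_mem[OF letter_comm_sym] SI.lmult_mem[OF Cons]])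
    finally show ?case .
  qed (simp add: SI.zero_mem)
  have 2: "wd xs * wd ys - wd ys * wd xs \<in> sym_ideal scale" for xs ys
  proof (induction xs)
    case (Cons x xs)
    have "wd (x # xs) * wd ys - wd ys * wd (x # xs)
       = letter x * (wd xs * wd ys - wd ys * wd xs) + (letter x * wd ys - wd ys * letter x) * wd xs"
      by (simp add: wd_Cons algebra_simps)
    also have "\<dots> \<in> sym_ideal scale"
      by (rule SI.add_mem[OF SI.lmult_mem[OF Cons] SI.rmult_mem[OF 1]])
    finally show ?case .
  qed (simp add: SI.zero_mem)
  have sub: "subsp {g. f * g - g * f \<in> sym_ideal scale}" for f
  proof -
    have "f * (g + h) - (g + h) * f = (f * g - g * f) + (f * h - h * f)" for g h
      by (simp add: algebra_simps)
    moreover have "f * (cst c * g) - cst c * g * f = cst c * (f * g - g * f)" for c g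
      by (simp add: algebra_simps cst_left_commute)
    ultimately show ?thesis
      by (simp add: subsp_def SI.zero_mem SI.add_mem SI.lmult_mem)
  qed
  have 3: "wd xs * g - g * wd xs \<in> sym_ideal scale" for xs g
    using free_alg_induct[OF sub, of "wd xs" g] 2 by simp
  then show ?thesis
    using free_alg_induct[OF sub, of g f] SI.swap_mem by auto
qed

lemma wd_mset_sym: "mset xs = mset ys \<Longrightarrow> wd xs - wd ys \<in> sym_ideal scale"
proof (induction xs arbitrary: ys)
  case (Cons x xs)
  then have "x \<in> set ys" by (metis list.set_intros(1) set_mset_mset)
  then obtain us vs where ys: "ys = us @ x # vs" by (meson split_list)
  then have "wd xs - wd (us @ vs) \<in> sym_ideal scale" using Cons by auto
  then have "letter x * (wd xs - wd (us @ vs)) + (letter x * wd us - wd us * letter x) * wd vs \<in> sym_ideal scale"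
    by (intro SI.add_mem SI.lmult_mem SI.rmult_mem mult_comm_sym)
  then show ?case
    by (simp add: ys wd_Cons wd_append algebra_simps)
qed (simp add: SI.zero_mem)

lemma letter_coords_sym: "letter x - lin letter (coords x) \<in> sym_ideal scale"
proof -
  have l0: "letter 0 \<in> sym_ideal scale"
    using letter_scale_sym[of 0 0] by simp
  have "letter (\<Sum>b\<in>A. scale (c b) b) - (\<Sum>b\<in>A. cst (c b) * letter b) \<in> sym_ideal scale"
    for A and c :: "'g \<Rightarrow> 'k"
  proof (induction A rule: infinite_finite_induct)
    case (insert b A)
    from SI.add_mem[OF SI.add_mem[OF insert.IH letter_scale_sym[of "c b" b]]
        letter_add_sym[of "scale (c b) b" "\<Sum>b\<in>A. scale (c b) b"]]
    show ?case using insert.hyps by (simp add: algebra_simps)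
  qed (simp_all add: l0)
  from this[of "lookup (coords x)" "keys (coords x)"] show ?thesis
    by (simp add: lin_def sum_coords)
qed

text \<open>
  A linear section of \<open>poly_of\<close> modulo the ideal. The order in which the letters of a monomial are
  written is chosen arbitrarily; by \<open>wd_mset_sym\<close> it does not matter.
\<close>

definition sec :: "('g multiset \<Rightarrow>\<^sub>0 'k) \<Rightarrow> ('k, 'g) free_alg" where
  "sec = lin (\<lambda>M. wd (SOME xs. mset xs = M))"

lemma klin_sec: "klin sec"
  unfolding sec_def by (rule klin_lin)

lemma letter_sec_sym: "letter x * sec m - sec (iota x * m) \<in> sym_ideal scale"
proof -
  have b: "letter b * sec m - sec (Poly_Mapping.single {#b#} 1 * m) \<in> sym_ideal scale" for b
  proof -
    have "letter b * sec (Poly_Mapping.single M 1) - sec (Poly_Mapping.single {#b#} 1 * Poly_Mapping.single M 1)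
        \<in> sym_ideal scale" for M
    proof -
      have e: "mset (SOME xs. mset xs = N) = N" for N :: "'g multiset"
        by (rule someI_ex) (rule ex_mset)
      have "wd (b # (SOME xs. mset xs = M)) - wd (SOME xs. mset xs = add_mset b M) \<in> sym_ideal scale"
        by (rule wd_mset_sym) (simp add: e)
      then show ?thesis by (simp add: sec_def mult_single wd_Cons)
    qed
    moreover have "subsp {m. letter b * sec m - sec (Poly_Mapping.single {#b#} 1 * m) \<in> sym_ideal scale}"
      by (rule SI.subsp_cong[OF klin_lmult[OF klin_sec] klin_compose[OF klin_sec klin_lmult[OF klin_id]]])
    ultimately show ?thesis using klin_span_induct by blast
  qed
  have "subsp {c. lin letter c * sec m - sec (lin (\<lambda>b. Poly_Mapping.single {#b#} 1) c * m) \<in> sym_ideal scale}"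
    by (rule SI.subsp_cong[OF klin_rmult[OF klin_lin] klin_compose[OF klin_sec klin_rmult[OF klin_lin]]])
  from klin_span_induct[OF this, of "coords x"] b
  have "lin letter (coords x) * sec m - sec (iota x * m) \<in> sym_ideal scale"
    by (simp add: iota_def)
  from SI.add_mem[OF this SI.rmult_mem[OF letter_coords_sym[of x], of "sec m"]]
  show ?thesis by (simp add: algebra_simps)
qed

text \<open>
  Every word is, modulo the ideal, the section of its polynomial: expand its letters in the basis
  one after the other. This makes the kernel of \<open>poly_of\<close> no larger than the ideal.
\<close>

lemma sec_poly_of_sym: "f - sec (poly_of f) \<in> sym_ideal scale"
proof -
  have "wd xs - sec (poly_of (wd xs)) \<in> sym_ideal scale" for xs
  proof (induction xs)
    case Nil
    have "sec 1 = 1"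
      using lin_single[of "\<lambda>M. wd (SOME xs. mset xs = M)" "{#}" 1] by (simp add: sec_def)
    then show ?case by (simp add: poly_of_1 SI.zero_mem)
  next
    case (Cons x xs)
    from SI.add_mem[OF SI.lmult_mem[OF Cons, of "letter x"] letter_sec_sym[of x "poly_of (wd xs)"]]
    show ?case by (simp add: wd_Cons poly_of_mult poly_of_letter algebra_simps)
  qed
  moreover have "subsp {f. f - sec (poly_of f) \<in> sym_ideal scale}"
    by (rule SI.subsp_cong[OF klin_id klin_compose[OF klin_sec klin_poly_of]])
  ultimately show ?thesis using free_alg_induct by blast
qed

lemma poly_of_eq_0_iff: "poly_of f = 0 \<longleftrightarrow> f \<in> sym_ideal scale"
  using poly_of_sym_ideal[of f] sec_poly_of_sym[of f] by (auto simp: klin_0[OF klin_sec])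

lemma poly_of_eq_iff: "poly_of f = poly_of g \<longleftrightarrow> f - g \<in> sym_ideal scale"
  using poly_of_eq_0_iff[of "f - g"] by (simp add: klin_diff[OF klin_poly_of])

text \<open>Polarization: apply the lemma on polynomial curves to \<open>(u + t x)\<^sup>m\<close>.\<close>

lemma iota_powers_span:
  assumes V: "subsp V" and pow: "\<And>y n. iota y ^ n \<in> V"
  shows "poly_of f \<in> V"
proof -
  have "prod_list (map iota xs) * iota u ^ m \<in> V" for xs u m
  proof (induction xs arbitrary: u m)
    case Nil
    then show ?case by (simp add: pow)
  next
    case (Cons x xs)
    define v where "v = (\<lambda>i. of_nat (Suc m choose i) * (prod_list (map iota xs) * (iota x ^ i * iota u ^ (Suc m - i))))"
    have "(\<Sum>i\<le>Suc m. cst (t ^ i) * v i) \<in> V" for t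
    proof -
      have cp: "cst (t ^ i) = cst t ^ i" for i by (induction i) (simp_all add: cst_mult)
      have "iota (scale t x + u) = cst t * iota x + iota u"
        by (simp add: glin_add glin_scale glin_iota)
      moreover have "prod_list (map iota xs) * (cst t * iota x + iota u) ^ Suc m = (\<Sum>i\<le>Suc m. cst (t ^ i) * v i)"
        unfolding binomial_ring sum_distrib_left v_def cp
        by (rule sum.cong) (simp_all add: power_mult_distrib mult_ac)
      ultimately show ?thesis using Cons[of "scale t x + u" "Suc m"] by simp
    qed
    then have "v 1 \<in> V" by (rule subsp_coeffs[OF V]) simp
    then have "cst (1 / of_nat (Suc m)) * v 1 \<in> V" by (rule subspD(3)[OF V])
    moreover have "v 1 = cst (of_nat (Suc m)) * (prod_list (map iota (x # xs)) * iota u ^ m)"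
      by (simp add: v_def cst_add cst_of_nat mult_ac)
    moreover have "of_nat (Suc m) \<noteq> (0 :: 'k)" by (simp only: of_nat_eq_0_iff)
    ultimately show ?case by (simp only: cst_cancel not_False_eq_True)
  qed
  from this[of _ 0 0] have "poly_of (wd xs) \<in> V" for xs by (simp add: poly_of_wd)
  moreover have "subsp {f. poly_of f \<in> V}"
    using subspD(1-3)[OF V] by (simp add: subsp_def klin_0[OF klin_poly_of] klin_add[OF klin_poly_of] klin_cst[OF klin_poly_of])
  ultimately show ?thesis using free_alg_induct by blast
qed

text \<open>
  A linear property of the elements of the symmetric algebra holds as soon as it holds for powers
  of vectors.
\<close>

lemma free_alg_power_induct:
  assumes "subsp V" "sym_ideal scale \<subseteq> V" "\<And>y n. letter y ^ n \<in> V"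
  shows "f \<in> V"
proof -
  have "subsp (poly_of ` V)"
    unfolding subsp_def
  proof (intro conjI ballI allI)
    show "0 \<in> poly_of ` V"
      using subspD(1)[OF assms(1)] klin_0[OF klin_poly_of] by (metis imageI)
  next
    fix f g assume "f \<in> poly_of ` V" "g \<in> poly_of ` V"
    then show "f + g \<in> poly_of ` V"
      using subspD(2)[OF assms(1)] klin_add[OF klin_poly_of] by (auto simp: image_iff) metis
  next
    fix c f assume "f \<in> poly_of ` V"
    then show "cst c * f \<in> poly_of ` V"
      using subspD(3)[OF assms(1)] klin_cst[OF klin_poly_of] by (auto simp: image_iff) metis
  qed
  moreover have "iota y ^ n \<in> poly_of ` V" for y n
    using assms(3)[of y n] poly_of_power[of "letter y" n] by (metis imageI poly_of_letter)
  ultimately have "poly_of f \<in> poly_of ` V" by (rule iota_powers_span)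
  then obtain g where "g \<in> V" "f - g \<in> sym_ideal scale" by (auto simp: poly_of_eq_iff)
  then show ?thesis
    using subspD(2)[OF assms(1), of "f - g" g] assms(2) by auto
qed

end

section \<open>Symmetrization on words\<close>

abbreviation invp :: "('a \<Rightarrow> 'a) \<Rightarrow> 'a \<Rightarrow> 'a" where "invp \<sigma> \<equiv> inv_into UNIV \<sigma>"

text \<open>
  The average over all orders of the letters. On representatives it involves neither the bracket
  nor the relations; it descends to a map \<open>S \<rightarrow> U\<close> by \<open>symz_mem\<close> below.
\<close>

definition symz :: "('k::field_char_0, 'g) free_alg \<Rightarrow> ('k, 'g) free_alg" where
  "symz = lin (\<lambda>w. cst (1 / fact (length (letters w))) *
     (\<Sum>\<sigma> | \<sigma> permutes {..<length (letters w)}. wd (permute_list \<sigma> (letters w))))"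

lemma klin_symz: "klin symz"
  unfolding symz_def by (rule klin_lin)

lemma symz_wd:
  "symz (wd xs) = cst (1 / fact (length xs)) * (\<Sum>\<sigma> | \<sigma> permutes {..<length xs}. wd (permute_list \<sigma> xs))"
  by (simp add: symz_def)

lemma symz_mset_eq:
  fixes xs ys :: "'g list"
  assumes "mset xs = mset ys"
  shows "(symz (wd xs) :: ('k::field_char_0, 'g) free_alg) = symz (wd ys)"
proof -
  obtain p where p: "p permutes {..<length ys}" "permute_list p ys = xs"
    using mset_eq_permutation[OF assms] by blast
  have len: "length xs = length ys" using assms by (rule mset_eq_length)
  have "(\<Sum>\<sigma> | \<sigma> permutes {..<length ys}. wd (permute_list \<sigma> ys) :: ('k, 'g) free_alg)
      = (\<Sum>\<sigma> | \<sigma> permutes {..<length ys}. wd (permute_list (p \<circ> \<sigma>) ys))"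
    by (rule setum_permutations_compose_left[OF p(1)])
  also have "\<dots> = (\<Sum>\<sigma> | \<sigma> permutes {..<length ys}. wd (permute_list \<sigma> xs))"
    by (rule sum.cong[OF refl]) (auto simp: permute_list_compose p(2))
  finally show ?thesis by (simp add: symz_wd len)
qed

lemma permute_list_update:
  assumes "\<sigma> permutes {..<length xs}" "i < length xs"
  shows "permute_list \<sigma> (xs[i := z]) = (permute_list \<sigma> xs)[invp \<sigma> i := z]"
proof (rule nth_equalityI)
  fix j assume "j < length (permute_list \<sigma> (xs[i := z]))"
  then have j: "j < length xs" by simp
  have "\<sigma> j < length xs" using permutes_in_image[OF assms(1)] j by (metis lessThan_iff)
  moreover have "invp \<sigma> i = j \<longleftrightarrow> \<sigma> j = i" using permutes_inv_eq[OF assms(1)] .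
  ultimately show "permute_list \<sigma> (xs[i := z]) ! j = (permute_list \<sigma> xs)[invp \<sigma> i := z] ! j"
    using j assms by (auto simp: permute_list_nth nth_list_update)
qed simp

lemma wd_update: "j < length m \<Longrightarrow> wd (m[j := z]) = wd (take j m) * letter z * wd (drop (Suc j) m)"
  by (simp add: upd_conv_take_nth_drop wd_append wd_Cons mult.assoc)

lemma permute_list_replicate: "permute_list \<sigma> (replicate n y) = replicate n y"
  if "\<sigma> permutes {..<n}"
proof (rule nth_equalityI)
  fix j assume "j < length (permute_list \<sigma> (replicate n y))"
  then have j: "j < n" by simp
  then have "\<sigma> j < n" using permutes_in_image[OF that] by (metis lessThan_iff)
  then show "permute_list \<sigma> (replicate n y) ! j = replicate n y ! j"
    using j that by (simp add: permute_list_nth)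
qed simp

lemma symz_power:
  fixes y :: 'g
  shows "(symz (letter y ^ n) :: ('k::field_char_0, 'g) free_alg) = letter y ^ n"
proof -
  have "(\<Sum>\<sigma> | \<sigma> permutes {..<n}. wd (permute_list \<sigma> (replicate n y)) :: ('k, 'g) free_alg)
      = (\<Sum>\<sigma> | \<sigma> permutes {..<n}. wd (replicate n y))"
    by (rule sum.cong) (auto simp: permute_list_replicate)
  also have "\<dots> = of_nat (fact n) * wd (replicate n y)"
    by (simp add: card_permutations[of _ n])
  also have "\<dots> = cst (fact n) * wd (replicate n y)"
    by (simp only: cst_of_nat[symmetric] of_nat_fact)
  finally show ?thesis
    by (simp add: wd_replicate[symmetric] symz_wd cst_cancel)
qed

text \<open>
  Each of the \<open>n + 1\<close> positions is the one of the first letter for \<open>n!\<close> permutations.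
\<close>

lemma sum_permutes_position:
  fixes h :: "nat \<Rightarrow> 'a::ring_1"
  shows "(\<Sum>\<sigma> | \<sigma> permutes {..<Suc n}. h (invp \<sigma> 0)) = of_nat (fact n) * (\<Sum>j\<le>n. h j)"
proof -
  have "(\<Sum>\<sigma> | \<sigma> permutes {..<Suc n}. h (invp \<sigma> 0)) = (\<Sum>\<sigma> | \<sigma> permutes {..<Suc n}. h (\<sigma> 0))"
    by (subst sum_permutations_inverse)
       (rule sum.cong, auto simp: permutes_inv_inv)
  also have "{..<Suc n} = insert 0 {1..n}" by auto
  also have "(\<Sum>\<sigma> | \<sigma> permutes insert 0 {1..n}. h (\<sigma> 0))
      = (\<Sum>b\<in>insert 0 {1..n}. \<Sum>q | q permutes {1..n}. h ((transpose 0 b \<circ> q) 0))"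
    by (rule sum_over_permutations_insert) auto
  also have "\<dots> = (\<Sum>b\<in>insert 0 {1..n}. \<Sum>q | q permutes {1..n}. h b)"
  proof (rule sum.cong[OF refl], rule sum.cong[OF refl])
    fix b q assume "q \<in> {q. q permutes {1..n}}"
    then have "q 0 = 0" by (simp add: permutes_def)
    then show "h ((transpose 0 b \<circ> q) 0) = h b" by simp
  qed
  also have "\<dots> = (\<Sum>b\<in>insert 0 {1..n}. of_nat (fact n) * h b)"
    by (simp add: card_permutations[of _ n])
  also have "insert 0 {1..n} = {..n}" by auto
  finally show ?thesis by (simp only: sum_distrib_left lessThan_Suc_atMost)
qed

lemma symz_letter_power:
  fixes y z :: 'g
  shows "(symz (letter z * letter y ^ n) :: ('k::field_char_0, 'g) free_alg)
     = cst (1 / of_nat (Suc n)) * (\<Sum>i\<le>n. letter y ^ i * letter z * letter y ^ (n - i))"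
proof -
  define h where "h = (\<lambda>j. letter y ^ j * letter z * letter y ^ (n - j) :: ('k, 'g) free_alg)"
  have l: "z # replicate n y = (replicate (Suc n) y)[0 := z]" by simp
  have "(\<Sum>\<sigma> | \<sigma> permutes {..<Suc n}. wd (permute_list \<sigma> (z # replicate n y)) :: ('k, 'g) free_alg)
      = (\<Sum>\<sigma> | \<sigma> permutes {..<Suc n}. h (invp \<sigma> 0))"
  proof (rule sum.cong[OF refl])
    fix \<sigma> assume "\<sigma> \<in> {\<sigma>. \<sigma> permutes {..<Suc n}}"
    then have s: "\<sigma> permutes {..<Suc n}" by simp
    have j: "invp \<sigma> 0 < Suc n"
      using permutes_in_image[OF permutes_inv[OF s], of 0] by simp
    have "permute_list \<sigma> (z # replicate n y) = (replicate (Suc n) y)[invp \<sigma> 0 := z]"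
      unfolding l by (subst permute_list_update) (use s in \<open>auto simp: permute_list_replicate simp del: replicate_Suc\<close>)
    then show "wd (permute_list \<sigma> (z # replicate n y)) = h (invp \<sigma> 0)"
      using j by (simp add: wd_update h_def wd_replicate[symmetric] min_def del: replicate_Suc)
  qed
  also have "\<dots> = cst (fact n) * (\<Sum>j\<le>n. h j)"
    unfolding sum_permutes_position by (simp only: cst_of_nat[symmetric] of_nat_fact)
  finally have "symz (wd (z # replicate n y)) = cst (1 / fact (Suc n)) * (cst (fact n) * (\<Sum>j\<le>n. h j))"
    by (simp add: symz_wd)
  also have "1 / fact (Suc n) = 1 / of_nat (Suc n) * (1 / fact n :: 'k)"
    by simp
  also have "cst (1 / of_nat (Suc n) * (1 / fact n)) * (cst (fact n) * (\<Sum>j\<le>n. h j)) = cst (1 / of_nat (Suc n)) * (\<Sum>j\<le>n. h j)"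
    unfolding cst_mult mult.assoc by (simp only: cst_cancel fact_nonzero not_False_eq_True)
  finally show ?thesis
    by (simp add: wd_Cons wd_replicate h_def)
qed

definition trev :: "('k::field, 'g) free_alg \<Rightarrow> ('k, 'g) free_alg" where
  "trev = lin (\<lambda>w. wd (rev (letters w)))"

lemma klin_trev: "klin trev"
  unfolding trev_def by (rule klin_lin)

lemma trev_wd [simp]: "trev (wd xs) = wd (rev xs)"
  by (simp add: trev_def)

lemma trev_letter [simp]: "trev (letter x) = letter x"
  by (simp add: letter_eq_wd)

lemma trev_mult: "trev (f * g) = trev g * trev f"
proof (rule klin_free_eqI[where F = "\<lambda>f. trev (f * g)" and G = "\<lambda>f. trev g * trev f"])
  fix xs
  show "trev (wd xs * g) = trev g * trev (wd xs)"
  proof (rule klin_free_eqI[where F = "\<lambda>g. trev (wd xs * g)" and G = "\<lambda>g. trev g * trev (wd xs)"])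
    show "trev (wd xs * wd ys) = trev (wd ys) * trev (wd xs)" for ys
      by (simp add: wd_append[symmetric])
  qed (rule klin_compose[OF klin_trev klin_lmult[OF klin_id]] klin_rmult[OF klin_trev])+
qed (rule klin_compose[OF klin_trev klin_rmult[OF klin_id]] klin_lmult[OF klin_trev])+

text \<open>
  Composing with the reversal of positions permutes the orders that are averaged.
\<close>

lemma trev_symz:
  fixes f :: "('k::field_char_0, 'g) free_alg"
  shows "trev (symz f) = symz f"
proof (rule klin_free_eqI[where F = "\<lambda>f. trev (symz f)" and G = symz])
  fix xs :: "'g list"
  define n where "n = length xs"
  define \<rho> where "\<rho> = (\<lambda>i. if i < n then n - 1 - i else i)"
  have \<rho>: "\<rho> permutes {..<n}"
  proof (rule bij_imp_permutes)
    show "bij_betw \<rho> {..<n} {..<n}"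
      by (rule bij_betw_byWitness[where f' = \<rho>]) (auto simp: \<rho>_def)
  qed (auto simp: \<rho>_def)
  have "rev (permute_list \<sigma> xs) = permute_list (\<sigma> \<circ> \<rho>) xs" if "\<sigma> permutes {..<n}" for \<sigma>
  proof -
    have "rev l = permute_list \<rho> l" if "length l = n" for l :: "'g list"
      by (rule nth_equalityI) (use that \<rho> in \<open>auto simp: rev_nth permute_list_nth \<rho>_def\<close>)
    from this[of "permute_list \<sigma> xs"] show ?thesis
      using \<rho> by (simp add: n_def permute_list_compose)
  qed
  then have "trev (\<Sum>\<sigma> | \<sigma> permutes {..<n}. wd (permute_list \<sigma> xs))
      = (\<Sum>\<sigma> | \<sigma> permutes {..<n}. wd (permute_list (\<sigma> \<circ> \<rho>) xs) :: ('k, 'g) free_alg)"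
    unfolding klin_sum[OF klin_trev] by (intro sum.cong) auto
  also have "\<dots> = (\<Sum>\<sigma> | \<sigma> permutes {..<n}. wd (permute_list \<sigma> xs))"
    by (rule sum_permutations_compose_right[OF \<rho>, symmetric])
  finally show "trev (symz (wd xs)) = symz (wd xs :: ('k, 'g) free_alg)"
    by (simp add: symz_wd klin_cst[OF klin_trev] n_def)
qed (rule klin_compose[OF klin_trev klin_symz] klin_symz)+

text \<open>
  An ideal modulo which letters depend linearly on vectors. Symmetrized words then depend
  multilinearly on their letters, and they are symmetric, so they kill the relations of \<open>S\<close>.
\<close>

locale tensor_ideal = sym_space scale + free_ideal I
  for scale :: "'k::field_char_0 \<Rightarrow> 'g::ab_group_add \<Rightarrow> 'g" and I :: "('k, 'g) free_alg set" +
  assumes letter_add_mem: "letter (x + y) - (letter x + letter y) \<in> I"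
    and letter_scale_mem: "letter (scale c x) - cst c * letter x \<in> I"
begin

lemma symz_mem:
  assumes "f \<in> sym_ideal scale"
  shows "symz f \<in> I"
proof -
  have subN: "subsp {f. symz f \<in> I}"
    by (simp add: subsp_def klin_0[OF klin_symz] klin_add[OF klin_symz] klin_cst[OF klin_symz]
        zero_mem add_mem lmult_mem)
  have slot: "symz (wd u * letter z * wd v) = cst (1 / fact (length u + Suc (length v))) *
      (\<Sum>\<sigma> | \<sigma> permutes {..<length u + Suc (length v)}. wd ((permute_list \<sigma> (u @ 0 # v))[invp \<sigma> (length u) := z]))"
    for u v z
  proof -
    have w: "wd u * letter z * wd v = wd ((u @ 0 # v)[length u := z])"
      by (simp add: wd_append wd_Cons mult.assoc)
    show ?thesis
      unfolding w symz_wd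
      by (rule arg_cong2[where f = "(*)"], simp)
         (rule sum.cong, simp, subst permute_list_update, auto)
  qed
  have pos: "invp \<sigma> (length u) < length (permute_list \<sigma> (u @ 0 # v))"
    if "\<sigma> permutes {..<length u + Suc (length v)}" for \<sigma> and u v :: "'g list"
    using permutes_in_image[OF permutes_inv[OF that], of "length u"] by simp
  show ?thesis
  proof (rule CollectD[of f "\<lambda>f. symz f \<in> I"], rule sym_ideal_cases[OF assms subN], goal_cases)
    case (1 u v x y)
    have *: "wd (m[j := x + y]) - (wd (m[j := x]) + wd (m[j := y])) \<in> I" if "j < length m" for m j
    proof -
      have "wd (take j m) * (letter (x + y) - (letter x + letter y)) * wd (drop (Suc j) m) \<in> I"
        by (intro rmult_mem lmult_mem letter_add_mem)
      then show ?thesis using that by (simp add: wd_update algebra_simps)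
    qed
    have "symz (wd u * (letter (x + y) - (letter x + letter y)) * wd v)
        = symz (wd u * letter (x + y) * wd v) - (symz (wd u * letter x * wd v) + symz (wd u * letter y * wd v))"
      by (simp add: algebra_simps klin_add[OF klin_symz] klin_diff[OF klin_symz])
    also have "\<dots> = cst (1 / fact (length u + Suc (length v))) *
      (\<Sum>\<sigma> | \<sigma> permutes {..<length u + Suc (length v)}.
         wd ((permute_list \<sigma> (u @ 0 # v))[invp \<sigma> (length u) := x + y])
         - (wd ((permute_list \<sigma> (u @ 0 # v))[invp \<sigma> (length u) := x])
         + wd ((permute_list \<sigma> (u @ 0 # v))[invp \<sigma> (length u) := y])))"
      unfolding slot by (simp only: sum_subtractf sum.distrib right_diff_distrib distrib_left)
    also have "\<dots> \<in> I"
      by (intro lmult_mem sum_mem *) (simp add: pos del: length_permute_list)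
    finally show ?case by simp
  next
    case (2 u v c x)
    have *: "wd (m[j := scale c x]) - cst c * wd (m[j := x]) \<in> I" if "j < length m" for m j
    proof -
      have "wd (take j m) * (letter (scale c x) - cst c * letter x) * wd (drop (Suc j) m) \<in> I"
        by (intro rmult_mem lmult_mem letter_scale_mem)
      then show ?thesis
        using that by (simp only: wd_update right_diff_distrib left_diff_distrib cst_left_commute mult.assoc)
    qed
    have "wd u * (letter (scale c x) - cst c * letter x) * wd v
        = wd u * letter (scale c x) * wd v - cst c * (wd u * letter x * wd v)"
      by (simp only: right_diff_distrib left_diff_distrib cst_left_commute mult.assoc)
    then have "symz (wd u * (letter (scale c x) - cst c * letter x) * wd v)
        = symz (wd u * letter (scale c x) * wd v) - cst c * symz (wd u * letter x * wd v)"
      by (simp only: klin_cst[OF klin_symz] klin_diff[OF klin_symz])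
    also have "\<dots> = cst (1 / fact (length u + Suc (length v))) *
      (\<Sum>\<sigma> | \<sigma> permutes {..<length u + Suc (length v)}.
         wd ((permute_list \<sigma> (u @ 0 # v))[invp \<sigma> (length u) := scale c x])
         - cst c * wd ((permute_list \<sigma> (u @ 0 # v))[invp \<sigma> (length u) := x]))"
      unfolding slot
      by (simp only: sum_subtractf right_diff_distrib sum_distrib_left[symmetric]
          cst_left_commute[where f = "cst (1 / fact (length u + Suc (length v)))" and c = c])
    also have "\<dots> \<in> I"
      by (intro lmult_mem sum_mem *) (simp add: pos del: length_permute_list)
    finally show ?case by simp
  next
    case (3 u v x y)
    have "symz (wd (u @ x # y # v)) = symz (wd (u @ y # x # v) :: ('k, 'g) free_alg)"
      by (rule symz_mset_eq) simp
    moreover have "(wd u :: ('k, 'g) free_alg) * (letter x * letter y - letter y * letter x) * wd v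
        = wd (u @ x # y # v) - wd (u @ y # x # v)"
      by (simp add: wd_append wd_Cons algebra_simps)
    ultimately show ?case by (simp add: klin_diff[OF klin_symz] zero_mem)
  qed
qed

end

section \<open>Sums over a triangle\<close>

lemma sum_square_triangle:
  fixes F :: "nat \<Rightarrow> nat \<Rightarrow> 'a::comm_monoid_add"
  assumes "\<And>i j. i + j > N \<Longrightarrow> F i j = 0"
  shows "(\<Sum>i\<le>N. \<Sum>j\<le>N. F i j) = (\<Sum>k\<le>N. \<Sum>i\<le>k. F i (k - i))"
proof -
  have "(\<Sum>i\<le>N. \<Sum>j\<le>N. F i j) = (\<Sum>(i, j)\<in>{..N} \<times> {..N}. F i j)"
    by (simp add: sum.cartesian_product)
  also have "\<dots> = (\<Sum>(i, j)\<in>{(i, j). i + j \<le> N}. F i j)"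
    by (rule sum.mono_neutral_right) (auto, metis assms not_less)
  also have "\<dots> = (\<Sum>k\<le>N. \<Sum>i\<le>k. F i (k - i))"
    by (rule sum.triangle_reindex_eq)
  finally show ?thesis .
qed

lemma sum_strict_triangle_square:
  fixes F :: "nat \<Rightarrow> nat \<Rightarrow> 'a::comm_monoid_add"
  assumes "\<And>i j. i + j \<ge> N \<Longrightarrow> F i j = 0"
  shows "(\<Sum>q\<le>N. \<Sum>i<q. F i (q - 1 - i)) = (\<Sum>i\<le>N. \<Sum>j\<le>N. F i j)"
proof -
  have "(\<Sum>i\<le>N. \<Sum>j\<le>N. F i j) = (\<Sum>k\<le>N. \<Sum>i\<le>k. F i (k - i))"
    by (rule sum_square_triangle) (simp add: assms)
  also have "\<dots> = (\<Sum>k<N. \<Sum>i\<le>k. F i (k - i))"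
    by (rule sum.mono_neutral_right) (auto simp: assms intro!: sum.neutral)
  also have "\<dots> = (\<Sum>q<Suc N. \<Sum>i<q. F i (q - 1 - i))"
    by (subst sum.lessThan_Suc_shift) (simp add: lessThan_Suc_atMost)
  finally show ?thesis by (simp add: lessThan_Suc_atMost)
qed

section \<open>Contraction with a derivative\<close>

text \<open>
  The operator \<open>\<Sum>\<^sub>b \<beta>\<^sub>b \<circ> \<partial>/\<partial>b\<close>, where \<open>b\<close> runs over the variables: each occurrence of a variable
  in a monomial is taken out in turn and handed to \<open>\<beta>\<close>.
\<close>

definition der :: "('g \<Rightarrow> ('g multiset \<Rightarrow>\<^sub>0 'k::field) \<Rightarrow> ('g multiset \<Rightarrow>\<^sub>0 'k)) \<Rightarrow>
    ('g multiset \<Rightarrow>\<^sub>0 'k) \<Rightarrow> ('g multiset \<Rightarrow>\<^sub>0 'k)" where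
  "der \<beta> = lin (\<lambda>M. \<Sum>b\<in>#M. \<beta> b (Poly_Mapping.single (M - {#b#}) 1))"

lemma klin_der: "klin (der \<beta>)"
  unfolding der_def by (rule klin_lin)

lemma der_single: "der \<beta> (Poly_Mapping.single M 1) = (\<Sum>b\<in>#M. \<beta> b (Poly_Mapping.single (M - {#b#}) 1))"
  by (simp add: der_def)

lemma der_1: "der \<beta> 1 = 0"
  using der_single[of \<beta> "{#}"] by simp

lemma der_plus: "der (\<lambda>v h. \<beta> v h + \<gamma> v h) f = der \<beta> f + der \<gamma> f"
proof (rule klin_eqI[where F = "der (\<lambda>v h. \<beta> v h + \<gamma> v h)" and G = "\<lambda>f. der \<beta> f + der \<gamma> f"])
  show "klin (\<lambda>f. der \<beta> f + der \<gamma> f)" by (rule klin_plus[OF klin_der klin_der])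
qed (simp_all add: klin_der der_single sum_mset.distrib)

lemma der_cst: "der (\<lambda>v h. cst c * \<beta> v h) f = cst c * der \<beta> f"
proof (rule klin_eqI[where F = "der (\<lambda>v h. cst c * \<beta> v h)" and G = "\<lambda>f. cst c * der \<beta> f"])
  show "klin (\<lambda>f. cst c * der \<beta> f)" by (rule klin_lmult[OF klin_der])
qed (simp_all add: klin_der der_single sum_mset_distrib_left)

lemma der_mult_left: "der (\<lambda>v h. u * \<beta> v h) f = u * der \<beta> f"
proof (rule klin_eqI[where F = "der (\<lambda>v h. u * \<beta> v h)" and G = "\<lambda>f. u * der \<beta> f"])
  show "klin (\<lambda>f. u * der \<beta> f)" by (rule klin_lmult[OF klin_der])
qed (simp_all add: klin_der der_single sum_mset_distrib_left)

lemma der_minus: "der (\<lambda>v h. \<beta> v h - \<gamma> v h) f = der \<beta> f - der \<gamma> f"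
  using der_plus[of "\<lambda>v h. \<beta> v h - \<gamma> v h" \<gamma> f] by simp

lemma der_zero: "(\<And>v h. \<beta> v h = 0) \<Longrightarrow> der \<beta> f = 0"
  using der_cst[of 0 \<beta> f] by (simp add: der_def)

text \<open>
  In a monomial with the additional variable \<open>b\<close> either that occurrence is taken out or another
  one.
\<close>

lemma der_var_mult:
  assumes "\<And>v. klin (\<beta> v)"
  shows "der \<beta> (Poly_Mapping.single {#b#} 1 * f)
    = \<beta> b f + der (\<lambda>v h. \<beta> v (Poly_Mapping.single {#b#} 1 * h)) f"
proof (rule klin_eqI[where F = "\<lambda>f. der \<beta> (Poly_Mapping.single {#b#} 1 * f)"
      and G = "\<lambda>f. \<beta> b f + der (\<lambda>v h. \<beta> v (Poly_Mapping.single {#b#} 1 * h)) f"])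
  show "klin (\<lambda>f. der \<beta> (Poly_Mapping.single {#b#} 1 * f))"
    by (rule klin_compose[OF klin_der klin_lmult[OF klin_id]])
  show "klin (\<lambda>f. \<beta> b f + der (\<lambda>v h. \<beta> v (Poly_Mapping.single {#b#} 1 * h)) f)"
    by (rule klin_plus[OF assms klin_der])
  fix M
  have "(\<Sum>c\<in>#M. \<beta> c (Poly_Mapping.single (add_mset b M - {#c#}) 1))
      = (\<Sum>c\<in>#M. \<beta> c (Poly_Mapping.single (add_mset b (M - {#c#})) 1))"
    by (rule arg_cong[where f = sum_mset], rule image_mset_cong) simp
  then show "der \<beta> (Poly_Mapping.single {#b#} 1 * Poly_Mapping.single M 1)
      = \<beta> b (Poly_Mapping.single M 1) + der (\<lambda>v h. \<beta> v (Poly_Mapping.single {#b#} 1 * h)) (Poly_Mapping.single M 1)"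
    by (simp add: mult_single der_single)
qed

lemma homog_sum_mset: "(\<And>b. b \<in># N \<Longrightarrow> homog k (h b)) \<Longrightarrow> homog k (\<Sum>b\<in>#N. h b)"
  by (induction N) (auto simp: homog_0 intro!: homog_add)

lemma homog_der:
  assumes "homog n f" "\<And>v m h. homog m h \<Longrightarrow> homog (m + d) (\<beta> v h)"
  shows "homog (n - 1 + d) (der \<beta> f)"
  unfolding der_def
proof (rule homog_lin)
  fix M assume "M \<in> keys f"
  then have n: "int (size M) = n" using assms(1) by (simp add: homog_def)
  have "homog (n - 1 + d) (\<beta> b (Poly_Mapping.single (M - {#b#}) 1))" if "b \<in># M" for b
  proof -
    have "int (size (M - {#b#})) = n - 1"
      using that n by (metis of_nat_Suc add_diff_cancel_left' insert_DiffM size_add_mset)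
    then show ?thesis using assms(2)[OF homog_single[of "M - {#b#}" 1]] by simp
  qed
  then show "homog (n - 1 + d) (\<Sum>b\<in>#M. \<beta> b (Poly_Mapping.single (M - {#b#}) 1))"
    by (rule homog_sum_mset)
qed

text \<open>
  The commutator of \<open>der \<beta>\<close> with a variable \<open>b\<close> is \<open>\<beta>\<^sub>b\<close> plus the contraction with the
  commutators of the \<open>\<beta>\<^sub>v\<close> and \<open>b\<close>, whose order is lower.
\<close>

lemma dorder_der:
  assumes "\<And>v. dorder n (\<beta> v)" "\<And>v. klin (\<beta> v)"
  shows "dorder (Suc n) (der \<beta>)"
  using assms
proof (induction n arbitrary: \<beta>)
  case 0
  then show ?case by (simp add: der_zero)
next
  case (Suc n)
  define H where "H = {h. dorder (Suc n) (\<lambda>f. der \<beta> (h * f) - h * der \<beta> f)}"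
  have gen: "Poly_Mapping.single {#b#} 1 \<in> H" for b
  proof -
    let ?b = "Poly_Mapping.single {#b#} 1 :: 'a multiset \<Rightarrow>\<^sub>0 'b"
    have "dorder (Suc n) (der (\<lambda>v h. \<beta> v (?b * h) - ?b * \<beta> v h))"
    proof (rule Suc.IH)
      show "dorder n (\<lambda>h. \<beta> v (?b * h) - ?b * \<beta> v h)" for v
        using Suc.prems(1)[of v] by simp
      show "klin (\<lambda>h. \<beta> v (?b * h) - ?b * \<beta> v h)" for v
        by (rule klin_minus[OF klin_compose[OF Suc.prems(2) klin_lmult[OF klin_id]] klin_lmult[OF Suc.prems(2)]])
    qed
    then have "dorder (Suc n) (\<lambda>f. \<beta> b f + der (\<lambda>v h. \<beta> v (?b * h) - ?b * \<beta> v h) f)"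
      by (rule dorder_add[OF Suc.prems(1)])
    moreover have "(\<lambda>f. \<beta> b f + der (\<lambda>v h. \<beta> v (?b * h) - ?b * \<beta> v h) f) = (\<lambda>f. der \<beta> (?b * f) - ?b * der \<beta> f)"
      by (rule ext) (simp add: der_var_mult[OF Suc.prems(2)] der_minus der_mult_left)
    ultimately show ?thesis by (simp only: H_def mem_Collect_eq)
  qed
  have "Poly_Mapping.single M 1 \<in> H" for M
  proof (induction M)
    case empty
    show ?case using dorder_zero[of "Suc n"] by (simp add: H_def)
  next
    case (add b M)
    have "Poly_Mapping.single {#b#} 1 * Poly_Mapping.single M 1 \<in> H"
      using gen[of b] add unfolding H_def mem_Collect_eq by (rule dorder_commutator_mult)
    then show ?case by (simp add: mult_single)
  qed
  moreover have "subsp H"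
    unfolding subsp_def
  proof (intro conjI ballI allI)
    show "0 \<in> H" using dorder_zero[of "Suc n"] by (simp add: H_def klin_0[OF klin_der])
  next
    fix g h assume "g \<in> H" "h \<in> H"
    then have "dorder (Suc n) (\<lambda>f. (der \<beta> (g * f) - g * der \<beta> f) + (der \<beta> (h * f) - h * der \<beta> f))"
      unfolding H_def mem_Collect_eq by (rule dorder_add)
    moreover have "(\<lambda>f. (der \<beta> (g * f) - g * der \<beta> f) + (der \<beta> (h * f) - h * der \<beta> f))
        = (\<lambda>f. der \<beta> ((g + h) * f) - (g + h) * der \<beta> f)"
      by (rule ext) (simp add: algebra_simps klin_add[OF klin_der])
    ultimately show "g + h \<in> H" by (simp only: H_def mem_Collect_eq)
  next
    fix c h assume "h \<in> H"
    then have "dorder (Suc n) (\<lambda>f. cst c * (der \<beta> (h * f) - h * der \<beta> f))"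
      unfolding H_def mem_Collect_eq by (rule dorder_mult)
    moreover have "(\<lambda>f. cst c * (der \<beta> (h * f) - h * der \<beta> f))
        = (\<lambda>f. der \<beta> (cst c * h * f) - cst c * h * der \<beta> f)"
      by (rule ext) (simp only: mult.assoc klin_cst[OF klin_der] right_diff_distrib)
    ultimately show "cst c * h \<in> H" by (simp only: H_def mem_Collect_eq)
  qed
  ultimately have "h \<in> H" for h using klin_span_induct by blast
  then show ?case by (simp add: H_def)
qed

context sym_space
begin

lemma der_iota_mult:
  assumes "\<And>v. klin (\<beta> v)" "\<And>f. glin (\<lambda>v. \<beta> v f)"
  shows "der \<beta> (iota u * f) = \<beta> u f + der (\<lambda>v h. \<beta> v (iota u * h)) f"
proof -
  let ?l = "lin (\<lambda>b. Poly_Mapping.single {#b#} 1) :: ('g \<Rightarrow>\<^sub>0 'k) \<Rightarrow> ('g multiset \<Rightarrow>\<^sub>0 'k)"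
  have b: "klin (\<beta> v)" for v by (rule assms)
  have "der \<beta> (?l c * f) = lin (\<lambda>b. \<beta> b f) c + der (\<lambda>v h. \<beta> v (?l c * h)) f" for c
  proof (rule klin_eqI[where F = "\<lambda>c. der \<beta> (?l c * f)"
        and G = "\<lambda>c. lin (\<lambda>b. \<beta> b f) c + der (\<lambda>v h. \<beta> v (?l c * h)) f"])
    show "klin (\<lambda>c. der \<beta> (?l c * f))"
      by (rule klin_compose[OF klin_der klin_rmult[OF klin_lin]])
    have "klin (\<lambda>c. der (\<lambda>v h. \<beta> v (?l c * h)) f)"
      by (rule klinI) (simp_all add: lin_add lin_cst distrib_right mult.assoc klin_add[OF b] klin_cst[OF b] der_plus der_cst)
    then show "klin (\<lambda>c. lin (\<lambda>b. \<beta> b f) c + der (\<lambda>v h. \<beta> v (?l c * h)) f)"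
      by (rule klin_plus[OF klin_lin])
  qed (simp add: der_var_mult[OF b])
  from this[of "coords u"] show ?thesis
    by (simp add: iota_def[symmetric] glin_coords[OF assms(2)])
qed

text \<open>Divided powers; the integer index makes negative ones vanish.\<close>

definition dpow :: "'g \<Rightarrow> int \<Rightarrow> ('g multiset \<Rightarrow>\<^sub>0 'k)" where
  "dpow y n = (if n < 0 then 0 else cst (1 / fact (nat n)) * iota y ^ nat n)"

lemma dpow_neg: "n < 0 \<Longrightarrow> dpow y n = 0"
  by (simp add: dpow_def)

lemma dpow_of_nat: "dpow y (int n) = cst (1 / fact n) * iota y ^ n"
  by (simp add: dpow_def)

lemma iota_power_eq_dpow: "iota y ^ n = cst (fact n) * dpow y (int n)"
  by (simp add: dpow_of_nat mult.assoc[symmetric] cst_mult[symmetric])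

lemma der_power:
  assumes "\<And>v. klin (\<beta> v)" "\<And>f. glin (\<lambda>v. \<beta> v f)"
  shows "der \<beta> (iota y ^ Suc n) = of_nat (Suc n) * \<beta> y (iota y ^ n)"
  using assms
proof (induction n arbitrary: \<beta>)
  case 0
  then show ?case using der_iota_mult[OF 0, of y 1] by (simp add: der_1)
next
  case (Suc n)
  have "der \<beta> (iota y ^ Suc (Suc n)) = \<beta> y (iota y ^ Suc n) + der (\<lambda>v h. \<beta> v (iota y * h)) (iota y ^ Suc n)"
    using der_iota_mult[OF Suc.prems, of y "iota y ^ Suc n"] by simp
  also have "der (\<lambda>v h. \<beta> v (iota y * h)) (iota y ^ Suc n) = of_nat (Suc n) * \<beta> y (iota y * iota y ^ n)"
  proof (rule Suc.IH)
    show "klin (\<lambda>h. \<beta> v (iota y * h))" for v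
      by (rule klin_compose[OF Suc.prems(1) klin_lmult[OF klin_id]])
  qed (rule Suc.prems(2))
  finally show ?case by (simp add: algebra_simps)
qed

lemma der_dpow:
  assumes "\<And>v. klin (\<beta> v)" "\<And>f. glin (\<lambda>v. \<beta> v f)"
  shows "der \<beta> (dpow y n) = \<beta> y (dpow y (n - 1))"
proof -
  consider "n < 0" | "n = 0" | m where "n = int (Suc m)"
    by (metis linorder_cases not0_implies_Suc of_nat_0 zero_less_imp_eq_int gr0_implies_Suc)
  then show ?thesis
  proof cases
    case 1
    then show ?thesis by (simp add: dpow_neg klin_0[OF klin_der] klin_0[OF assms(1)])
  next
    case 2
    then show ?thesis by (simp add: dpow_def der_1 klin_0[OF assms(1)])
  next
    case 3
    have n1: "n - 1 = int m" using 3 by simp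
    have "der \<beta> (dpow y n) = cst (1 / fact (Suc m)) * (of_nat (Suc m) * \<beta> y (iota y ^ m))"
      unfolding 3 dpow_of_nat klin_cst[OF klin_der] der_power[OF assms] ..
    also have "\<dots> = cst (1 / fact (Suc m) * of_nat (Suc m)) * \<beta> y (iota y ^ m)"
      by (simp only: cst_mult cst_of_nat mult.assoc)
    also have "1 / fact (Suc m) * of_nat (Suc m) = (1 / fact m :: 'k)"
      using of_nat_neq_0[of m, where 'a = 'k] by (simp add: divide_simps del: of_nat_Suc)
    finally show ?thesis
      unfolding n1 dpow_of_nat klin_cst[OF assms(1)] .
  qed
qed

lemma subsp_range_poly_of: "subsp (range poly_of)"
  unfolding subsp_def
proof (intro conjI ballI allI)
  show "0 \<in> range poly_of"
    using rangeI[of poly_of 0] by (simp add: klin_0[OF klin_poly_of])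
next
  fix f g assume "f \<in> range poly_of" "g \<in> range poly_of"
  then obtain f' g' where "f = poly_of f'" "g = poly_of g'" by auto
  then have "f + g = poly_of (f' + g')" by (simp add: klin_add[OF klin_poly_of])
  then show "f + g \<in> range poly_of" by simp
next
  fix c f assume "f \<in> range poly_of"
  then obtain f' where "f = poly_of f'" by auto
  then have "cst c * f = poly_of (cst c * f')" by (simp add: klin_cst[OF klin_poly_of])
  then show "cst c * f \<in> range poly_of" by simp
qed

lemma iota_range: "iota y \<in> range poly_of"
  by (metis poly_of_letter rangeI)

lemma mult_range:
  assumes "f \<in> range poly_of" "g \<in> range poly_of"
  shows "f * g \<in> range poly_of"
proof -
  obtain f' g' where "f = poly_of f'" "g = poly_of g'" using assms by auto
  then have "f * g = poly_of (f' * g')" by (simp add: poly_of_mult)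
  then show ?thesis by simp
qed

lemma dpow_range: "dpow y n \<in> range poly_of"
proof -
  have "iota y ^ m \<in> range poly_of" for m
    by (metis poly_of_letter poly_of_power rangeI)
  then show ?thesis
    using subspD(1,3)[OF subsp_range_poly_of] by (simp add: dpow_def)
qed

end

section \<open>The operators of left multiplication\<close>

locale lie_algebra_0 = lie_algebra scale bracket
  for scale :: "'k::field_char_0 \<Rightarrow> 'g::ab_group_add \<Rightarrow> 'g" and bracket :: "'g \<Rightarrow> 'g \<Rightarrow> 'g"
begin

sublocale sym_space scale ..

lemma bracket_right:
  "bracket x (y + z) = bracket x y + bracket x z" "bracket x (scale c y) = scale c (bracket x y)"
proof -
  interpret l: Vector_Spaces.linear scale scale "\<lambda>y. bracket x y"
    by (rule bracket_linear_right)
  show "bracket x (y + z) = bracket x y + bracket x z" "bracket x (scale c y) = scale c (bracket x y)"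
    by (simp_all add: l.add l.scale)
qed

lemma bracket_left:
  "bracket (x + y) z = bracket x z + bracket y z" "bracket (scale c x) z = scale c (bracket x z)"
proof -
  interpret l: Vector_Spaces.linear scale scale "\<lambda>x. bracket x z"
    by (rule bracket_linear_left)
  show "bracket (x + y) z = bracket x z + bracket y z" "bracket (scale c x) z = scale c (bracket x z)"
    by (simp_all add: l.add l.scale)
qed

lemma bracket_swap: "bracket x y = - bracket y x"
proof -
  have "bracket (x + y) (x + y) = 0" by (rule bracket_self)
  then have "bracket x y + bracket y x = 0"
    by (simp only: bracket_left bracket_right) (simp add: bracket_self add.commute)
  then show ?thesis by (rule eq_neg_iff_add_eq_0[THEN iffD2])
qed

lemma bracket_minus_right: "bracket x (- y) = - bracket x y"
  using bracket_right(2)[of x "-1" y] by simp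

lemma bracket_derivation: "bracket y (bracket u v) = bracket (bracket y u) v + bracket u (bracket y v)"
proof -
  have "bracket y (bracket u v) + bracket u (bracket v y) + bracket v (bracket y u) = 0"
    by (rule jacobi)
  moreover have "bracket u (bracket v y) = - bracket u (bracket y v)"
    by (subst bracket_swap[of v y]) (rule bracket_minus_right)
  moreover have "bracket v (bracket y u) = - bracket (bracket y u) v"
    by (rule bracket_swap)
  ultimately show ?thesis by (simp add: algebra_simps)
qed

abbreviation ad :: "'g \<Rightarrow> nat \<Rightarrow> 'g \<Rightarrow> 'g" where
  "ad y n \<equiv> (bracket y ^^ n)"

text \<open>
  The derivation \<open>ad y\<close> acts on \<open>[u, v]\<close> as the sum of two commuting operators, one for each slot.
\<close>

lemma leibniz_sum:
  assumes "glin F"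
  shows "F (ad y k (bracket u v)) = (\<Sum>a\<le>k. of_nat (k choose a) * F (bracket (ad y a u) (ad y (k - a) v)))"
  using assms
proof (induction k arbitrary: F)
  case (Suc k)
  define h where "h = (\<lambda>a. F (bracket (ad y a u) (ad y (Suc k - a) v)))"
  have "glin (\<lambda>x. F (bracket y x))"
    using Suc.prems by (simp add: glin_def bracket_right)
  from Suc.IH[OF this]
  have "F (ad y (Suc k) (bracket u v)) = (\<Sum>a\<le>k. of_nat (k choose a) * F (bracket y (bracket (ad y a u) (ad y (k - a) v))))"
    by simp
  also have "\<dots> = (\<Sum>a\<le>k. of_nat (k choose a) * h (Suc a) + of_nat (k choose a) * h a)"
  proof (rule sum.cong[OF refl])
    fix a assume "a \<in> {..k}"
    then have "ad y (Suc k - a) v = bracket y (ad y (k - a) v)" by (simp add: Suc_diff_le)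
    then show "of_nat (k choose a) * F (bracket y (bracket (ad y a u) (ad y (k - a) v)))
        = of_nat (k choose a) * h (Suc a) + of_nat (k choose a) * h a"
      by (simp add: h_def bracket_derivation[of y "ad y a u"] glin_add[OF Suc.prems] distrib_left)
  qed
  also have "\<dots> = (\<Sum>a\<le>k. of_nat (k choose a) * h (Suc a)) + (\<Sum>a\<le>Suc k. of_nat (k choose a) * h a)"
    by (simp add: sum.distrib binomial_eq_0)
  also have "(\<Sum>a\<le>Suc k. of_nat (k choose a) * h a) = h 0 + (\<Sum>a\<le>k. of_nat (k choose Suc a) * h (Suc a))"
    by (simp add: sum.atMost_Suc_shift del: sum.atMost_Suc)
  also have "(\<Sum>a\<le>k. of_nat (k choose a) * h (Suc a)) + (h 0 + (\<Sum>a\<le>k. of_nat (k choose Suc a) * h (Suc a)))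
      = h 0 + (\<Sum>a\<le>k. of_nat (Suc k choose Suc a) * h (Suc a))"
    by (simp add: sum.distrib algebra_simps)
  also have "\<dots> = (\<Sum>a\<le>Suc k. of_nat (Suc k choose a) * h a)"
    by (simp add: sum.atMost_Suc_shift del: sum.atMost_Suc)
  finally show ?case by (simp only: h_def)
qed simp

text \<open>
  If \<open>s\<close> and \<open>t\<close> stand for \<open>ad y\<close> acting on \<open>u\<close> and on \<open>v\<close>, the left side is
  \<open>\<Sum>\<^sub>i (s + t)\<^sup>i t\<^bsup>q-1-i\<^esup> = ((s + t)\<^sup>q - t\<^sup>q) / s\<close>, and the right side is its expansion.
\<close>

lemma bracket_insertion_sum:
  assumes "glin F"
  shows "(\<Sum>i<q. F (ad y i (bracket u (ad y (q - 1 - i) v))))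
    = (\<Sum>a<q. of_nat (q choose Suc a) * F (bracket (ad y a u) (ad y (q - 1 - a) v)))"
  using assms
proof (induction q arbitrary: F)
  case (Suc q)
  define h where "h = (\<lambda>a. F (bracket (ad y a u) (ad y (q - a) v)))"
  have "glin (\<lambda>x. F (bracket y x))"
    using Suc.prems by (simp add: glin_def bracket_right)
  from Suc.IH[OF this]
  have IH: "(\<Sum>i<q. F (bracket y (ad y i (bracket u (ad y (q - 1 - i) v)))))
    = (\<Sum>a<q. of_nat (q choose Suc a) * F (bracket y (bracket (ad y a u) (ad y (q - 1 - a) v))))" .
  have "(\<Sum>i<Suc q. F (ad y i (bracket u (ad y (Suc q - 1 - i) v))))
      = h 0 + (\<Sum>i<q. F (bracket y (ad y i (bracket u (ad y (q - 1 - i) v)))))"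
    by (simp add: sum.lessThan_Suc_shift h_def del: sum.lessThan_Suc)
  also have "\<dots> = h 0 + (\<Sum>a<q. of_nat (q choose Suc a) * h (Suc a) + of_nat (q choose Suc a) * h a)"
    unfolding IH
  proof (rule arg_cong[where f = "\<lambda>x. h 0 + x"], rule sum.cong[OF refl])
    fix a assume "a \<in> {..<q}"
    then have "q - a = Suc (q - 1 - a)" by auto
    then have "ad y (q - a) v = bracket y (ad y (q - 1 - a) v)"
      by (simp only: funpow.simps o_apply)
    then show "of_nat (q choose Suc a) * F (bracket y (bracket (ad y a u) (ad y (q - 1 - a) v)))
        = of_nat (q choose Suc a) * h (Suc a) + of_nat (q choose Suc a) * h a"
      by (simp add: h_def bracket_derivation[of y "ad y a u"] glin_add[OF Suc.prems] distrib_left)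
  qed
  also have "\<dots> = (h 0 + (\<Sum>a<q. of_nat (q choose Suc a) * h (Suc a))) + (\<Sum>a<Suc q. of_nat (q choose Suc a) * h a)"
    by (simp add: sum.distrib binomial_eq_0)
  also have "h 0 + (\<Sum>a<q. of_nat (q choose Suc a) * h (Suc a)) = (\<Sum>a<Suc q. of_nat (q choose a) * h a)"
    by (simp add: sum.lessThan_Suc_shift del: sum.lessThan_Suc)
  also have "(\<Sum>a<Suc q. of_nat (q choose a) * h a) + (\<Sum>a<Suc q. of_nat (q choose Suc a) * h a)
      = (\<Sum>a<Suc q. of_nat (Suc q choose Suc a) * h a)"
    by (simp only: sum.distrib[symmetric] binomial_Suc_Suc of_nat_add distrib_right)
  finally show ?case by (simp add: h_def del: sum.lessThan_Suc)
qed simp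

text \<open>
  The operator \<open>E\<^sub>p(z)\<close>: on a product of vectors it is the sum over all choices of \<open>p\<close> factors
  \<open>v\<^sub>1, \<dots>, v\<^sub>p\<close> in order, of \<open>[v\<^sub>p, [\<dots>, [v\<^sub>1, z]]]\<close> times the remaining factors.
\<close>

primrec eop :: "nat \<Rightarrow> 'g \<Rightarrow> ('g multiset \<Rightarrow>\<^sub>0 'k) \<Rightarrow> ('g multiset \<Rightarrow>\<^sub>0 'k)" where
  "eop 0 z = (\<lambda>f. iota z * f)"
| "eop (Suc p) z = der (\<lambda>b. eop p (bracket b z))"

lemma klin_eop: "klin (eop p z)"
  by (cases p) (simp_all add: klin_der klin_lmult klin_id)

lemma glin_eop: "glin (\<lambda>z. eop p z f)"
proof (induction p arbitrary: f)
  case 0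
  then show ?case using glin_iota by (simp add: glin_def algebra_simps)
next
  case (Suc p)
  have "eop p (x + y) = (\<lambda>h. eop p x h + eop p y h)" "eop p (scale c x) = (\<lambda>h. cst c * eop p x h)" for x y c
    by (auto simp: glin_add[OF Suc] glin_scale[OF Suc])
  then show ?case
    unfolding glin_def by (simp add: bracket_right der_plus der_cst)
qed

lemma glin_eop_bracket: "glin (\<lambda>v. eop p (bracket v z) f)"
  unfolding glin_def by (simp add: bracket_left glin_add[OF glin_eop] glin_scale[OF glin_eop])

lemma dorder_eop: "dorder (Suc p) (eop p z)"
proof (induction p arbitrary: z)
  case (Suc p)
  show ?case unfolding eop.simps by (rule dorder_der[OF Suc klin_eop])
qed (simp add: algebra_simps)

lemma homog_eop: "homog n f \<Longrightarrow> homog (n + 1 - int p) (eop p z f)"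
proof (induction p arbitrary: z n f)
  case 0
  then show ?case using homog_mult[OF homog_iota 0] by (simp add: add.commute)
next
  case (Suc p)
  have "homog (n - 1 + (1 - int p)) (der (\<lambda>b. eop p (bracket b z)) f)"
    by (rule homog_der[OF Suc.prems]) (use Suc.IH in \<open>simp add: algebra_simps\<close>)
  then show ?case by (simp add: algebra_simps)
qed

lemma eop_vanish: "size M < p \<Longrightarrow> eop p z (Poly_Mapping.single M 1) = 0"
proof (induction p arbitrary: z M)
  case (Suc p)
  have "eop p (bracket b z) (Poly_Mapping.single (M - {#b#}) 1) = 0" if "b \<in># M" for b
  proof (rule Suc.IH)
    show "size (M - {#b#}) < p"
      using Suc.prems that by (metis Suc_less_eq insert_DiffM size_add_mset)
  qed
  then have "image_mset (\<lambda>b. eop p (bracket b z) (Poly_Mapping.single (M - {#b#}) 1)) M = image_mset (\<lambda>b. 0) M"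
    by (rule image_mset_cong)
  then show ?case by (simp add: der_single)
qed simp

lemma eop_dpow: "eop p z (dpow y n) = iota (ad y p z) * dpow y (n - int p)"
proof (induction p arbitrary: z n)
  case (Suc p)
  have "eop (Suc p) z (dpow y n) = eop p (bracket y z) (dpow y (n - 1))"
    unfolding eop.simps by (rule der_dpow[OF klin_eop glin_eop_bracket])
  also have "\<dots> = iota (ad y (Suc p) z) * dpow y (n - int (Suc p))"
    by (simp add: Suc funpow_swap1 algebra_simps)
  finally show ?case .
qed simp

text \<open>
  The sum collects the ways to take out \<open>u\<close> as one of the \<open>p\<close> factors; the first term leaves it in
  place.
\<close>

lemma eop_iota_dpow:
  "eop p z (iota u * dpow y m) = iota u * iota (ad y p z) * dpow y (m - int p)
     + (\<Sum>i<p. iota (ad y i (bracket u (ad y (p - 1 - i) z)))) * dpow y (m + 1 - int p)"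
proof (induction p arbitrary: z m)
  case (Suc p)
  have "eop (Suc p) z (iota u * dpow y m)
      = eop p (bracket u z) (dpow y m) + der (\<lambda>v h. eop p (bracket v z) (iota u * h)) (dpow y m)"
    unfolding eop.simps by (rule der_iota_mult[OF klin_eop glin_eop_bracket])
  also have "der (\<lambda>v h. eop p (bracket v z) (iota u * h)) (dpow y m) = eop p (bracket y z) (iota u * dpow y (m - 1))"
    by (rule der_dpow[OF klin_compose[OF klin_eop klin_lmult[OF klin_id]] glin_eop_bracket])
  also have "\<dots> = iota u * iota (ad y (Suc p) z) * dpow y (m - int (Suc p))
     + (\<Sum>i<p. iota (ad y i (bracket u (ad y (p - i) z)))) * dpow y (m - int p)"
  proof -
    have "ad y (p - 1 - i) (bracket y z) = ad y (p - i) z" if "i < p" for i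
    proof -
      have "p - i = Suc (p - 1 - i)" using that by auto
      then show ?thesis by (simp only: funpow_Suc_right o_apply)
    qed
    then show ?thesis by (simp add: Suc funpow_swap1 algebra_simps)
  qed
  finally show ?case
    by (simp add: eop_dpow algebra_simps)
qed (simp add: algebra_simps)

text \<open>
  The operator \<open>L\<^sub>z\<close>. The sum stops at the degree of the monomial, beyond which \<open>eop\<close> vanishes.
\<close>

definition lop :: "'g \<Rightarrow> ('g multiset \<Rightarrow>\<^sub>0 'k) \<Rightarrow> ('g multiset \<Rightarrow>\<^sub>0 'k)" where
  "lop z = lin (\<lambda>M. \<Sum>p\<le>size M. cst (bern p) * eop p z (Poly_Mapping.single M 1))"

lemma klin_lop: "klin (lop z)"
  unfolding lop_def by (rule klin_lin)

lemma lop_eq_sum: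
  assumes "\<And>M. M \<in> keys f \<Longrightarrow> size M \<le> N"
  shows "lop z f = (\<Sum>p\<le>N. cst (bern p) * eop p z f)"
proof -
  have "lop z f = (\<Sum>M\<in>keys f. cst (lookup f M) * (\<Sum>p\<le>N. cst (bern p) * eop p z (Poly_Mapping.single M 1)))"
    unfolding lop_def lin_def
  proof (rule sum.cong[OF refl], rule arg_cong[where f = "\<lambda>x. _ * x"], rule sum.mono_neutral_left)
    fix M assume "M \<in> keys f"
    then show "{..size M} \<subseteq> {..N}" using assms by auto
  qed (auto simp: eop_vanish)
  also have "\<dots> = (\<Sum>M\<in>keys f. \<Sum>p\<le>N. cst (bern p) * (cst (lookup f M) * eop p z (Poly_Mapping.single M 1)))"
    by (simp only: sum_distrib_left mult.left_commute)
  also have "\<dots> = (\<Sum>p\<le>N. \<Sum>M\<in>keys f. cst (bern p) * (cst (lookup f M) * eop p z (Poly_Mapping.single M 1)))"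
    by (rule sum.swap)
  also have "\<dots> = (\<Sum>p\<le>N. cst (bern p) * eop p z (\<Sum>M\<in>keys f. cst (lookup f M) * Poly_Mapping.single M 1))"
    by (simp only: klin_sum[OF klin_eop] klin_cst[OF klin_eop] sum_distrib_left)
  also have "(\<Sum>M\<in>keys f. cst (lookup f M) * Poly_Mapping.single M 1) = f"
    using poly_mapping_sum_single[of f] by (simp only: single_eq_cst_mult[symmetric])
  finally show ?thesis .
qed

lemma lop_homog:
  assumes "homog n f" "n \<le> int N"
  shows "lop z f = (\<Sum>p\<le>N. cst (bern p) * eop p z f)"
  by (rule lop_eq_sum) (use assms in \<open>auto simp: homog_def\<close>)

lemma homog_dpow: "homog n (dpow y n)"
proof (cases "n < 0")
  case False
  have "homog (int m) (iota y ^ m)" for m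
    using homog_prod_list[of "replicate m (iota y)"] homog_iota by auto
  from this[of "nat n"] show ?thesis using False by (simp add: dpow_def homog_cst)
qed (simp add: dpow_neg homog_0)

lemma lop_dpow:
  assumes "n \<le> int N"
  shows "lop z (dpow y n) = (\<Sum>p\<le>N. cst (bern p) * (iota (ad y p z) * dpow y (n - int p)))"
  by (simp add: lop_homog[OF homog_dpow assms] eop_dpow)

text \<open>
  Only \<open>p = 0\<close> contributes, since \<open>[y, y] = 0\<close>.
\<close>

lemma lop_self_power: "lop y (iota y ^ n) = iota y ^ Suc n"
proof -
  have b0: "bracket y 0 = 0"
    using bracket_right(2)[of y 0 0] by simp
  have ad0: "ad y (Suc p) y = 0" for p
    by (induction p) (simp_all add: bracket_self b0)
  have "lop y (dpow y (int n)) = iota y * dpow y (int n)"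
  proof -
    have "lop y (dpow y (int n)) = (\<Sum>p\<le>n. if p = 0 then iota y * dpow y (int n) else 0)"
      unfolding lop_dpow[OF order_refl]
    proof (rule sum.cong[OF refl])
      fix p
      have "bern 0 = (1 :: 'k)" using bern_convolution[of 0, where 'k = 'k] by simp
      then show "cst (bern p) * (iota (ad y p y) * dpow y (int n - int p))
          = (if p = 0 then iota y * dpow y (int n) else 0)"
        using ad0 by (cases p) (simp_all add: glin_0[OF glin_iota] del: funpow.simps(2))
    qed
    then show ?thesis by simp
  qed
  then show ?thesis
    by (simp add: iota_power_eq_dpow[of y n] klin_cst[OF klin_lop])
qed

lemma glin_lop: "glin (\<lambda>z. lop z f)"
  unfolding glin_def lop_def lin_def
  by (simp add: glin_add[OF glin_eop] glin_scale[OF glin_eop] distrib_left sum.distrib sum_distrib_left mult.left_commute)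

lemma lop_range: "f \<in> range poly_of \<Longrightarrow> lop z f \<in> range poly_of"
proof -
  have "subsp {f. lop z f \<in> range poly_of}"
    using subspD(1-3)[OF subsp_range_poly_of]
    by (simp add: subsp_def klin_0[OF klin_lop] klin_add[OF klin_lop] klin_cst[OF klin_lop])
  moreover have "iota y ^ n \<in> {f. lop z f \<in> range poly_of}" for y n
  proof -
    have "cst (fact n) * (\<Sum>p\<le>n. cst (bern p) * (iota (ad y p z) * dpow y (int n - int p))) \<in> range poly_of"
      by (intro subspD(3,5)[OF subsp_range_poly_of] mult_range iota_range dpow_range)
    then show ?thesis
      by (simp add: iota_power_eq_dpow klin_cst[OF klin_lop] lop_dpow[of "int n" n])
  qed
  ultimately have "poly_of g \<in> {f. lop z f \<in> range poly_of}" for g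
    by (rule iota_powers_span)
  then show "f \<in> range poly_of \<Longrightarrow> lop z f \<in> range poly_of" by auto
qed

end

section \<open>The operators of left multiplication represent the Lie algebra\<close>

context lie_algebra_0
begin

text \<open>
  Apply \<open>L\<^sub>z\<close> to the terms \<open>ad(y)\<^sup>p(x) y\<^bsup>[n-p]\<^esup>\<close> of \<open>L\<^sub>x y\<^bsup>[n]\<^esup>\<close>. The terms in which \<open>L\<^sub>z\<close> does not
  touch the first factor are symmetric in \<open>x\<close> and \<open>z\<close> and cancel in the commutator. The others are
  combinations of \<open>[ad(y)\<^sup>a x, ad(y)\<^sup>b z]\<close>; in terms of the variables \<open>s\<close> and \<open>t\<close> that count \<open>a\<close> and
  \<open>b\<close> their coefficient in \<open>L\<^sub>z L\<^sub>x\<close> is \<open>\<phi>(s) (\<phi>(s + t) - \<phi>(t)) / s\<close>. Exchanging \<open>x\<close> and \<open>z\<close>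
  exchanges \<open>s\<close> and \<open>t\<close> and reverses the sign of the bracket, and \<open>L\<^bsub>[z,x]\<^esub>\<close> has the coefficient
  \<open>- \<phi>(s + t)\<close>; so the claim is \<open>bern_identity\<close>.
\<close>

lemma lop_commutator_dpow:
  "lop z (lop x (dpow y (int n))) - lop x (lop z (dpow y (int n))) = lop (bracket z x) (dpow y (int n))"
proof -
  (* L z is applied to polynomials of degree n + 1 - p at most, so both sums may stop at n + 1. *)
  define N where "N = Suc n"
  define w where "w = (\<lambda>a b. of_nat ((a + b + 1) choose (a + 1)) * bern (a + b + 1) :: 'k)"
  define K where "K = (\<lambda>u v a b. iota (bracket (ad y a u) (ad y b v)) * dpow y (int n - int (a + b)))"
  define Com where "Com = (\<lambda>u v. \<Sum>p\<le>N. \<Sum>q\<le>N. cst (bern p * bern q) *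
      (iota (ad y p u) * iota (ad y q v) * dpow y (int n - int (p + q))))"
  define T where "T = (\<lambda>u v. \<Sum>a\<le>N. \<Sum>b\<le>N. cst (\<Sum>p\<le>a. bern p * w (a - p) b) * K u v a b)"
  have K0: "K u v a b = 0" if "a + b > n" for u v a b
    using that by (simp add: K_def dpow_neg)
  (* Com collects the terms that are symmetric in u and v, and T those with a bracket. *)
  have lop2: "lop v (lop u (dpow y (int n))) = Com u v + T u v" for u v
  proof -
    have "lop v (lop u (dpow y (int n)))
        = (\<Sum>p\<le>N. cst (bern p) * lop v (iota (ad y p u) * dpow y (int n - int p)))"
      by (simp add: lop_dpow[of _ N] N_def klin_sum[OF klin_lop] klin_cst[OF klin_lop] del: sum.atMost_Suc)
    also have "\<dots> = (\<Sum>p\<le>N. cst (bern p) * (\<Sum>q\<le>N. cst (bern q) *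
        (iota (ad y p u) * iota (ad y q v) * dpow y (int n - int (p + q))
         + (\<Sum>a<q. of_nat (q choose Suc a) * K u v (a + p) (q - 1 - a)))))"
    proof (rule sum.cong[OF refl], rule arg_cong[where f = "\<lambda>x. _ * x"])
      fix p assume "p \<in> {..N}"
      have "homog (1 + (int n - int p)) (iota (ad y p u) * dpow y (int n - int p))"
        by (rule homog_mult[OF homog_iota homog_dpow])
      then have "lop v (iota (ad y p u) * dpow y (int n - int p))
          = (\<Sum>q\<le>N. cst (bern q) * eop q v (iota (ad y p u) * dpow y (int n - int p)))"
        by (rule lop_homog) (simp add: N_def)
      also have "\<dots> = (\<Sum>q\<le>N. cst (bern q) * (iota (ad y p u) * iota (ad y q v) * dpow y (int n - int (p + q))
         + (\<Sum>a<q. of_nat (q choose Suc a) * K u v (a + p) (q - 1 - a))))"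
      proof (rule sum.cong[OF refl], rule arg_cong[where f = "\<lambda>x. _ * x"])
        fix q
        have "(\<Sum>i<q. iota (ad y i (bracket (ad y p u) (ad y (q - 1 - i) v)))) * dpow y (int n - int p + 1 - int q)
          = (\<Sum>a<q. of_nat (q choose Suc a) * K u v (a + p) (q - 1 - a))"
          unfolding bracket_insertion_sum[OF glin_iota] sum_distrib_right
        proof (rule sum.cong[OF refl])
          fix a assume "a \<in> {..<q}"
          then have e: "int n - int p + 1 - int q = int n - int (a + p + (q - 1 - a))" by auto
          then show "of_nat (q choose Suc a) * iota (bracket (ad y a (ad y p u)) (ad y (q - 1 - a) v)) *
              dpow y (int n - int p + 1 - int q) = of_nat (q choose Suc a) * K u v (a + p) (q - 1 - a)"
            by (simp only: K_def funpow_add o_apply mult.assoc e)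
        qed
        then show "eop q v (iota (ad y p u) * dpow y (int n - int p))
          = iota (ad y p u) * iota (ad y q v) * dpow y (int n - int (p + q))
           + (\<Sum>a<q. of_nat (q choose Suc a) * K u v (a + p) (q - 1 - a))"
          by (simp add: eop_iota_dpow algebra_simps)
      qed
      finally show "lop v (iota (ad y p u) * dpow y (int n - int p)) = \<dots>" .
    qed
    also have "\<dots> = Com u v + (\<Sum>p\<le>N. cst (bern p) * (\<Sum>q\<le>N. cst (bern q) *
         (\<Sum>a<q. of_nat (q choose Suc a) * K u v (a + p) (q - 1 - a))))"
      by (simp only: Com_def distrib_left sum.distrib sum_distrib_left cst_mult mult.assoc)
    also have "(\<Sum>p\<le>N. cst (bern p) * (\<Sum>q\<le>N. cst (bern q) *
         (\<Sum>a<q. of_nat (q choose Suc a) * K u v (a + p) (q - 1 - a))))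
       = (\<Sum>p\<le>N. \<Sum>a\<le>N. \<Sum>b\<le>N. cst (bern p * w a b) * K u v (a + p) b)"
    proof (rule sum.cong[OF refl])
      fix p
      have "cst (bern p) * (\<Sum>q\<le>N. cst (bern q) * (\<Sum>a<q. of_nat (q choose Suc a) * K u v (a + p) (q - 1 - a)))
          = (\<Sum>q\<le>N. \<Sum>a<q. cst (bern p * w a (q - 1 - a)) * K u v (a + p) (q - 1 - a))"
        unfolding sum_distrib_left
      proof (rule sum.cong[OF refl], rule sum.cong[OF refl])
        fix q a :: nat assume "a \<in> {..<q}"
        then have e: "a + (q - 1 - a) + 1 = q" by auto
        have "w a (q - 1 - a) = of_nat (q choose Suc a) * bern q" unfolding w_def e by simp
        then show "cst (bern p) * (cst (bern q) * (of_nat (q choose Suc a) * K u v (a + p) (q - 1 - a)))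
            = cst (bern p * w a (q - 1 - a)) * K u v (a + p) (q - 1 - a)"
          by (simp add: cst_mult cst_of_nat mult_ac)
      qed
      also have "\<dots> = (\<Sum>a\<le>N. \<Sum>b\<le>N. cst (bern p * w a b) * K u v (a + p) b)"
        by (rule sum_strict_triangle_square) (simp add: K0 N_def)
      finally show "cst (bern p) * (\<Sum>q\<le>N. cst (bern q) * (\<Sum>a<q. of_nat (q choose Suc a) * K u v (a + p) (q - 1 - a)))
          = (\<Sum>a\<le>N. \<Sum>b\<le>N. cst (bern p * w a b) * K u v (a + p) b)" .
    qed
    also have "\<dots> = (\<Sum>p\<le>N. \<Sum>b\<le>N. \<Sum>a\<le>N. cst (bern p * w a b) * K u v (a + p) b)"
      by (rule sum.cong[OF refl]) (rule sum.swap)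
    also have "\<dots> = (\<Sum>b\<le>N. \<Sum>p\<le>N. \<Sum>a\<le>N. cst (bern p * w a b) * K u v (a + p) b)"
      by (rule sum.swap)
    also have "\<dots> = (\<Sum>b\<le>N. \<Sum>a\<le>N. \<Sum>p\<le>a. cst (bern p * w (a - p) b) * K u v (a - p + p) b)"
      by (rule sum.cong[OF refl], rule sum_square_triangle) (simp add: K0 N_def)
    also have "\<dots> = (\<Sum>b\<le>N. \<Sum>a\<le>N. cst (\<Sum>p\<le>a. bern p * w (a - p) b) * K u v a b)"
      by (simp add: cst_sum sum_distrib_right del: sum.atMost_Suc)
    also have "\<dots> = T u v"
      unfolding T_def by (rule sum.swap)
    finally show ?thesis .
  qed
  have Com: "Com z x = Com x z"
    unfolding Com_def by (subst sum.swap) (simp only: mult_ac add.commute)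
  have Ks: "K z x a b = - K x z b a" for a b
  proof -
    have "iota (- v) = - iota v" for v
      using glin_scale[OF glin_iota, of "-1" v] by (simp add: cst_uminus)
    then show ?thesis
      unfolding K_def by (subst bracket_swap) (simp add: add.commute)
  qed
  have "lop (bracket z x) (dpow y (int n))
      = (\<Sum>k\<le>N. cst (bern k) * (\<Sum>a\<le>k. of_nat (k choose a) * iota (bracket (ad y a z) (ad y (k - a) x))) * dpow y (int n - int k))"
    by (simp add: lop_dpow[of _ N] N_def leibniz_sum[OF glin_iota] mult.assoc del: sum.atMost_Suc)
  also have "\<dots> = (\<Sum>k\<le>N. \<Sum>a\<le>k. cst (of_nat ((a + (k - a)) choose a) * bern (a + (k - a))) * K z x a (k - a))"
    unfolding sum_distrib_left sum_distrib_right
    by (rule sum.cong[OF refl], rule sum.cong[OF refl]) (simp add: K_def cst_mult cst_of_nat mult_ac)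
  also have "\<dots> = (\<Sum>a\<le>N. \<Sum>b\<le>N. cst (of_nat ((a + b) choose a) * bern (a + b)) * K z x a b)"
    by (rule sum_square_triangle[symmetric]) (simp add: K0 N_def)
  also have "\<dots> = (\<Sum>b\<le>N. \<Sum>a\<le>N. cst (of_nat ((a + b) choose a) * bern (a + b)) * K z x a b)"
    by (rule sum.swap)
  also have "\<dots> = - (\<Sum>a\<le>N. \<Sum>b\<le>N. cst (of_nat ((a + b) choose a) * bern (a + b)) * K x z a b)"
  proof -
    have "cst (of_nat ((a + b) choose a) * bern (a + b)) * K z x a b
        = - (cst (of_nat ((b + a) choose b) * bern (b + a)) * K x z b a)" for a b
      using binomial_symmetric[of a "a + b"] by (simp add: Ks add.commute)
    then show ?thesis
      by (simp only: sum_negf)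
  qed
  finally have L: "lop (bracket z x) (dpow y (int n))
      = - (\<Sum>a\<le>N. \<Sum>b\<le>N. cst (of_nat ((a + b) choose a) * bern (a + b)) * K x z a b)" .
  have Tz: "T z x = - (\<Sum>a\<le>N. \<Sum>b\<le>N. cst (\<Sum>p\<le>b. bern p * w (b - p) a) * K x z a b)"
  proof -
    have "T z x = (\<Sum>b\<le>N. \<Sum>a\<le>N. cst (\<Sum>p\<le>a. bern p * w (a - p) b) * K z x a b)"
      unfolding T_def by (rule sum.swap)
    then show ?thesis by (simp only: Ks mult_minus_right sum_negf)
  qed
  have "T x z - T z x - lop (bracket z x) (dpow y (int n))
      = (\<Sum>a\<le>N. \<Sum>b\<le>N. cst ((\<Sum>p\<le>a. bern p * w (a - p) b) + (\<Sum>p\<le>b. bern p * w (b - p) a)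
          + of_nat ((a + b) choose a) * bern (a + b)) * K x z a b)"
    unfolding Tz L unfolding T_def by (simp only: cst_add distrib_right sum.distrib) simp
  also have "\<dots> = 0"
  proof -
    have "(\<Sum>p\<le>a. bern p * w (a - p) b) + (\<Sum>p\<le>b. bern p * w (b - p) a)
          + of_nat ((a + b) choose a) * bern (a + b) = 0" for a b
      using bern_identity[of a b, where 'k = 'k] unfolding w_def by (simp add: add_ac)
    then show ?thesis by simp
  qed
  finally show ?thesis by (simp add: lop2 Com)
qed

lemma lop_commutator:
  assumes "f \<in> range poly_of"
  shows "lop z (lop x f) - lop x (lop z f) = lop (bracket z x) f"
proof -
  define V where "V = {f. lop z (lop x f) - lop x (lop z f) - lop (bracket z x) f = 0}"
  have l: "klin (\<lambda>f. lop z (lop x f) - lop x (lop z f) - lop (bracket z x) f)"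
    by (intro klin_minus klin_compose[OF klin_lop klin_lop] klin_lop)
  have "subsp V"
    unfolding subsp_def V_def mem_Collect_eq
    using klin_0[OF l] klin_add[OF l] klin_cst[OF l] by simp
  moreover have "iota y ^ n \<in> V" for y n
    unfolding V_def mem_Collect_eq iota_power_eq_dpow klin_cst[OF l] lop_commutator_dpow by simp
  ultimately have "poly_of g \<in> V" for g by (rule iota_powers_span)
  then show ?thesis using assms by (auto simp: V_def)
qed

sublocale EI: free_ideal "env_ideal scale bracket"
  unfolding env_ideal_def by (rule genideal_free_ideal)

lemma letter_bracket_env:
  "letter x * letter y - letter y * letter x - letter (bracket x y) \<in> env_ideal scale bracket"
  unfolding env_ideal_def by (rule genideal_gen) auto

sublocale ET: tensor_ideal scale "env_ideal scale bracket"
proof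
  show "letter (x + y) - (letter x + letter y) \<in> env_ideal scale bracket" for x y
    unfolding env_ideal_def by (rule genideal_gen) (auto simp: tensor_rels_def)
  show "letter (scale c x) - cst c * letter x \<in> env_ideal scale bracket" for c x
    unfolding env_ideal_def by (rule genideal_gen) (auto simp: tensor_rels_def free_const_eq_cst)
qed

lemma env_ideal_cases:
  assumes "f \<in> env_ideal scale bracket" "subsp N"
    and "\<And>u v x y. wd u * (letter (x + y) - (letter x + letter y)) * wd v \<in> N"
    and "\<And>u v c x. wd u * (letter (scale c x) - cst c * letter x) * wd v \<in> N"
    and "\<And>u v x y. wd u * (letter x * letter y - letter y * letter x - letter (bracket x y)) * wd v \<in> N"
  shows "f \<in> N"
  using assms(1) unfolding env_ideal_def
  by (rule genideal_induct) (use assms in \<open>auto simp: tensor_rels_def free_const_eq_cst\<close>)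

text \<open>The action of the free algebra on \<open>1\<close> through the operators \<open>lop\<close>.\<close>

definition act :: "('k, 'g) free_alg \<Rightarrow> ('g multiset \<Rightarrow>\<^sub>0 'k)" where
  "act = lin (\<lambda>w. foldr lop (letters w) 1)"

lemma klin_act: "klin act"
  unfolding act_def by (rule klin_lin)

lemma act_wd: "act (wd xs) = foldr lop xs 1"
  by (simp add: act_def)

lemma act_letter_mult: "act (letter x * f) = lop x (act f)"
proof (rule klin_free_eqI[where F = "\<lambda>f. act (letter x * f)" and G = "\<lambda>f. lop x (act f)"])
  show "act (letter x * wd xs) = lop x (act (wd xs))" for xs
    using act_wd[of "x # xs"] by (simp add: wd_Cons act_wd)
qed (rule klin_compose[OF klin_act klin_lmult[OF klin_id]] klin_compose[OF klin_lop klin_act])+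

lemma act_range: "act f \<in> range poly_of"
proof -
  have "act (wd xs) \<in> range poly_of" for xs
  proof (induction xs)
    case Nil
    then show ?case using rangeI[of poly_of 1] by (simp add: act_wd poly_of_1 del: wd_Nil)
  next
    case (Cons x xs)
    then show ?case by (simp add: act_wd lop_range)
  qed
  moreover have "subsp {f. act f \<in> range poly_of}"
    using subspD(1-3)[OF subsp_range_poly_of]
    by (simp add: subsp_def klin_0[OF klin_act] klin_add[OF klin_act] klin_cst[OF klin_act])
  ultimately show ?thesis using free_alg_induct by blast
qed

lemma act_wd_mult: "act (wd xs * f) = foldr lop xs (act f)"
  by (induction xs) (simp_all add: wd_Cons mult.assoc act_letter_mult)

lemma act_env_ideal:
  assumes "f \<in> env_ideal scale bracket"
  shows "act f = 0"
proof -
  have fold0: "foldr lop xs 0 = 0" for xs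
    by (induction xs) (simp_all add: klin_0[OF klin_lop])
  have z: "act (wd u * r * wd v) = 0" if "\<And>v. act (r * wd v) = 0" for u v r
    using that by (simp add: mult.assoc act_wd_mult fold0)
  show ?thesis
  proof (rule CollectD[of f "\<lambda>f. act f = 0"], rule env_ideal_cases[OF assms], goal_cases)
    case 1
    then show ?case
      by (simp add: subsp_def klin_0[OF klin_act] klin_add[OF klin_act] klin_cst[OF klin_act])
  next
    case (2 u v x y)
    show ?case
      unfolding mem_Collect_eq
      by (rule z) (simp only: left_diff_distrib distrib_right klin_diff[OF klin_act] klin_add[OF klin_act]
          act_letter_mult glin_add[OF glin_lop], simp)
  next
    case (3 u v c x)
    show ?case
      unfolding mem_Collect_eq
      by (rule z) (simp only: left_diff_distrib mult.assoc klin_diff[OF klin_act] klin_cst[OF klin_act]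
          act_letter_mult glin_scale[OF glin_lop], simp)
  next
    case (4 u v x y)
    show ?case
      unfolding mem_Collect_eq
      by (rule z) (simp only: left_diff_distrib mult.assoc klin_diff[OF klin_act]
          act_letter_mult lop_commutator[OF act_range], simp)
  qed
qed

lemma act_power_mult: "act (letter y ^ d * f) = (lop y ^^ d) (act f)"
  by (induction d) (simp_all add: mult.assoc act_letter_mult)

lemma act_power: "act (letter y ^ n) = iota y ^ n"
proof (induction n)
  case 0
  then show ?case using act_wd[of "[]"] by simp
next
  case (Suc n)
  then show ?case using lop_self_power[of y n] by (simp add: act_letter_mult)
qed

text \<open>
  This makes symmetrization injective. On powers both sides are \<open>y\<^sup>n\<close>.
\<close>

lemma act_symz: "act (symz f) = poly_of f"
proof -
  have l: "klin (\<lambda>f. act (symz f) - poly_of f)"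
    by (intro klin_minus klin_compose[OF klin_act klin_symz] klin_poly_of)
  have "f \<in> {f. act (symz f) - poly_of f = 0}"
  proof (rule free_alg_power_induct)
    show "subsp {f. act (symz f) - poly_of f = 0}"
      unfolding subsp_def mem_Collect_eq
      using klin_0[OF l] klin_add[OF l] klin_cst[OF l] by simp
    show "sym_ideal scale \<subseteq> {f. act (symz f) - poly_of f = 0}"
      using ET.symz_mem act_env_ideal poly_of_sym_ideal by auto
    show "letter y ^ n \<in> {f. act (symz f) - poly_of f = 0}" for y n
      by (simp add: symz_power act_power poly_of_power poly_of_letter)
  qed
  then show ?thesis by simp
qed

lemma letter_funpow_env:
  "letter (ad y p x) - ((\<lambda>V. letter y * V - V * letter y) ^^ p) (letter x) \<in> env_ideal scale bracket"
proof (induction p)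
  case (Suc p)
  let ?D = "\<lambda>V. letter y * V - V * letter y"
  have "?D (letter (ad y p x) - (?D ^^ p) (letter x)) \<in> env_ideal scale bracket"
    by (rule EI.diff_mem[OF EI.lmult_mem[OF Suc] EI.rmult_mem[OF Suc]])
  from EI.diff_mem[OF this letter_bracket_env[of y "ad y p x"]]
  show ?case by (simp add: algebra_simps)
qed (simp add: EI.zero_mem)

text \<open>
  The class of \<open>h\<close> is \<open>L\<^sub>x y\<^sup>n\<close>. Its symmetrization is a combination of the sums
  \<open>\<Sum>\<^sub>i y\<^sup>i ad(y)\<^sup>p(x) y\<^bsup>n-p-i\<^esup>\<close>, and \<open>letter_times_power\<close> says that these combine to \<open>x y\<^sup>n\<close>.
\<close>

lemma symz_lop_power:
  "\<exists>h. poly_of h = lop x (iota y ^ n) \<and> symz h - letter x * letter y ^ n \<in> env_ideal scale bracket"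
proof -
  define c where "c = (\<lambda>p. bern p * (fact n / fact (n - p)) :: 'k)"
  define h where "h = (\<Sum>p\<le>n. cst (c p) * (letter (ad y p x) * letter y ^ (n - p)))"
  define D where "D = (\<lambda>V. letter y * V - V * letter y :: ('k, 'g) free_alg)"
  have "poly_of h = (\<Sum>p\<le>n. cst (c p) * (iota (ad y p x) * iota y ^ (n - p)))"
    by (simp add: h_def klin_sum[OF klin_poly_of] poly_of_cst poly_of_mult poly_of_letter poly_of_power)
  also have "\<dots> = (\<Sum>p\<le>n. cst (fact n) * (cst (bern p) * (iota (ad y p x) * dpow y (int n - int p))))"
  proof (rule sum.cong[OF refl])
    fix p assume p: "p \<in> {..n}"
    then have "int n - int p = int (n - p)" by auto
    then show "cst (c p) * (iota (ad y p x) * iota y ^ (n - p))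
        = cst (fact n) * (cst (bern p) * (iota (ad y p x) * dpow y (int n - int p)))"
      by (simp only: dpow_of_nat c_def times_divide_eq_right[symmetric] divide_inverse cst_mult mult_1_left)
        (simp only: mult_ac)
  qed
  also have "\<dots> = lop x (iota y ^ n)"
    by (simp only: iota_power_eq_dpow klin_cst[OF klin_lop] lop_dpow[OF order_refl] sum_distrib_left)
  finally have 1: "poly_of h = lop x (iota y ^ n)" .
  have "symz h = (\<Sum>p\<le>n. cst (c p) * (cst (1 / of_nat (Suc (n - p))) *
      (\<Sum>i\<le>n - p. letter y ^ i * letter (ad y p x) * letter y ^ (n - p - i))))"
    by (simp add: h_def klin_sum[OF klin_symz] klin_cst[OF klin_symz] symz_letter_power)
  also have "\<dots> = (\<Sum>p\<le>n. cst (bern p * (fact n / fact (Suc (n - p)))) *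
      (\<Sum>i\<le>n - p. letter y ^ i * letter (ad y p x) * letter y ^ (n - p - i)))"
    by (rule sum.cong[OF refl]) (simp add: c_def mult.assoc[symmetric] cst_mult[symmetric] mult.commute)
  finally have "symz h - letter x * letter y ^ n
     = (\<Sum>p\<le>n. cst (bern p * (fact n / fact (Suc (n - p)))) *
      (\<Sum>i\<le>n - p. letter y ^ i * (letter (ad y p x) - (D ^^ p) (letter x)) * letter y ^ (n - p - i)))"
    unfolding letter_times_power[of "letter x" "letter y" n] D_def
    by (simp only: right_diff_distrib left_diff_distrib sum_subtractf)
  also have "\<dots> \<in> env_ideal scale bracket"
    unfolding D_def by (intro EI.sum_mem EI.lmult_mem EI.rmult_mem letter_funpow_env)
  finally show ?thesis using 1 by blast
qed

lemma symz_lop: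
  "\<exists>h. poly_of h = lop x (poly_of g) \<and> symz h - letter x * symz g \<in> env_ideal scale bracket"
proof -
  define V where "V = {g. \<exists>h. poly_of h = lop x (poly_of g) \<and> symz h - letter x * symz g \<in> env_ideal scale bracket}"
  have "g \<in> V"
  proof (rule free_alg_power_induct)
    show "subsp V"
      unfolding subsp_def
    proof (intro conjI ballI allI)
      show "0 \<in> V"
        unfolding V_def
        by (rule CollectI, rule exI[of _ 0])
           (simp add: klin_0[OF klin_poly_of] klin_0[OF klin_lop] klin_0[OF klin_symz] EI.zero_mem)
    next
      fix f g assume "f \<in> V" "g \<in> V"
      then obtain f' g' where
        f': "poly_of f' = lop x (poly_of f)" "symz f' - letter x * symz f \<in> env_ideal scale bracket" and
        g': "poly_of g' = lop x (poly_of g)" "symz g' - letter x * symz g \<in> env_ideal scale bracket"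
        by (auto simp: V_def)
      have "symz (f' + g') - letter x * symz (f + g) \<in> env_ideal scale bracket"
        using EI.add_mem[OF f'(2) g'(2)] by (simp add: klin_add[OF klin_symz] algebra_simps)
      then show "f + g \<in> V"
        unfolding V_def using f'(1) g'(1)
        by (intro CollectI exI[of _ "f' + g'"]) (simp add: klin_add[OF klin_poly_of] klin_add[OF klin_lop])
    next
      fix c f assume "f \<in> V"
      then obtain f' where
        f': "poly_of f' = lop x (poly_of f)" "symz f' - letter x * symz f \<in> env_ideal scale bracket"
        by (auto simp: V_def)
      have "symz (cst c * f') - letter x * symz (cst c * f) \<in> env_ideal scale bracket"
        using EI.lmult_mem[OF f'(2), of "cst c"]
        by (simp add: klin_cst[OF klin_symz] right_diff_distrib cst_left_commute[of "letter x"])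
      then show "cst c * f \<in> V"
        unfolding V_def using f'(1)
        by (intro CollectI exI[of _ "cst c * f'"]) (simp add: klin_cst[OF klin_poly_of] klin_cst[OF klin_lop])
    qed
    show "sym_ideal scale \<subseteq> V"
    proof
      fix f assume "f \<in> sym_ideal scale"
      then have "poly_of f = 0" "symz f \<in> env_ideal scale bracket"
        by (simp_all add: poly_of_sym_ideal ET.symz_mem)
      then show "f \<in> V"
        unfolding V_def
        by (intro CollectI exI[of _ 0])
           (simp add: klin_0[OF klin_poly_of] klin_0[OF klin_lop] klin_0[OF klin_symz] EI.lmult_mem EI.uminus_mem)
    qed
    show "letter y ^ n \<in> V" for y n
      using symz_lop_power[of x y n]
      by (simp add: V_def symz_power poly_of_power poly_of_letter)
  qed
  then show ?thesis by (simp add: V_def)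
qed

text \<open>
  The image of symmetrization contains \<open>1\<close> and is stable under left multiplication by letters.
\<close>

lemma symz_surj: "\<exists>h. poly_of h = act u \<and> symz h - u \<in> env_ideal scale bracket"
proof -
  define V where "V = {u. \<exists>h. symz h - u \<in> env_ideal scale bracket}"
  have "wd xs \<in> V" for xs
  proof (induction xs)
    case Nil
    have "symz (1 :: ('k, 'g) free_alg) = 1"
      using symz_power[of "0 :: 'g" 0] by (metis power_0)
    then show ?case
      unfolding V_def by (intro CollectI exI[of _ 1]) (simp add: EI.zero_mem)
  next
    case (Cons x xs)
    then obtain g where g: "symz g - wd xs \<in> env_ideal scale bracket" by (auto simp: V_def)
    obtain h where h: "symz h - letter x * symz g \<in> env_ideal scale bracket" using symz_lop by blast
    from EI.add_mem[OF h EI.lmult_mem[OF g, of "letter x"]]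
    have "symz h - wd (x # xs) \<in> env_ideal scale bracket" by (simp add: wd_Cons algebra_simps)
    then show ?case by (auto simp: V_def)
  qed
  moreover have "subsp V"
    unfolding subsp_def
  proof (intro conjI ballI allI)
    show "0 \<in> V"
      by (auto simp: V_def klin_0[OF klin_symz] EI.zero_mem intro!: exI[of _ 0])
  next
    fix f g assume "f \<in> V" "g \<in> V"
    then obtain f' g' where "symz f' - f \<in> env_ideal scale bracket" "symz g' - g \<in> env_ideal scale bracket"
      by (auto simp: V_def)
    from EI.add_mem[OF this] have "symz (f' + g') - (f + g) \<in> env_ideal scale bracket"
      by (simp add: klin_add[OF klin_symz] algebra_simps)
    then show "f + g \<in> V" by (auto simp: V_def)
  next
    fix c f assume "f \<in> V"
    then obtain f' where "symz f' - f \<in> env_ideal scale bracket" by (auto simp: V_def)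
    from EI.lmult_mem[OF this, of "cst c"] have "symz (cst c * f') - cst c * f \<in> env_ideal scale bracket"
      by (simp add: klin_cst[OF klin_symz] right_diff_distrib)
    then show "cst c * f \<in> V" by (auto simp: V_def)
  qed
  ultimately have "u \<in> V" using free_alg_induct by blast
  then obtain h where h: "symz h - u \<in> env_ideal scale bracket" by (auto simp: V_def)
  have "act (symz h - u) = 0" by (rule act_env_ideal[OF h])
  then have "poly_of h = act u" by (simp add: klin_diff[OF klin_act] act_symz)
  then show ?thesis using h by blast
qed

end

section \<open>Homogeneous components of the star product\<close>

context lie_algebra_0
begin

text \<open>
  The part of \<open>L\<^sub>y\<^sup>d\<close> that lowers the expected degree \<open>n + d\<close> by \<open>p\<close>.
\<close>

primrec lop_comp :: "'g \<Rightarrow> nat \<Rightarrow> nat \<Rightarrow> ('g multiset \<Rightarrow>\<^sub>0 'k) \<Rightarrow> ('g multiset \<Rightarrow>\<^sub>0 'k)" where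
  "lop_comp y 0 p = (\<lambda>f. if p = 0 then f else 0)"
| "lop_comp y (Suc d) p = (\<lambda>f. \<Sum>i\<le>p. cst (bern (p - i)) * eop (p - i) y (lop_comp y d i f))"

lemma klin_lop_comp: "klin (lop_comp y d p)"
proof (induction d arbitrary: p)
  case 0
  then show ?case by (cases "p = 0") (simp_all add: klin_id klin_zero)
next
  case (Suc d)
  show ?case
    unfolding lop_comp.simps by (intro klin_setsum klin_lmult klin_compose[OF klin_eop Suc])
qed

lemma dorder_lop_comp: "dorder (Suc p) (lop_comp y d p)"
proof (induction d arbitrary: p)
  case 0
  then show ?case by (cases "p = 0") (simp_all add: dorder_zero del: dorder.simps(2), simp)
next
  case (Suc d)
  have "dorder (Suc p) (\<lambda>f. eop (p - i) y (lop_comp y d i f))" if "i \<in> {..p}" for i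
    using dorder_compose[OF dorder_eop[of "p - i" y] Suc[of i] klin_add[OF klin_eop]] that by simp
  then show ?case
    unfolding lop_comp.simps by (intro dorder_sum dorder_mult)
qed

lemma homog_lop_comp: "homog n f \<Longrightarrow> homog (n + int d - int p) (lop_comp y d p f)"
proof (induction d arbitrary: p)
  case 0
  then show ?case by (simp add: homog_0)
next
  case (Suc d)
  have "homog (n + int (Suc d) - int p) (eop (p - i) y (lop_comp y d i f))" if "i \<in> {..p}" for i
    using homog_eop[OF Suc.IH[OF Suc.prems, of i], of "p - i" y] that by (simp add: algebra_simps of_nat_diff)
  then show ?case
    unfolding lop_comp.simps by (intro homog_sum homog_cst)
qed

lemma lop_power_components:
  assumes "homog n f" "n + int d \<le> int N"
  shows "(lop y ^^ d) f = (\<Sum>p\<le>N. lop_comp y d p f)"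
  using assms(2)
proof (induction d)
  case 0
  then show ?case by simp
next
  case (Suc d)
  have "(lop y ^^ Suc d) f = lop y (\<Sum>p\<le>N. lop_comp y d p f)"
    using Suc by simp
  also have "\<dots> = (\<Sum>p\<le>N. \<Sum>i\<le>N - p. cst (bern i) * eop i y (lop_comp y d p f))"
    unfolding klin_sum[OF klin_lop]
  proof (rule sum.cong[OF refl])
    fix p assume "p \<in> {..N}"
    then show "lop y (lop_comp y d p f) = (\<Sum>i\<le>N - p. cst (bern i) * eop i y (lop_comp y d p f))"
      using Suc.prems by (intro lop_homog[OF homog_lop_comp[OF assms(1)]]) (simp add: of_nat_diff)
  qed
  also have "\<dots> = (\<Sum>(p, i)\<in>Sigma {..N} (\<lambda>p. {..N - p}). cst (bern i) * eop i y (lop_comp y d p f))"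
    by (simp add: sum.Sigma)
  also have "Sigma {..N} (\<lambda>p. {..N - p}) = {(p, i). p + i \<le> N}"
    by auto
  also have "(\<Sum>(p, i)\<in>{(p, i). p + i \<le> N}. cst (bern i) * eop i y (lop_comp y d p f))
      = (\<Sum>p\<le>N. lop_comp y (Suc d) p f)"
    by (simp add: sum.triangle_reindex_eq)
  finally show ?case .
qed

lemma pcomp_lop_power:
  assumes "homog n f"
  shows "pcomp (n + int d - int p) ((lop y ^^ d) f) = lop_comp y d p f"
proof -
  define N where "N = max p (nat (n + int d))"
  have "(lop y ^^ d) f = (\<Sum>q\<le>N. lop_comp y d q f)"
    by (rule lop_power_components[OF assms]) (simp add: N_def)
  then have "pcomp (n + int d - int p) ((lop y ^^ d) f) = (\<Sum>q\<le>N. if q = p then lop_comp y d q f else 0)"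
    by (simp add: klin_sum[OF klin_pcomp] pcomp_homog[OF homog_lop_comp[OF assms]] cong: if_cong)
  also have "\<dots> = lop_comp y d p f"
    by (simp add: N_def)
  finally show ?thesis .
qed

end

context sym_space
begin

text \<open>
  The parameter \<open>BB\<close> stands for the product or the opposite product. Being a differential operator
  is a linear condition on \<open>f\<close>, so that powers of vectors suffice.
\<close>

lemma component_operator:
  assumes lin: "\<And>g. klin (\<lambda>f. BB f g)"
    and ker: "\<And>f g. f \<in> sym_ideal scale \<Longrightarrow> BB f g = 0"
    and pow: "\<And>y d. \<exists>A. klin A \<and> dorder (Suc p) A \<and>
       (\<forall>n g. homog n (poly_of g) \<longrightarrow> pcomp (n + int d - int p) (BB (letter y ^ d) g) = A (poly_of g))"
  shows "\<exists>A. klin A \<and> dorder (Suc p) A \<and>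
       (\<forall>n g. homog n (poly_of g) \<longrightarrow> pcomp (n + int m - int p) (BB (tcomp m f) g) = A (poly_of g))"
proof -
  define Q where "Q = (\<lambda>f A. klin A \<and> dorder (Suc p) A \<and>
       (\<forall>n g. homog n (poly_of g) \<longrightarrow> pcomp (n + int m - int p) (BB (tcomp m f) g) = A (poly_of g)))"
  have Q0: "Q f (\<lambda>f. 0)" if "\<And>g. BB (tcomp m f) g = 0" for f
    unfolding Q_def that by (simp add: klin_zero dorder_zero klin_0[OF klin_pcomp] del: dorder.simps)
  have "f \<in> {f. \<exists>A. Q f A}"
  proof (rule free_alg_power_induct)
    show "subsp {f. \<exists>A. Q f A}"
      unfolding subsp_def
    proof (intro conjI ballI allI)
      show "0 \<in> {f. \<exists>A. Q f A}"
        using Q0[of 0] by (auto simp: klin_0[OF klin_tcomp] klin_0[OF lin])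
    next
      fix f g assume "f \<in> {f. \<exists>A. Q f A}" "g \<in> {f. \<exists>A. Q f A}"
      then obtain A A' where "Q f A" "Q g A'" by auto
      then have "Q (f + g) (\<lambda>h. A h + A' h)"
        unfolding Q_def
        by (auto simp: klin_add[OF klin_tcomp] klin_add[OF lin] klin_add[OF klin_pcomp]
            simp del: dorder.simps intro!: klin_plus dorder_add)
      then show "f + g \<in> {f. \<exists>A. Q f A}" by blast
    next
      fix c f assume "f \<in> {f. \<exists>A. Q f A}"
      then obtain A where "Q f A" by auto
      then have "Q (cst c * f) (\<lambda>h. cst c * A h)"
        unfolding Q_def
        by (auto simp: klin_cst[OF klin_tcomp] klin_cst[OF lin] klin_cst[OF klin_pcomp]
            simp del: dorder.simps intro!: klin_lmult dorder_mult)
      then show "cst c * f \<in> {f. \<exists>A. Q f A}" by blast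
    qed
    show "sym_ideal scale \<subseteq> {f. \<exists>A. Q f A}"
    proof
      fix f assume "f \<in> sym_ideal scale"
      then have "tcomp m f \<in> sym_ideal scale"
        by (simp add: poly_of_eq_0_iff[symmetric] poly_of_tcomp klin_0[OF klin_pcomp])
      then show "f \<in> {f. \<exists>A. Q f A}" using Q0[of f] ker by auto
    qed
    show "letter y ^ d \<in> {f. \<exists>A. Q f A}" for y d
    proof (cases "d = m")
      case True
      then have "tcomp m (letter y ^ d :: ('k, 'g) free_alg) = letter y ^ d"
        by (simp add: wd_replicate[symmetric] tcomp_wd)
      then show ?thesis using pow[of d y] True by (simp add: Q_def)
    next
      case False
      then have "tcomp m (letter y ^ d :: ('k, 'g) free_alg) = 0"
        by (simp add: wd_replicate[symmetric] tcomp_wd)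
      then show ?thesis using Q0[of "letter y ^ d"] by (auto simp: klin_0[OF lin])
    qed
  qed
  then show ?thesis by (simp add: Q_def)
qed

lemma component_operator_sum:
  assumes lin: "\<And>g. klin (\<lambda>f. BB f g)"
    and ker: "\<And>f g. f \<in> sym_ideal scale \<Longrightarrow> BB f g = 0"
    and pow: "\<And>y d. \<exists>A. klin A \<and> dorder (Suc p) A \<and>
       (\<forall>n g. homog n (poly_of g) \<longrightarrow> pcomp (n + int d - int p) (BB (letter y ^ d) g) = A (poly_of g))"
  shows "\<exists>A. klin A \<and> dorder (Suc p) A \<and>
       (\<forall>N g. (\<forall>w\<in>keys g. length (letters w) \<le> N) \<longrightarrow>
          (\<Sum>m\<le>M. \<Sum>n\<le>N. pcomp (int m + int n - int p) (BB (tcomp m f) (tcomp n g))) = A (poly_of g))"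
proof -
  have "\<forall>m. \<exists>A. klin A \<and> dorder (Suc p) A \<and>
       (\<forall>n g. homog n (poly_of g) \<longrightarrow> pcomp (n + int m - int p) (BB (tcomp m f) g) = A (poly_of g))"
    using component_operator[of BB p, OF lin ker pow] by blast
  then obtain A where A: "\<And>m. klin (A m)" "\<And>m. dorder (Suc p) (A m)"
      "\<And>m n g. homog n (poly_of g) \<Longrightarrow> pcomp (n + int m - int p) (BB (tcomp m f) g) = A m (poly_of g)"
    by metis
  define A' where "A' = (\<lambda>h. \<Sum>m\<le>M. A m h)"
  have "(\<Sum>m\<le>M. \<Sum>n\<le>N. pcomp (int m + int n - int p) (BB (tcomp m f) (tcomp n g))) = A' (poly_of g)"
    if N: "\<forall>w\<in>keys g. length (letters w) \<le> N" for N g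
  proof -
    have "pcomp (int m + int n - int p) (BB (tcomp m f) (tcomp n g)) = A m (poly_of (tcomp n g))" for m n
      using A(3)[of "int n" "tcomp n g" m] homog_pcomp[of "int n" "poly_of g"]
      by (simp add: poly_of_tcomp add.commute)
    then have "(\<Sum>m\<le>M. \<Sum>n\<le>N. pcomp (int m + int n - int p) (BB (tcomp m f) (tcomp n g)))
        = (\<Sum>m\<le>M. A m (poly_of (\<Sum>n\<le>N. tcomp n g)))"
      by (simp add: klin_sum[OF A(1)] klin_sum[OF klin_poly_of])
    then show ?thesis
      using tcomp_decompose[of g N] N by (simp add: A'_def)
  qed
  moreover have "klin A'" unfolding A'_def by (intro klin_setsum A)
  moreover have "dorder (Suc p) A'" unfolding A'_def by (intro dorder_sum A)
  ultimately show ?thesis by blast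
qed

end

context lie_algebra_0
begin

lemma lie_algebra_opposite: "lie_algebra_0 scale (\<lambda>x y. bracket y x)"
proof (intro lie_algebra_0.intro lie_algebra.intro lie_algebra_axioms.intro)
  show "vector_space scale" by (rule vector_space_axioms)
  show "Vector_Spaces.linear scale scale (\<lambda>y. bracket y x)" for x by (rule bracket_linear_left)
  show "Vector_Spaces.linear scale scale (\<lambda>x. bracket y x)" for y by (rule bracket_linear_right)
  show "bracket x x = 0" for x by (rule bracket_self)
  have "bracket (bracket z y) x = bracket x (bracket y z)" for x y z
    by (metis bracket_swap bracket_minus_right minus_minus)
  then show "bracket (bracket z y) x + bracket (bracket x z) y + bracket (bracket y x) z = 0" for x y z
    using jacobi[of x y z] by simp
qed

text \<open>Reversing words is an isomorphism onto the opposite algebra that fixes symmetrized words.\<close>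

lemma symz_mult_letter:
  "\<exists>h. poly_of h = lie_algebra_0.lop scale (\<lambda>x y. bracket y x) x (poly_of g)
     \<and> symz h - symz g * letter x \<in> env_ideal scale bracket"
proof -
  interpret Op: lie_algebra_0 scale "\<lambda>x y. bracket y x"
    by (rule lie_algebra_opposite)
  have outer: "trev (wd u * r * wd v) \<in> env_ideal scale bracket" if "trev r \<in> env_ideal scale bracket" for u v r
    unfolding trev_mult by (rule EI.lmult_mem[OF EI.rmult_mem[OF that]])
  have trev_env: "trev f \<in> env_ideal scale bracket" if "f \<in> env_ideal scale (\<lambda>x y. bracket y x)" for f
  proof (rule CollectD[of f "\<lambda>f. trev f \<in> env_ideal scale bracket"], rule Op.env_ideal_cases[OF that], goal_cases)
    case 1
    then show ?case
      by (simp add: subsp_def klin_0[OF klin_trev] klin_add[OF klin_trev] klin_cst[OF klin_trev]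
          EI.zero_mem EI.add_mem EI.lmult_mem)
  next
    case (2 u v x y)
    show ?case
      using ET.letter_add_mem[of x y]
      by (intro CollectI outer) (simp only: klin_diff[OF klin_trev] klin_add[OF klin_trev] trev_letter)
  next
    case (3 u v c x)
    show ?case
      using ET.letter_scale_mem[of c x]
      by (intro CollectI outer) (simp only: klin_diff[OF klin_trev] klin_cst[OF klin_trev] trev_letter)
  next
    case (4 u v x y)
    show ?case
      using letter_bracket_env[of y x]
      by (intro CollectI outer) (simp only: klin_diff[OF klin_trev] trev_mult trev_letter)
  qed
  obtain h where h: "poly_of h = Op.lop x (poly_of g)"
      "symz h - letter x * symz g \<in> env_ideal scale (\<lambda>x y. bracket y x)"
    using Op.symz_lop by blast
  have "symz h - symz g * letter x \<in> env_ideal scale bracket"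
    using trev_env[OF h(2)] by (simp add: klin_diff[OF klin_trev] trev_mult trev_symz)
  then show ?thesis using h(1) by blast
qed

lemma act_symz_mult_power:
  "act (symz g * letter y ^ d) = (lie_algebra_0.lop scale (\<lambda>x y. bracket y x) y ^^ d) (poly_of g)"
proof (induction d arbitrary: g)
  case 0
  then show ?case by (simp add: act_symz)
next
  case (Suc d)
  obtain h where h: "poly_of h = lie_algebra_0.lop scale (\<lambda>x y. bracket y x) y (poly_of g)"
      "symz h - symz g * letter y \<in> env_ideal scale bracket"
    using symz_mult_letter by blast
  have "act ((symz h - symz g * letter y) * letter y ^ d) = 0"
    by (rule act_env_ideal[OF EI.rmult_mem[OF h(2)]])
  then have "act (symz g * letter y ^ Suc d) = act (symz h * letter y ^ d)"
    by (simp add: left_diff_distrib klin_diff[OF klin_act] mult.assoc)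
  then show ?case by (simp add: Suc h(1) funpow_swap1)
qed

text \<open>The transported product: \<open>star f g\<close> is \<open>B\<close> at the classes of \<open>f\<close> and \<open>g\<close>.\<close>

definition star :: "('k, 'g) free_alg \<Rightarrow> ('k, 'g) free_alg \<Rightarrow> ('g multiset \<Rightarrow>\<^sub>0 'k)" where
  "star f g = act (symz f * symz g)"

lemma klin_star: "klin (star f)" "klin (\<lambda>f. star f g)"
  unfolding star_def
  by (rule klin_compose[OF klin_act klin_lmult[OF klin_symz]] klin_compose[OF klin_act klin_rmult[OF klin_symz]])+

lemma star_sym_ideal:
  "f \<in> sym_ideal scale \<Longrightarrow> star f g = 0" "g \<in> sym_ideal scale \<Longrightarrow> star f g = 0"
  unfolding star_def
  by (rule act_env_ideal[OF EI.rmult_mem[OF ET.symz_mem]], assumption)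
     (rule act_env_ideal[OF EI.lmult_mem[OF ET.symz_mem]])

lemma star_left_operator:
  "\<exists>A. klin A \<and> dorder (Suc p) A \<and>
       (\<forall>N g. (\<forall>w\<in>keys g. length (letters w) \<le> N) \<longrightarrow>
          (\<Sum>m\<le>M. \<Sum>n\<le>N. pcomp (int m + int n - int p) (star (tcomp m f) (tcomp n g))) = A (poly_of g))"
proof (rule component_operator_sum)
  fix y d
  have "pcomp (n + int d - int p) (star (letter y ^ d) g) = lop_comp y d p (poly_of g)"
    if "homog n (poly_of g)" for n g
    using pcomp_lop_power[OF that] by (simp add: star_def symz_power act_power_mult act_symz)
  then show "\<exists>A. klin A \<and> dorder (Suc p) A \<and>
       (\<forall>n g. homog n (poly_of g) \<longrightarrow> pcomp (n + int d - int p) (star (letter y ^ d) g) = A (poly_of g))"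
    using klin_lop_comp dorder_lop_comp by blast
qed (auto intro: klin_star star_sym_ideal)

lemma star_right_operator:
  "\<exists>A. klin A \<and> dorder (Suc p) A \<and>
       (\<forall>N g. (\<forall>w\<in>keys g. length (letters w) \<le> N) \<longrightarrow>
          (\<Sum>m\<le>M. \<Sum>n\<le>N. pcomp (int m + int n - int p) (star (tcomp n g) (tcomp m f))) = A (poly_of g))"
proof (rule component_operator_sum)
  interpret Op: lie_algebra_0 scale "\<lambda>x y. bracket y x"
    by (rule lie_algebra_opposite)
  fix y d
  have "pcomp (n + int d - int p) (star g (letter y ^ d)) = Op.lop_comp y d p (poly_of g)"
    if "homog n (poly_of g)" for n g
    using Op.pcomp_lop_power[OF that] by (simp add: star_def symz_power act_symz_mult_power)
  then show "\<exists>A. klin A \<and> dorder (Suc p) A \<and>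
       (\<forall>n g. homog n (poly_of g) \<longrightarrow> pcomp (n + int d - int p) (star g (letter y ^ d)) = A (poly_of g))"
    using Op.klin_lop_comp Op.dorder_lop_comp by blast
qed (auto intro: klin_star star_sym_ideal)

end

section \<open>Quotients of the free algebra\<close>

lemma free_alg_length_bound:
  obtains N where "\<And>w. w \<in> keys f \<Longrightarrow> length (letters w) \<le> N"
proof
  show "length (letters w) \<le> Max ((\<lambda>w. length (letters w)) ` keys f)" if "w \<in> keys f" for w
    using that by simp
qed

context free_ideal
begin

abbreviation cls :: "('k, 'g) free_alg \<Rightarrow> ('k, 'g) free_alg set" where
  "cls f \<equiv> I +>\<^bsub>free_ring\<^esub> f"

lemma cls_eq_iff: "cls f = cls g \<longleftrightarrow> f - g \<in> I"
proof -
  have cls: "cls f = {h + f | h. h \<in> I}" for f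
    by (auto simp: a_r_coset_def r_coset_def)
  show ?thesis
  proof
    assume "cls f = cls g"
    moreover have "f \<in> cls f" unfolding cls using zero_mem by force
    ultimately obtain h where "h \<in> I" "f = h + g" unfolding cls by auto
    then show "f - g \<in> I" by simp
  next
    assume fg: "f - g \<in> I"
    have "h + f = (h + (f - g)) + g" "h + g = (h - (f - g)) + f" for h by simp_all
    then show "cls f = cls g"
      unfolding cls using add_mem[OF _ fg] diff_mem[OF _ fg] by blast
  qed
qed

lemma cls_0_iff: "cls f = cls 0 \<longleftrightarrow> f \<in> I"
  by (simp add: cls_eq_iff)

lemma quot_alg_simps [simp]:
  "carrier (quot_alg I) = range cls"
  "cls f \<otimes>\<^bsub>quot_alg I\<^esub> cls g = cls (f * g)"
  "cls f \<oplus>\<^bsub>quot_alg I\<^esub> cls g = cls (f + g)"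
  "\<one>\<^bsub>quot_alg I\<^esub> = cls 1"
  "\<zero>\<^bsub>quot_alg I\<^esub> = cls 0"
  "c \<odot>\<^bsub>quot_alg I\<^esub> cls f = cls (cst c * f)"
proof -
  interpret ideal I "free_ring :: ('k, 'g) free_alg ring" by (rule ideal)
  have m: "cls f \<otimes>\<^bsub>free_ring Quot I\<^esub> cls g = cls (f * g)" for f g
    using rcoset_mult_add[of f g] by (simp add: FactRing_def)
  have z: "cls 0 = I"
    by (auto simp: a_r_coset_def r_coset_def)
  show "carrier (quot_alg I) = range cls"
    by (auto simp: quot_alg_def ring.defs FactRing_def A_RCOSETS_defs a_r_coset_def r_coset_def)
  show "cls f \<otimes>\<^bsub>quot_alg I\<^esub> cls g = cls (f * g)"
    using m by (simp add: quot_alg_def ring.defs)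
  show "cls f \<oplus>\<^bsub>quot_alg I\<^esub> cls g = cls (f + g)"
    using a_rcos_sum[of f g] by (simp add: quot_alg_def ring.defs FactRing_def)
  show "\<one>\<^bsub>quot_alg I\<^esub> = cls 1"
    by (simp add: quot_alg_def ring.defs FactRing_def)
  show "\<zero>\<^bsub>quot_alg I\<^esub> = cls 0"
    by (simp add: quot_alg_def ring.defs FactRing_def z)
  show "c \<odot>\<^bsub>quot_alg I\<^esub> cls f = cls (cst c * f)"
    using m[of "free_const c" f] by (simp add: quot_alg_def ring.defs module.defs free_const_eq_cst)
qed

lemma abelian_monoid_quot_alg: "abelian_monoid (quot_alg I)"
  by (rule abelian_monoidI) (auto simp: add_ac)

lemma finsum_cls: "finsum (quot_alg I) (\<lambda>i. cls (f i)) A = cls (sum f A)"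
proof -
  interpret abelian_monoid "quot_alg I" by (rule abelian_monoid_quot_alg)
  show ?thesis
    by (induction A rule: infinite_finite_induct) (auto simp: finsum_infinite)
qed

lemma list_prod_cls: "list_prod (quot_alg I) (map (\<lambda>x. cls (letter x)) xs) = cls (wd xs)"
  by (induction xs) (simp_all add: list_prod_def wd_Cons)

end

context sym_space
begin

abbreviation scls :: "('k, 'g) free_alg \<Rightarrow> ('k, 'g) free_alg set" where
  "scls \<equiv> SI.cls"

lemmas sym_simps [simp] = SI.quot_alg_simps[folded sym_alg_def]

lemma scls_eq_iff: "scls f = scls g \<longleftrightarrow> poly_of f = poly_of g"
  by (simp add: SI.cls_eq_iff poly_of_eq_iff)

lemma scls_eq_0_iff: "scls f = scls 0 \<longleftrightarrow> poly_of f = 0"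
  by (simp add: scls_eq_iff klin_0[OF klin_poly_of])

lemmas finsum_scls = SI.finsum_cls[folded sym_alg_def]

lemma comm_monoid_sym_alg: "comm_monoid (sym_alg scale)"
proof (rule comm_monoidI)
  fix x y assume "x \<in> carrier (sym_alg scale)" "y \<in> carrier (sym_alg scale)"
  then obtain f g where "x = scls f" "y = scls g" by auto
  then show "x \<otimes>\<^bsub>sym_alg scale\<^esub> y = y \<otimes>\<^bsub>sym_alg scale\<^esub> x"
    by (simp add: scls_eq_iff poly_of_mult mult.commute)
qed (auto simp: mult.assoc)

text \<open>
  The representatives do not commute, so only the polynomial of a product over a set is determined.
\<close>

lemma finprod_scls:
  assumes "finite A"
  shows "\<exists>h. finprod (sym_alg scale) (\<lambda>i. scls (f i)) A = scls h \<and> poly_of h = (\<Prod>i\<in>A. poly_of (f i))"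
  using assms
proof (induction A rule: finite_induct)
  case empty
  interpret comm_monoid "sym_alg scale" by (rule comm_monoid_sym_alg)
  show ?case by (auto intro!: exI[of _ 1] simp: poly_of_1)
next
  case (insert i A)
  interpret comm_monoid "sym_alg scale" by (rule comm_monoid_sym_alg)
  obtain h where "finprod (sym_alg scale) (\<lambda>i. scls (f i)) A = scls h" "poly_of h = (\<Prod>i\<in>A. poly_of (f i))"
    using insert.IH by blast
  then show ?case
    using insert.hyps by (auto intro!: exI[of _ "f i * h"] simp: poly_of_mult)
qed

text \<open>
  Transport of a differential operator \<open>A\<close> on the polynomial ring to the classes. It is enough that
  \<open>F\<close> and \<open>A\<close> correspond under \<open>poly_of\<close>.
\<close>

lemma diff_op_sym_algI:
  assumes A: "klin A" "dorder (Suc p) A"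
    and F: "\<And>g. \<exists>h. F (scls g) = scls h \<and> poly_of h = A (poly_of g)"
  shows "diff_op (sym_alg scale) p F"
proof -
  obtain H where H: "\<And>g. F (scls g) = scls (H g)" "\<And>g. poly_of (H g) = A (poly_of g)"
    using F by metis
  have lin: "klinear (sym_alg scale) (sym_alg scale) F"
    unfolding klinear_def
    by (auto simp: H scls_eq_iff klin_add[OF klin_poly_of] klin_cst[OF klin_poly_of] klin_add[OF A(1)] klin_cst[OF A(1)])
  have "(\<Oplus>\<^bsub>sym_alg scale\<^esub>T\<in>Pow {1..p+1}.
           ((- 1) ^ card T) \<odot>\<^bsub>sym_alg scale\<^esub>
             ((\<Otimes>\<^bsub>sym_alg scale\<^esub>i\<in>{1..p+1} - T. a i) \<otimes>\<^bsub>sym_alg scale\<^esub>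
                F ((\<Otimes>\<^bsub>sym_alg scale\<^esub>i\<in>T. a i) \<otimes>\<^bsub>sym_alg scale\<^esub> b)))
        = \<zero>\<^bsub>sym_alg scale\<^esub>"
    if a: "a \<in> {1..p+1} \<rightarrow> carrier (sym_alg scale)" and b: "b \<in> carrier (sym_alg scale)" for a b
  proof -
    interpret S: comm_monoid "sym_alg scale" by (rule comm_monoid_sym_alg)
    interpret SA: abelian_monoid "sym_alg scale"
      using SI.abelian_monoid_quot_alg by (simp only: sym_alg_def)
    define f where "f = (\<lambda>i. SOME f. a i = scls f)"
    have f: "a i = scls (f i)" if "i \<in> {1..p+1}" for i
    proof -
      have "a i \<in> range scls" using a that unfolding Pi_iff sym_simps by blast
      then have "\<exists>f. a i = scls f" by blast
      then show ?thesis unfolding f_def by (rule someI_ex)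
    qed
    obtain g where g: "b = scls g" using b by auto
    define P where "P = (\<lambda>T. SOME h. finprod (sym_alg scale) (\<lambda>i. scls (f i)) T = scls h
        \<and> poly_of h = (\<Prod>i\<in>T. poly_of (f i)))"
    have P: "finprod (sym_alg scale) a T = scls (P T)" "poly_of (P T) = (\<Prod>i\<in>T. poly_of (f i))"
      if T: "T \<subseteq> {1..p+1}" for T
    proof -
      have "finite T" using T finite_subset by blast
      from someI_ex[OF finprod_scls[OF this, of f]]
      have 1: "finprod (sym_alg scale) (\<lambda>i. scls (f i)) T = scls (P T)"
        and 2: "poly_of (P T) = (\<Prod>i\<in>T. poly_of (f i))" by (simp_all add: P_def)
      have "finprod (sym_alg scale) a T = finprod (sym_alg scale) (\<lambda>i. scls (f i)) T"
        by (rule S.finprod_cong') (use T f in auto)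
      then show "finprod (sym_alg scale) a T = scls (P T)" using 1 by simp
      show "poly_of (P T) = (\<Prod>i\<in>T. poly_of (f i))" by (rule 2)
    qed
    define t where "t = (\<lambda>T. cst ((- 1) ^ card T) * (P ({1..p+1} - T) * H (P T * g)))"
    have "(\<Oplus>\<^bsub>sym_alg scale\<^esub>T\<in>Pow {1..p+1}.
           ((- 1) ^ card T) \<odot>\<^bsub>sym_alg scale\<^esub>
             ((\<Otimes>\<^bsub>sym_alg scale\<^esub>i\<in>{1..p+1} - T. a i) \<otimes>\<^bsub>sym_alg scale\<^esub>
                F ((\<Otimes>\<^bsub>sym_alg scale\<^esub>i\<in>T. a i) \<otimes>\<^bsub>sym_alg scale\<^esub> b)))
       = (\<Oplus>\<^bsub>sym_alg scale\<^esub>T\<in>Pow {1..p+1}. scls (t T))"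
      by (rule SA.finsum_cong') (auto simp: P(1) g H(1) t_def)
    also have "\<dots> = scls (\<Sum>T\<in>Pow {1..p+1}. t T)"
      by (rule finsum_scls)
    also have "\<dots> = scls 0"
    proof -
      have cm: "cst ((- 1) ^ n) = ((- 1) ^ n :: 'g multiset \<Rightarrow>\<^sub>0 'k)" for n
        by (induction n) (simp_all add: cst_uminus)
      have "poly_of (\<Sum>T\<in>Pow {1..p+1}. t T) = (\<Sum>T\<in>Pow {1..p+1}. (- 1) ^ card T *
          (prod (\<lambda>i. poly_of (f i)) ({1..p+1} - T) * A (prod (\<lambda>i. poly_of (f i)) T * poly_of g)))"
        unfolding klin_sum[OF klin_poly_of]
        by (rule sum.cong[OF refl]) (auto simp: t_def poly_of_mult poly_of_cst cm P(2) H(2))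
      also have "\<dots> = 0"
        by (rule dorder_alternating_sum) (use A(2) in \<open>simp_all del: dorder.simps\<close>)
      finally show ?thesis by (simp add: scls_eq_0_iff)
    qed
    finally show ?thesis by simp
  qed
  then show ?thesis
    unfolding diff_op_def using lin by blast
qed

text \<open>
  The components are unique because the homogeneous parts of a polynomial are.
\<close>

lemma sym_component_scls: "sym_component scale (scls f) = (\<lambda>d. scls (tcomp d f))"
proof -
  obtain N where N: "\<And>w. w \<in> keys f \<Longrightarrow> length (letters w) \<le> N"
    using free_alg_length_bound by blast
  define D where "D = {d. scls (tcomp d f) \<noteq> scls 0}"
  have D: "D \<subseteq> {..N}"
  proof
    fix d assume "d \<in> D"
    then have "tcomp d f \<noteq> 0" by (auto simp: D_def)
    then obtain w where "lookup (tcomp d f) w \<noteq> 0" by (metis lookup_zero poly_mapping_eqI)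
    then show "d \<in> {..N}" using N[of w] by (auto simp: lookup_tcomp in_keys_iff split: if_splits)
  qed
  have finD: "finite D" using D finite_subset by blast
  show ?thesis
    unfolding sym_component_def Let_def
  proof (rule the_equality, intro conjI allI)
    fix d
    show "scls (tcomp d f) \<in> sym_degree scale d"
      unfolding sym_degree_def
      by (auto intro!: exI[of _ "tcomp d f"] simp: in_keys_iff lookup_tcomp split: if_splits)
    show "finite {d. scls (tcomp d f) \<noteq> \<zero>\<^bsub>sym_alg scale\<^esub>}"
      using finD by (simp add: D_def)
    have "poly_of (\<Sum>d\<in>D. tcomp d f) = poly_of (\<Sum>d\<le>N. tcomp d f)"
      unfolding klin_sum[OF klin_poly_of]
      by (rule sum.mono_neutral_left) (use D in \<open>auto simp: D_def scls_eq_0_iff\<close>)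
    then have "scls f = scls (\<Sum>d\<in>D. tcomp d f)"
      using tcomp_decompose[of f N] N by (simp add: scls_eq_iff)
    then show "scls f = (\<Oplus>\<^bsub>sym_alg scale\<^esub>d\<in>{d. scls (tcomp d f) \<noteq> \<zero>\<^bsub>sym_alg scale\<^esub>}. scls (tcomp d f))"
      by (simp add: finsum_scls D_def)
  next
    fix c assume c: "(\<forall>d. c d \<in> sym_degree scale d) \<and> finite {d. c d \<noteq> \<zero>\<^bsub>sym_alg scale\<^esub>} \<and>
        scls f = (\<Oplus>\<^bsub>sym_alg scale\<^esub>d\<in>{d. c d \<noteq> \<zero>\<^bsub>sym_alg scale\<^esub>}. c d)"
    then have "\<forall>d. \<exists>g. c d = scls g \<and> (\<forall>w\<in>keys g. length (letters w) = d)"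
      unfolding sym_degree_def by blast
    then obtain g where g: "\<And>d. c d = scls (g d)" "\<And>d w. w \<in> keys (g d) \<Longrightarrow> length (letters w) = d"
      by metis
    define E where "E = {d. c d \<noteq> \<zero>\<^bsub>sym_alg scale\<^esub>}"
    have finE: "finite E" using c by (simp add: E_def)
    have homg: "poly_of (g d) = pcomp (int d) (poly_of (g d))" for d
    proof -
      have "tcomp d (g d) = g d"
        by (rule poly_mapping_eqI) (use g(2) in \<open>auto simp: lookup_tcomp in_keys_iff\<close>)
      then show ?thesis using poly_of_tcomp[of d "g d"] by simp
    qed
    have homog: "homog (int d) (poly_of (g d))" for d
      using homog_pcomp[of "int d" "poly_of (g d)"] homg[of d] by simp
    have "scls f = scls (\<Sum>d\<in>E. g d)"
      using c by (simp add: E_def g(1) finsum_scls)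
    then have pf: "poly_of f = (\<Sum>d\<in>E. poly_of (g d))"
      by (simp add: scls_eq_iff klin_sum[OF klin_poly_of])
    have "poly_of (g d) = pcomp (int d) (poly_of f)" for d
    proof -
      have "pcomp (int d) (poly_of f) = (\<Sum>j\<in>E. if d = j then poly_of (g d) else 0)"
        unfolding pf klin_sum[OF klin_pcomp]
        by (rule sum.cong) (auto simp: pcomp_homog[OF homog])
      also have "\<dots> = (if d \<in> E then poly_of (g d) else 0)"
        using finE by simp
      also have "\<dots> = poly_of (g d)"
        by (auto simp: E_def g(1) scls_eq_0_iff)
      finally show ?thesis by simp
    qed
    then show "c = (\<lambda>d. scls (tcomp d f))"
      by (intro ext) (simp add: g(1) scls_eq_iff poly_of_tcomp)
  qed
qed

end

context lie_algebra_0
begin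

abbreviation ucls :: "('k, 'g) free_alg \<Rightarrow> ('k, 'g) free_alg set" where
  "ucls \<equiv> EI.cls"

lemmas env_simps [simp] = EI.quot_alg_simps[folded env_alg_def]

text \<open>
  Uniqueness: a linear map is determined by its values on words. Existence: \<open>symz\<close> respects the
  relations.
\<close>

lemma symmetrization_scls: "symmetrization scale bracket (scls f) = ucls (symz f)"
proof -
  define e0 where "e0 = (\<lambda>x\<in>carrier (sym_alg scale). ucls (symz (SOME f. x = scls f)))"
  have e0: "e0 (scls f) = ucls (symz f)" for f
  proof -
    have "scls f = scls (SOME g. scls f = scls g)"
      by (rule someI_ex) blast
    then have "f - (SOME g. scls f = scls g) \<in> sym_ideal scale"
      by (simp only: SI.cls_eq_iff)
    then have "symz (f - (SOME g. scls f = scls g)) \<in> env_ideal scale bracket"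
      by (rule ET.symz_mem)
    then have "ucls (symz f) = ucls (symz (SOME g. scls f = scls g))"
      by (simp add: EI.cls_eq_iff klin_diff[OF klin_symz])
    then show ?thesis by (simp add: e0_def)
  qed
  have Sprod: "list_prod (sym_alg scale) (map (sym_gen scale) gs) = scls (wd gs)" for gs
    using SI.list_prod_cls[of gs] by (simp add: sym_alg_def sym_gen_def[abs_def])
  have Uprod: "list_prod (env_alg scale bracket) (map (env_gen scale bracket) gs) = ucls (wd gs)" for gs
    using EI.list_prod_cls[of gs] by (simp add: env_alg_def env_gen_def[abs_def])
  have avg: "(1 / fact (length gs)) \<odot>\<^bsub>env_alg scale bracket\<^esub>
       (\<Oplus>\<^bsub>env_alg scale bracket\<^esub>\<sigma>\<in>{\<sigma>. \<sigma> permutes {..<length gs}}.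
          list_prod (env_alg scale bracket) (map (env_gen scale bracket) (permute_list \<sigma> gs)))
      = ucls (symz (wd gs))" for gs
    unfolding Uprod EI.finsum_cls[folded env_alg_def] env_simps symz_wd ..
  have "symmetrization scale bracket = e0"
    unfolding symmetrization_def Let_def avg Sprod
  proof (rule the_equality, intro conjI allI)
    show "e0 \<in> extensional (carrier (sym_alg scale))" by (simp add: e0_def)
    show "klinear (sym_alg scale) (env_alg scale bracket) e0"
      unfolding klinear_def by (auto simp: e0 klin_add[OF klin_symz] klin_cst[OF klin_symz])
    show "e0 (scls (wd gs)) = ucls (symz (wd gs))" for gs by (rule e0)
  next
    fix e assume e: "e \<in> extensional (carrier (sym_alg scale)) \<and>
        klinear (sym_alg scale) (env_alg scale bracket) e \<and>
        (\<forall>gs. e (scls (wd gs)) = ucls (symz (wd gs)))"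
    then have add: "e (scls (f + g)) = e (scls f) \<oplus>\<^bsub>env_alg scale bracket\<^esub> e (scls g)"
      and scal: "e (scls (cst c * f)) = c \<odot>\<^bsub>env_alg scale bracket\<^esub> e (scls f)" for f g c
      unfolding klinear_def by (metis rangeI sym_simps(1,3), metis rangeI sym_simps(1,6))
    have "f \<in> {f. e (scls f) = ucls (symz f)}" for f
    proof (rule free_alg_induct)
      have "e (scls (cst 0 * wd [])) = 0 \<odot>\<^bsub>env_alg scale bracket\<^esub> ucls (symz (wd []))"
        unfolding scal using e by (simp only:)
      then have "e (scls 0) = ucls 0" by (simp only: env_simps cst_0 mult_zero_left)
      then show "subsp {f. e (scls f) = ucls (symz f)}"
        by (simp add: subsp_def add scal klin_0[OF klin_symz] klin_add[OF klin_symz] klin_cst[OF klin_symz])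
    qed (use e in auto)
    then have "e (scls f) = e0 (scls f)" for f by (simp add: e0)
    then show "e = e0"
      using e by (intro extensionalityI[of e "carrier (sym_alg scale)" e0]) (auto simp: e0_def)
  qed
  then show ?thesis by (simp add: e0)
qed

lemma B_op_scls: "\<exists>h. B_op scale bracket (scls f) (scls g) = scls h \<and> poly_of h = star f g"
proof -
  obtain h where h: "poly_of h = star f g" "symz h - symz f * symz g \<in> env_ideal scale bracket"
    using symz_surj unfolding star_def by blast
  have "inj_on (symmetrization scale bracket) (carrier (sym_alg scale))"
  proof (rule inj_onI)
    fix x y assume "x \<in> carrier (sym_alg scale)" "y \<in> carrier (sym_alg scale)"
      and eq: "symmetrization scale bracket x = symmetrization scale bracket y"
    then obtain f g where x: "x = scls f" and y: "y = scls g" by auto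
    then have "symz f - symz g \<in> env_ideal scale bracket"
      using eq by (simp add: symmetrization_scls EI.cls_eq_iff)
    then have "act (symz f - symz g) = 0" by (rule act_env_ideal)
    then show "x = y"
      by (simp add: x y scls_eq_iff klin_diff[OF klin_act] act_symz)
  qed
  moreover have "symmetrization scale bracket (scls h)
      = symmetrization scale bracket (scls f) \<otimes>\<^bsub>env_alg scale bracket\<^esub> symmetrization scale bracket (scls g)"
    using h(2) by (simp add: symmetrization_scls EI.cls_eq_iff)
  ultimately have "B_op scale bracket (scls f) (scls g) = scls h"
    unfolding B_op_def Let_def by (intro the_inv_into_f_eq) auto
  then show ?thesis using h(1) by blast
qed

text \<open>
  The pairs of degrees with a vanishing component and those with \<open>m + n < p\<close> contribute \<open>0\<close> to
  the double sum on the right.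
\<close>

lemma B_comp_scls:
  assumes M: "\<And>w. w \<in> keys f \<Longrightarrow> length (letters w) \<le> M"
    and N: "\<And>w. w \<in> keys g \<Longrightarrow> length (letters w) \<le> N"
  shows "\<exists>h. B_comp scale bracket p (scls f) (scls g) = scls h \<and>
     poly_of h = (\<Sum>m\<le>M. \<Sum>n\<le>N. pcomp (int m + int n - int p) (star (tcomp m f) (tcomp n g)))"
proof -
  have "\<forall>m n. \<exists>h. B_op scale bracket (scls (tcomp m f)) (scls (tcomp n g)) = scls h
      \<and> poly_of h = star (tcomp m f) (tcomp n g)"
    using B_op_scls by blast
  then obtain H where H: "\<And>m n. B_op scale bracket (scls (tcomp m f)) (scls (tcomp n g)) = scls (H m n)"
      "\<And>m n. poly_of (H m n) = star (tcomp m f) (tcomp n g)"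
    by metis
  define J where "J = {(m, n). scls (tcomp m f) \<noteq> scls 0 \<and> scls (tcomp n g) \<noteq> scls 0 \<and> p \<le> m + n}"
  define t where "t = (\<lambda>(m, n). tcomp (m + n - p) (H m n))"
  define s where "s = (\<lambda>(m, n). pcomp (int m + int n - int p) (star (tcomp m f) (tcomp n g)))"
  have bound: "n \<le> K" if "scls (tcomp n h) \<noteq> scls 0" "\<And>w. w \<in> keys h \<Longrightarrow> length (letters w) \<le> K" for n h K
  proof -
    have "tcomp n h \<noteq> 0" using that(1) by auto
    then obtain w where "lookup (tcomp n h) w \<noteq> 0" by (metis lookup_zero poly_mapping_eqI)
    then show ?thesis using that(2)[of w] by (auto simp: lookup_tcomp in_keys_iff split: if_splits)
  qed
  have J: "J \<subseteq> {..M} \<times> {..N}"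
    unfolding J_def using bound[OF _ M] bound[OF _ N] by blast
  have "B_comp scale bracket p (scls f) (scls g) = finsum (sym_alg scale) (\<lambda>x. scls (t x)) J"
    unfolding B_comp_def Let_def sym_component_scls H(1) J_def t_def
    by (simp add: case_prod_unfold)
  then have 1: "B_comp scale bracket p (scls f) (scls g) = scls (\<Sum>x\<in>J. t x)"
    by (simp add: finsum_scls)
  have "poly_of (\<Sum>x\<in>J. t x) = (\<Sum>x\<in>J. s x)"
    unfolding klin_sum[OF klin_poly_of]
  proof (rule sum.cong[OF refl])
    fix x assume "x \<in> J"
    then obtain m n where x: "x = (m, n)" and "p \<le> m + n" by (auto simp: J_def)
    then have "int (m + n - p) = int m + int n - int p" by auto
    then show "poly_of (t x) = s x" by (simp only: x t_def s_def prod.case poly_of_tcomp H(2))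
  qed
  also have "\<dots> = (\<Sum>x\<in>{..M} \<times> {..N}. s x)"
  proof (rule sum.mono_neutral_left)
    show "\<forall>x\<in>{..M} \<times> {..N} - J. s x = 0"
    proof
      fix x assume "x \<in> {..M} \<times> {..N} - J"
      then obtain m n where x: "x = (m, n)" and "(m, n) \<notin> J" by auto
      then consider "tcomp m f \<in> sym_ideal scale" | "tcomp n g \<in> sym_ideal scale" | "m + n < p"
        by (auto simp: J_def SI.cls_0_iff)
      then show "s x = 0"
      proof cases
        case 3
        then have "int m + int n - int p < 0" by linarith
        then show ?thesis unfolding x s_def prod.case by (rule homog_neg[OF homog_pcomp])
      qed (simp_all add: x s_def star_sym_ideal klin_0[OF klin_pcomp])
    qed
  qed (use J in auto)
  also have "\<dots> = (\<Sum>m\<le>M. \<Sum>n\<le>N. pcomp (int m + int n - int p) (star (tcomp m f) (tcomp n g)))"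
    by (simp add: s_def sum.cartesian_product)
  finally show ?thesis using 1 by blast
qed

lemma B_comp_diff_op:
  assumes "a \<in> carrier (sym_alg scale)"
  shows "diff_op (sym_alg scale) p (\<lambda>b. B_comp scale bracket p a b)"
    and "diff_op (sym_alg scale) p (\<lambda>b. B_comp scale bracket p b a)"
proof -
  obtain f where a: "a = scls f" using assms by auto
  obtain M where M: "\<And>w. w \<in> keys f \<Longrightarrow> length (letters w) \<le> M"
    using free_alg_length_bound by blast
  obtain A where A: "klin A" "dorder (Suc p) A"
      "\<And>N g. (\<forall>w\<in>keys g. length (letters w) \<le> N) \<Longrightarrow>
          (\<Sum>m\<le>M. \<Sum>n\<le>N. pcomp (int m + int n - int p) (star (tcomp m f) (tcomp n g))) = A (poly_of g)"
    using star_left_operator[where p = p and M = M and f = f] by blast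
  show "diff_op (sym_alg scale) p (\<lambda>b. B_comp scale bracket p a b)"
  proof (rule diff_op_sym_algI[OF A(1,2)])
    fix g :: "('k, 'g) free_alg"
    obtain N where N: "\<And>w. w \<in> keys g \<Longrightarrow> length (letters w) \<le> N"
      using free_alg_length_bound by blast
    show "\<exists>h. B_comp scale bracket p a (scls g) = scls h \<and> poly_of h = A (poly_of g)"
      using B_comp_scls[of f M g N p, OF M N] A(3)[of g N] N by (simp add: a)
  qed
  obtain A' where A': "klin A'" "dorder (Suc p) A'"
      "\<And>N g. (\<forall>w\<in>keys g. length (letters w) \<le> N) \<Longrightarrow>
          (\<Sum>m\<le>M. \<Sum>n\<le>N. pcomp (int m + int n - int p) (star (tcomp n g) (tcomp m f))) = A' (poly_of g)"
    using star_right_operator[where p = p and M = M and f = f] by blast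
  show "diff_op (sym_alg scale) p (\<lambda>b. B_comp scale bracket p b a)"
  proof (rule diff_op_sym_algI[OF A'(1,2)])
    fix g :: "('k, 'g) free_alg"
    obtain N where N: "\<And>w. w \<in> keys g \<Longrightarrow> length (letters w) \<le> N"
      using free_alg_length_bound by blast
    have "(\<Sum>n\<le>N. \<Sum>m\<le>M. pcomp (int n + int m - int p) (star (tcomp n g) (tcomp m f))) = A' (poly_of g)"
      using A'(3)[of g N] N by (subst sum.swap) (simp add: add.commute)
    then show "\<exists>h. B_comp scale bracket p (scls g) a = scls h \<and> poly_of h = A' (poly_of g)"
      using B_comp_scls[of g N f M p, OF N M] by (simp add: a)
  qed
qed

end

theorem theorem2p2:
  fixes scale :: "'k::field_char_0 \<Rightarrow> 'g::ab_group_add \<Rightarrow> 'g"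
    and bracket :: "'g \<Rightarrow> 'g \<Rightarrow> 'g"
    and a :: "('k, 'g) free_alg set"
    and p :: nat
    and F :: "('k, 'g) free_alg set \<Rightarrow> ('k, 'g) free_alg set"
  assumes "lie_algebra scale bracket"
    and "a \<in> carrier (sym_alg scale)"
    and "p \<ge> 1"
    and "F = (\<lambda>b. B_comp scale bracket p a b) \<or> F = (\<lambda>b. B_comp scale bracket p b a)"
  shows "diff_op (sym_alg scale) p F"
proof -
  interpret lie_algebra_0 scale bracket
    using assms(1) by (rule lie_algebra_0.intro)
  show ?thesis
    using assms(4) B_comp_diff_op[OF assms(2)] by auto
qed

end
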